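(* Let $D$ be a divisor of degree $0$ on a curve $C$ over the finite field $k$, with $k$-rational points $P_1,\dots,P_N$, and for each $i$ let $\varphi_i$ be a rational function on $C$ whose divisor has the same order at $P_i$ as $D$. Suppose $f_1,f_2$ are distinct rational sections of $L_D$ of degrees $h_1,h_2$. Then the words $$\bigl((\varphi_1f_j)(P_1),\dots,(\varphi_Nf_j)(P_N)\bigr)\in(\mathbf{P}^1(k))^N\qquad(j=1,2)$$ agree on at most $h_1+h_2$ coordinates. In particular, for each integer $h$ with $0\le h<N/2$, the code $\mathcal{C}_D(h)$ has minimal distance at least $N-2h$.
   Context: A curve over $k$ is a smooth, projective, geometrically irreducible algebraic curve; $N$ is its number of $k$-rational points. All divisors and functions are defined over $k$. $\mathbf{P}^1(k)=k\cup\{\infty\}$; a rational function takes the value $\infty$ at its poles. For a degree-zero divisor $D$, a rational section of the line bundle $L_D$ is a rational function $f$ on $C$. If $f\ne0$, its degree as a section is the degree of the positive part (equivalently, of the negative part) of the degree-zero divisor $(f)+D$; the zero section has degree $0$. $\mathcal{C}_D(h)$ is the set of rational sections of $L_D$ of degree at most $h$, regarded as a code of length $N$ over the alphabet $\mathbf{P}^1(k)$ by identifying $f$ with the word $\bigl((\varphi_1f)(P_1),\dots,(\varphi_Nf)(P_N)\bigr)$. The minimal distance is the least Hamming distance between the words associated to two distinct elements of $\mathcal{C}_D(h)$. *)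

theory Defs
  imports
    "HOL-Analysis.Cartesian_Space"
    "HOL-Algebra.Algebraic_Closure_Type"
    "HOL-Algebra.Finite_Extensions"
    "HOL-Algebra.Generated_Fields"
    "HOL-Library.Poly_Mapping"
    "HOL-Library.Extended_Nat"
begin

section \<open>Polynomials in several variables\<close>

text \<open>The variables are indexed by a finite type \<open>'n\<close>; a monomial is its exponent vector.\<close>

type_synonym ('n, 'a) mpol = "('n \<Rightarrow>\<^sub>0 nat) \<Rightarrow>\<^sub>0 'a"

definition mpol_eval :: "('n::finite, 'a::field) mpol \<Rightarrow> 'a ^ 'n \<Rightarrow> 'a" where
  "mpol_eval F v =
    (\<Sum>m\<in>Poly_Mapping.keys F. Poly_Mapping.lookup F m * (\<Prod>i\<in>UNIV. (v $ i) ^ Poly_Mapping.lookup m i))"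

definition mpol_const :: "'a::field \<Rightarrow> ('n, 'a) mpol" where
  "mpol_const c = Poly_Mapping.single 0 c"

definition homogeneous :: "nat \<Rightarrow> ('n::finite, 'a::field) mpol \<Rightarrow> bool" where
  "homogeneous d F \<longleftrightarrow> (\<forall>m\<in>Poly_Mapping.keys F. (\<Sum>i\<in>UNIV. Poly_Mapping.lookup m i) = d)"

text \<open>The subtraction of exponents is truncated, which is harmless: the coefficient is then \<open>0\<close>.\<close>

definition mpol_pderiv :: "'n \<Rightarrow> ('n, 'a::field) mpol \<Rightarrow> ('n, 'a) mpol" where
  "mpol_pderiv i F =
    (\<Sum>m\<in>Poly_Mapping.keys F.
       Poly_Mapping.single (m - Poly_Mapping.single i 1)
         (of_nat (Poly_Mapping.lookup m i) * Poly_Mapping.lookup F m))"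

definition gradient :: "('n::finite, 'a::field) mpol \<Rightarrow> 'a ^ 'n \<Rightarrow> 'a ^ 'n" where
  "gradient F v = (\<chi> i. mpol_eval (mpol_pderiv i F) v)"

definition base_change :: "('n, 'k::field) mpol \<Rightarrow> ('n, 'k alg_closure) mpol" where
  "base_change F = Poly_Mapping.map to_ac F"


section \<open>Projective space and its Zariski topology\<close>

text \<open>A point of projective space of dimension \<open>CARD('n) - 1\<close> is the set of all its vectors of
  homogeneous coordinates, i.e. a line through the origin with the origin removed.\<close>

type_synonym ('a, 'n) ppoint = "('a ^ 'n) set"

definition proj_point :: "'a::field ^ 'n::finite \<Rightarrow> ('a, 'n) ppoint" where
  "proj_point v = {c *s v | c. c \<noteq> 0}"

definition proj_space :: "('a::field, 'n::finite) ppoint set" where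
  "proj_space = {proj_point v | v. v \<noteq> 0}"

definition vanishes_on :: "('a::field, 'n::finite) ppoint set \<Rightarrow> ('n, 'a) mpol \<Rightarrow> bool" where
  "vanishes_on Z F \<longleftrightarrow> (\<forall>P\<in>Z. \<forall>v\<in>P. mpol_eval F v = 0)"

definition zero_locus :: "('n::finite, 'a::field) mpol set \<Rightarrow> ('a, 'n) ppoint set" where
  "zero_locus S = {P \<in> proj_space. \<forall>F\<in>S. \<forall>v\<in>P. mpol_eval F v = 0}"

definition zariski_closed :: "('a::field, 'n::finite) ppoint set \<Rightarrow> bool" where
  "zariski_closed Z \<longleftrightarrow> (\<exists>S. (\<forall>F\<in>S. \<exists>d. homogeneous d F) \<and> Z = zero_locus S)"

definition zariski_irreducible :: "('a::field, 'n::finite) ppoint set \<Rightarrow> bool" where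
  "zariski_irreducible Z \<longleftrightarrow> Z \<noteq> {} \<and>
    \<not> (\<exists>A B. zariski_closed A \<and> zariski_closed B \<and> A \<subset> Z \<and> B \<subset> Z \<and> Z = A \<union> B)"


section \<open>The function field of a projective variety\<close>

text \<open>A rational function on \<open>V\<close> is a class of fractions \<open>F/G\<close> of homogeneous polynomials of equal
  degree with \<open>G\<close> not vanishing identically on \<open>V\<close>; the fractions \<open>F/G\<close> and \<open>F'/G'\<close> are identified
  if \<open>F G' - F' G\<close> vanishes on \<open>V\<close>.\<close>

type_synonym ('n, 'a) ratfun = "(('n, 'a) mpol \<times> ('n, 'a) mpol) set"

definition fractions :: "('a::field, 'n::finite) ppoint set \<Rightarrow> (('n, 'a) mpol \<times> ('n, 'a) mpol) set" where
  "fractions V = {(F, G). (\<exists>d. homogeneous d F \<and> homogeneous d G) \<and> \<not> vanishes_on V G}"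

definition ratfun_of ::
    "('a::field, 'n::finite) ppoint set \<Rightarrow> ('n, 'a) mpol \<Rightarrow> ('n, 'a) mpol \<Rightarrow> ('n, 'a) ratfun" where
  "ratfun_of V F G = {(F', G') \<in> fractions V. vanishes_on V (F * G' - F' * G)}"

definition function_field :: "('a::field, 'n::finite) ppoint set \<Rightarrow> ('n, 'a) ratfun ring" where
  "function_field V = \<lparr>
     carrier = {ratfun_of V F G | F G. (F, G) \<in> fractions V},
     monoid.mult = (\<lambda>f g. \<Union>(F, G)\<in>f. \<Union>(F', G')\<in>g. ratfun_of V (F * F') (G * G')),
     monoid.one = ratfun_of V 1 1,
     ring.zero = ratfun_of V 0 1,
     ring.add = (\<lambda>f g. \<Union>(F, G)\<in>f. \<Union>(F', G')\<in>g. ratfun_of V (F * G' + F' * G) (G * G'))\<rparr>"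

definition constant_functions :: "('a::field, 'n::finite) ppoint set \<Rightarrow> ('n, 'a) ratfun set" where
  "constant_functions V = {ratfun_of V (mpol_const c) 1 | c. True}"

text \<open>The dimension of a variety is the transcendence degree of its function field over the
  constants; here a single element is required to be a transcendence basis.\<close>

definition has_dimension_one :: "('a::field, 'n::finite) ppoint set \<Rightarrow> bool" where
  "has_dimension_one V \<longleftrightarrow>
    (\<exists>x\<in>carrier (function_field V).
       ring.transcendental (function_field V) (constant_functions V) x \<and>
       (\<forall>y\<in>carrier (function_field V).
          ring.algebraic (function_field V)
            (generate_field (function_field V) (insert x (constant_functions V))) y))"


section \<open>Local rings, orders and values\<close>

definition regular_at :: "('a::field, 'n::finite) ppoint \<Rightarrow> ('n, 'a) ratfun \<Rightarrow> bool" where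
  "regular_at P f \<longleftrightarrow> (\<exists>(F, G)\<in>f. \<exists>v\<in>P. mpol_eval G v \<noteq> 0)"

definition value_at :: "('a::field, 'n::finite) ppoint \<Rightarrow> ('n, 'a) ratfun \<Rightarrow> 'a" where
  "value_at P f =
    (THE c. \<exists>(F, G)\<in>f. \<exists>v\<in>P. mpol_eval G v \<noteq> 0 \<and> c = mpol_eval F v / mpol_eval G v)"

definition local_ring ::
    "('a::field, 'n::finite) ppoint set \<Rightarrow> ('a, 'n) ppoint \<Rightarrow> ('n, 'a) ratfun set" where
  "local_ring V P = {f \<in> carrier (function_field V). regular_at P f}"

definition max_ideal ::
    "('a::field, 'n::finite) ppoint set \<Rightarrow> ('a, 'n) ppoint \<Rightarrow> ('n, 'a) ratfun set" where
  "max_ideal V P = {f \<in> local_ring V P. value_at P f = 0}"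

definition uniformizer ::
    "('a::field, 'n::finite) ppoint set \<Rightarrow> ('a, 'n) ppoint \<Rightarrow> ('n, 'a) ratfun \<Rightarrow> bool" where
  "uniformizer V P t \<longleftrightarrow> t \<in> carrier (function_field V) \<and>
     max_ideal V P = {t \<otimes>\<^bsub>function_field V\<^esub> g | g. g \<in> local_ring V P}"

text \<open>At a smooth point of a curve the local ring is a discrete valuation ring; \<open>ord_at\<close> is its
  normalized valuation. It is meaningful for nonzero rational functions only.\<close>

definition ord_at ::
    "('a::field, 'n::finite) ppoint set \<Rightarrow> ('a, 'n) ppoint \<Rightarrow> ('n, 'a) ratfun \<Rightarrow> int" where
  "ord_at V P f =
    (THE n. \<exists>t u. uniformizer V P t \<and> u \<in> local_ring V P - max_ideal V P \<and>
       f = u \<otimes>\<^bsub>function_field V\<^esub> (t [^]\<^bsub>function_field V\<^esub> (n::int)))"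

text \<open>The projective line is modelled by \<open>option\<close>, with \<open>None\<close> as the point at infinity.\<close>

definition value_P1 ::
    "('a::field, 'n::finite) ppoint set \<Rightarrow> ('a, 'n) ppoint \<Rightarrow> ('n, 'a) ratfun \<Rightarrow> 'a option" where
  "value_P1 V P f =
    (if f \<noteq> \<zero>\<^bsub>function_field V\<^esub> \<and> ord_at V P f < 0 then None else Some (value_at P f))"

definition P1_rational :: "'k::field alg_closure option set" where
  "P1_rational = insert None (Some ` range to_ac)"


section \<open>Curves over a field\<close>

text \<open>A projective scheme over \<open>'k\<close> is given by a set \<open>E\<close> of homogeneous equations with coefficients
  in \<open>'k\<close>. Geometric notions refer to its points over the algebraic closure. Smoothness is the
  Jacobian criterion for the given equations: the gradients (rows of the homogeneous Jacobian
  matrix) have rank \<open>CARD('n) - 1 - 1\<close> at every geometric point. In particular the scheme is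
  geometrically reduced, so that its functions are determined on geometric points.\<close>

definition geom_points :: "('n::finite, 'k::field) mpol set \<Rightarrow> ('k alg_closure, 'n) ppoint set" where
  "geom_points E = zero_locus (base_change ` E)"

definition smooth_dim_one :: "('n::finite, 'k::field) mpol set \<Rightarrow> bool" where
  "smooth_dim_one E \<longleftrightarrow>
    (\<forall>P\<in>geom_points E. \<forall>v\<in>P.
       vec.dim ((\<lambda>F. gradient (base_change F) v) ` E) + 2 = CARD('n))"

definition curve :: "('n::finite, 'k::field) mpol set \<Rightarrow> bool" where
  "curve E \<longleftrightarrow> (\<forall>F\<in>E. \<exists>d. homogeneous d F) \<and>
     zariski_irreducible (geom_points E) \<and> has_dimension_one (geom_points E) \<and> smooth_dim_one E"

definition rational_points :: "('n::finite, 'k::field) mpol set \<Rightarrow> ('k alg_closure, 'n) ppoint set" where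
  "rational_points E = {P \<in> geom_points E. \<exists>v\<in>P. \<forall>i. v $ i \<in> range to_ac}"

definition rational_functions :: "('n::finite, 'k::field) mpol set \<Rightarrow> ('n, 'k alg_closure) ratfun set" where
  "rational_functions E =
    {ratfun_of (geom_points E) (base_change F) (base_change G) | F G.
       (base_change F, base_change G) \<in> fractions (geom_points E)}"


section \<open>Divisors\<close>

definition galois_group :: "('k::field alg_closure \<Rightarrow> 'k alg_closure) set" where
  "galois_group = {\<sigma>. bij \<sigma> \<and> (\<forall>x y. \<sigma> (x + y) = \<sigma> x + \<sigma> y) \<and> (\<forall>x y. \<sigma> (x * y) = \<sigma> x * \<sigma> y) \<and>
     (\<forall>c. \<sigma> (to_ac c) = to_ac c)}"

definition galois_act :: "('a \<Rightarrow> 'a) \<Rightarrow> ('a, 'n::finite) ppoint \<Rightarrow> ('a, 'n) ppoint" where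
  "galois_act \<sigma> P = (\<lambda>v. \<chi> i. \<sigma> (v $ i)) ` P"

text \<open>A divisor over a perfect field \<open>'k\<close> is a Galois-invariant divisor on the geometric points: a
  closed point corresponds to the sum of the geometric points over it, and its degree is the
  number of these. So no residue degrees occur in \<open>div_degree\<close>.\<close>

definition divisor ::
    "('n::finite, 'k::field) mpol set \<Rightarrow> (('k alg_closure, 'n) ppoint \<Rightarrow> int) \<Rightarrow> bool" where
  "divisor E D \<longleftrightarrow> finite {P. D P \<noteq> 0} \<and> {P. D P \<noteq> 0} \<subseteq> geom_points E \<and>
     (\<forall>\<sigma>\<in>galois_group. \<forall>P\<in>geom_points E. D (galois_act \<sigma> P) = D P)"

definition div_degree :: "('p \<Rightarrow> int) \<Rightarrow> int" where
  "div_degree D = (\<Sum>P | D P \<noteq> 0. D P)"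

definition principal_divisor ::
    "('a::field, 'n::finite) ppoint set \<Rightarrow> ('n, 'a) ratfun \<Rightarrow> ('a, 'n) ppoint \<Rightarrow> int" where
  "principal_divisor V f P = (if P \<in> V then ord_at V P f else 0)"


section \<open>Rational sections and the codes\<close>

definition section_degree ::
    "('a::field, 'n::finite) ppoint set \<Rightarrow> (('a, 'n) ppoint \<Rightarrow> int) \<Rightarrow> ('n, 'a) ratfun \<Rightarrow> int" where
  "section_degree V D f =
    (if f = \<zero>\<^bsub>function_field V\<^esub> then 0
     else div_degree (\<lambda>P. max 0 (principal_divisor V f P + D P)))"

definition section_code ::
    "('n::finite, 'k::field) mpol set \<Rightarrow> (('k alg_closure, 'n) ppoint \<Rightarrow> int) \<Rightarrow> int
      \<Rightarrow> ('n, 'k alg_closure) ratfun set" where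
  "section_code E D h = {f \<in> rational_functions E. section_degree (geom_points E) D f \<le> h}"

text \<open>Coordinates are numbered from \<open>1\<close>; only those in \<open>{1..N}\<close> matter.\<close>

definition word ::
    "('a::field, 'n::finite) ppoint set \<Rightarrow> (nat \<Rightarrow> ('a, 'n) ppoint) \<Rightarrow> (nat \<Rightarrow> ('n, 'a) ratfun)
      \<Rightarrow> ('n, 'a) ratfun \<Rightarrow> nat \<Rightarrow> 'a option" where
  "word V P \<phi> f i = value_P1 V (P i) (\<phi> i \<otimes>\<^bsub>function_field V\<^esub> f)"

definition hamming_dist :: "nat \<Rightarrow> (nat \<Rightarrow> 'b) \<Rightarrow> (nat \<Rightarrow> 'b) \<Rightarrow> nat" where
  "hamming_dist N w w' = card {i \<in> {1..N}. w i \<noteq> w' i}"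

text \<open>The minimum over pairs of distinct elements of \<open>A\<close>; it is \<open>\<infinity>\<close> if there is no such pair.\<close>

definition minimal_distance :: "nat \<Rightarrow> ('s \<Rightarrow> nat \<Rightarrow> 'b) \<Rightarrow> 's set \<Rightarrow> enat" where
  "minimal_distance N w A =
    Inf {enat (hamming_dist N (w f) (w g)) | f g. f \<in> A \<and> g \<in> A \<and> f \<noteq> g}"

end

theory Submission
  imports Defs
begin

text \<open>
  The idea of the proof is as follows. Let \<open>f1\<close>, \<open>f2\<close> be distinct sections and let \<open>n1\<close>, \<open>n2\<close> be the
  polar parts of the divisors \<open>(f1) + D\<close>, \<open>(f2) + D\<close>. Suppose that the words agree at the point \<open>P\<close>.
  Then either both sections have a pole at \<open>P\<close>, so that \<open>n1\<close> and \<open>n2\<close> are positive at \<open>P\<close>, or both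
  are regular with the same value and \<open>(f1 - f2) + D\<close> is positive at \<open>P\<close>. In each case
  \<open>(f1 - f2) + D \<ge> [P] - n1 - n2\<close> at \<open>P\<close>, and without \<open>[P]\<close> this holds at all points. Principal divisors
  have degree zero; so \<open>D\<close> being of degree zero, the number of agreements is at most the degree of
  \<open>n1 + n2\<close>, which is the sum of the degrees of the sections (\<open>agreement_bound\<close>). The other
  coordinates are counted by the Hamming distance.

  The work lies in \<open>degree_principal_eq_0\<close>, to be shown for a curve given by equations. It is enough that
  \<open>f\<close> has no more zeros than poles (\<open>zeros_le_poles\<close>). Weak approximation gives a function \<open>e\<^sub>P\<^sub>a\<close> for
  every zero \<open>P\<close> of \<open>f\<close> and every \<open>a\<close> less than its order, with order \<open>a\<close> at \<open>P\<close> and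
  large order at the other zeros. The products \<open>f ^ j * e\<^sub>P\<^sub>a\<close> are linearly independent over the
  constants (\<open>local_basis_independent\<close>). Those with \<open>j \<le> l\<close> lie in a space of functions with bounded
  poles, whose dimension is at most \<open>l\<close> times the number of poles of \<open>f\<close> plus a constant
  (\<open>riemann_roch_space_le_span\<close>). Compare for large \<open>l\<close>.

  This argument is carried out in the locale \<open>valuations\<close>, whose assumptions are verified for a
  projective curve with generic point \<open>y\<close> in the locale \<open>projective_curve\<close>. Dimension one is used
  in the form that any two functions are algebraically dependent (\<open>algebraic_over_related\<close>).
  \<^item> Local rings are discrete valuation rings: by the Jacobian condition and Euler's relation the
    maximal ideal is spanned by one element modulo its square (\<open>jacobian_cotangent\<close>), hence principal
    by \<open>nakayama\<close>; and algebraic dependence on a uniformizer bounds the order (\<open>unit_times_power\<close>).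
  \<^item> Zeros are finite in number, as their coordinates are roots of polynomials obtained from algebraic
    dependence (\<open>finite_zeros\<close>).
  \<^item> Functions without poles are constant (\<open>regular_everywhere_const\<close>): a subalgebra which contains
    \<open>1 / f\<close> and is maximal without \<open>f\<close> is a valuation ring (\<open>exists_valuation_ring\<close>), and the generic
    point specializes along it to a point at which \<open>f\<close> is not regular.
  \<^item> Points are separated by quotients of linear forms (\<open>exists_separating_function\<close>).

  Finally, words have entries in the projective line over the finite field because the value of a
  rational function at a rational point is fixed by Frobenius (\<open>value_at_rational\<close>).
\<close>

section \<open>Divisors on a field with valuations\<close>


locale coefficient_field =
  fixes \<iota> :: "'a::field \<Rightarrow> 'f::field"
  assumes iota_add [simp]: "\<iota> (a + b) = \<iota> a + \<iota> b"
    and iota_mult [simp]: "\<iota> (a * b) = \<iota> a * \<iota> b"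
    and iota_one [simp]: "\<iota> 1 = 1"
begin

lemma iota_zero [simp]: "\<iota> 0 = 0"
  using iota_add[of 0 0] by (metis add_0 add_cancel_left_left)

lemma iota_uminus [simp]: "\<iota> (- a) = - \<iota> a"
  using iota_add[of "- a" a] by (simp add: eq_neg_iff_add_eq_0)

lemma iota_diff [simp]: "\<iota> (a - b) = \<iota> a - \<iota> b"
  using iota_add[of a "- b"] by simp

lemma iota_eq_0_iff [simp]: "\<iota> a = 0 \<longleftrightarrow> a = 0"
proof
  assume "\<iota> a = 0"
  show "a = 0"
  proof (rule ccontr)
    assume "a \<noteq> 0"
    then have "\<iota> (a * inverse a) = 1" by simp
    then show False unfolding iota_mult using \<open>\<iota> a = 0\<close> by simp
  qed
qed simp

lemma iota_eq_iff [simp]: "\<iota> a = \<iota> b \<longleftrightarrow> a = b"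
  using iota_eq_0_iff[of "a - b"] by simp

lemma iota_power [simp]: "\<iota> (a ^ n) = \<iota> a ^ n"
  by (induction n) simp_all

lemma iota_inverse [simp]: "\<iota> (inverse a) = inverse (\<iota> a)"
proof (cases "a = 0")
  case False
  then have "\<iota> (a * inverse a) = 1" by simp
  then show ?thesis unfolding iota_mult by (metis inverse_unique)
qed simp

lemma iota_divide [simp]: "\<iota> (a / b) = \<iota> a / \<iota> b"
  by (simp add: divide_inverse)

lemma iota_sum: "\<iota> (sum g A) = (\<Sum>x\<in>A. \<iota> (g x))"
  by (induction A rule: infinite_finite_induct) simp_all

lemma iota_prod: "\<iota> (prod g A) = (\<Prod>x\<in>A. \<iota> (g x))"
  by (induction A rule: infinite_finite_induct) simp_all

sublocale vs: vector_space "\<lambda>c f. \<iota> c * f"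
  by unfold_locales (simp_all add: algebra_simps)

(* against iota_mult this rule makes the simplifier loop *)
declare vs.scale_scale [simp del]

lemma independent_family_card_le:
  assumes "finite T" "finite B" "\<And>i. i \<in> T \<Longrightarrow> b i \<in> vs.span B"
    and indep: "\<And>c i. (\<Sum>i\<in>T. \<iota> (c i) * b i) = 0 \<Longrightarrow> i \<in> T \<Longrightarrow> c i = 0"
  shows "card T \<le> card B"
proof -
  have inj: "inj_on b T"
  proof (rule inj_onI, rule ccontr)
    fix i j assume ij: "i \<in> T" "j \<in> T" "b i = b j" "i \<noteq> j"
    let ?c = "\<lambda>l. (if l = i then 1 else 0) - (if l = j then 1 else 0) :: 'a"
    have "(\<Sum>l\<in>T. \<iota> (?c l) * b l) = (\<Sum>l\<in>T. (if l = i then b i else 0)) - (\<Sum>l\<in>T. (if l = j then b j else 0))"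
      unfolding sum_subtractf[symmetric] by (intro sum.cong) auto
    also have "\<dots> = 0" using ij \<open>finite T\<close> by simp
    finally have "?c i = 0" by (rule indep) (rule ij(1))
    then show False using ij by simp
  qed
  have "vs.independent (b ` T)"
  proof (rule vs.independent_if_scalars_zero)
    fix g x assume g: "(\<Sum>x\<in>b ` T. \<iota> (g x) * x) = 0" "x \<in> b ` T"
    then obtain i where i: "i \<in> T" "x = b i" by auto
    have "(\<Sum>i\<in>T. \<iota> (g (b i)) * b i) = 0" using g(1) inj by (simp add: sum.reindex)
    from indep[OF this i(1)] show "g x = 0" using i by simp
  qed (use assms in simp)
  then have "card (b ` T) \<le> card B"
    using vs.independent_span_bound[of B "b ` T"] assms by auto
  then show ?thesis using card_image[OF inj] by simp
qed

end

text \<open>The valuations of a function field at the points \<open>C\<close> of a complete smooth curve. The assumption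
  \<open>v_global\<close> expresses completeness; \<open>v_separate\<close> and \<open>v_uniformizer\<close> together give weak
  approximation.\<close>

locale valuations = coefficient_field \<iota> for \<iota> :: "'a::field \<Rightarrow> 'f::field" +
  fixes C :: "'p set" and v :: "'p \<Rightarrow> 'f \<Rightarrow> int"
  assumes v_mult: "P \<in> C \<Longrightarrow> f \<noteq> 0 \<Longrightarrow> g \<noteq> 0 \<Longrightarrow> v P (f * g) = v P f + v P g"
    and v_add: "P \<in> C \<Longrightarrow> f \<noteq> 0 \<Longrightarrow> g \<noteq> 0 \<Longrightarrow> f + g \<noteq> 0 \<Longrightarrow> min (v P f) (v P g) \<le> v P (f + g)"
    and v_const: "P \<in> C \<Longrightarrow> c \<noteq> 0 \<Longrightarrow> v P (\<iota> c) = 0"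
    and v_residue: "P \<in> C \<Longrightarrow> f \<noteq> 0 \<Longrightarrow> 0 \<le> v P f \<Longrightarrow> \<exists>c. f = \<iota> c \<or> 1 \<le> v P (f - \<iota> c)"
    and v_finite: "f \<noteq> 0 \<Longrightarrow> finite {P \<in> C. v P f \<noteq> 0}"
    and v_global: "f \<noteq> 0 \<Longrightarrow> (\<And>P. P \<in> C \<Longrightarrow> 0 \<le> v P f) \<Longrightarrow> f \<in> range \<iota>"
    and v_separate: "finite S \<Longrightarrow> S \<subseteq> C \<Longrightarrow> P \<in> S \<Longrightarrow>
        \<exists>g. g \<noteq> 0 \<and> v P g = 0 \<and> (\<forall>Q\<in>S - {P}. 1 \<le> v Q g)"
    and v_uniformizer: "P \<in> C \<Longrightarrow> \<exists>t. t \<noteq> 0 \<and> v P t = 1"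
begin

lemma v_one: "P \<in> C \<Longrightarrow> v P 1 = 0"
  using v_const[of P 1] by simp

lemma v_power: "P \<in> C \<Longrightarrow> f \<noteq> 0 \<Longrightarrow> v P (f ^ n) = int n * v P f"
  by (induction n) (simp_all add: v_one v_mult algebra_simps)

lemma v_inverse: "P \<in> C \<Longrightarrow> f \<noteq> 0 \<Longrightarrow> v P (inverse f) = - v P f"
  using v_mult[of P f "inverse f"] v_one[of P] by simp

lemma v_uminus: "P \<in> C \<Longrightarrow> f \<noteq> 0 \<Longrightarrow> v P (- f) = v P f"
  using v_mult[of P f "\<iota> (-1)"] v_const[of P "-1"] by simp

text \<open>The valuation of \<open>0\<close> counts as infinite in \<open>at_least\<close>.\<close>

definition at_least :: "'p \<Rightarrow> int \<Rightarrow> 'f \<Rightarrow> bool" where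
  "at_least P n f \<longleftrightarrow> f = 0 \<or> n \<le> v P f"

lemma at_least_0 [simp]: "at_least P n 0"
  by (simp add: at_least_def)

lemma at_least_mono: "at_least P n f \<Longrightarrow> m \<le> n \<Longrightarrow> at_least P m f"
  by (auto simp: at_least_def)

lemma at_least_add: "P \<in> C \<Longrightarrow> at_least P n f \<Longrightarrow> at_least P n g \<Longrightarrow> at_least P n (f + g)"
  unfolding at_least_def using v_add[of P f g] by (cases "f = 0"; cases "g = 0"; cases "f + g = 0") auto

lemma at_least_uminus: "P \<in> C \<Longrightarrow> at_least P n f \<Longrightarrow> at_least P n (- f)"
  unfolding at_least_def using v_uminus[of P f] by (cases "f = 0") auto

lemma at_least_diff: "P \<in> C \<Longrightarrow> at_least P n f \<Longrightarrow> at_least P n g \<Longrightarrow> at_least P n (f - g)"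
  using at_least_add[of P n f "- g"] at_least_uminus by simp

lemma at_least_mult: "P \<in> C \<Longrightarrow> at_least P m f \<Longrightarrow> at_least P n g \<Longrightarrow> at_least P (m + n) (f * g)"
  unfolding at_least_def using v_mult[of P f g] by (cases "f = 0"; cases "g = 0") auto

lemma at_least_const: "P \<in> C \<Longrightarrow> at_least P 0 (\<iota> c)"
  by (cases "c = 0") (auto simp: at_least_def v_const)

lemma at_least_sum: "P \<in> C \<Longrightarrow> (\<And>i. i \<in> I \<Longrightarrow> at_least P n (f i)) \<Longrightarrow> at_least P n (sum f I)"
  by (induction I rule: infinite_finite_induct) (auto intro: at_least_add)

definition riemann_roch_space :: "('p \<Rightarrow> int) \<Rightarrow> 'f set" where
  "riemann_roch_space D = {f. \<forall>P\<in>C. at_least P (- D P) f}"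

text \<open>If two functions have the same pole order at \<open>P\<close>, then the residue of their quotient there is a
  constant, and subtracting this multiple of one from the other lowers the pole order. So one more
  point in \<open>D\<close> costs at most one dimension; without points only the constants are left.\<close>

lemma riemann_roch_space_le_span:
  assumes "finite {P\<in>C. 0 < D P}" "(\<Sum>P | P \<in> C \<and> 0 < D P. D P) = int s"
  shows "\<exists>B. finite B \<and> card B \<le> Suc s \<and> riemann_roch_space D \<subseteq> vs.span B"
  using assms
proof (induction s arbitrary: D)
  case 0
  have nonpos: "D P \<le> 0" if "P \<in> C" for P
  proof (rule ccontr)
    assume "\<not> D P \<le> 0"
    then have "0 < (\<Sum>P | P \<in> C \<and> 0 < D P. D P)"
      using 0(1) that by (intro sum_pos2[of _ P]) auto
    then show False using 0(2) by simp
  qed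
  have "f \<in> range \<iota>" if f: "f \<in> riemann_roch_space D" for f
  proof (cases "f = 0")
    case True
    then show ?thesis using iota_zero by (metis rangeI)
  next
    case False
    show ?thesis
    proof (rule v_global[OF False])
      fix P assume "P \<in> C"
      then have "- D P \<le> v P f" "D P \<le> 0" using f False nonpos by (auto simp: riemann_roch_space_def at_least_def)
      then show "0 \<le> v P f" by simp
    qed
  qed
  then have "riemann_roch_space D \<subseteq> vs.span {1}"
    unfolding vs.span_singleton by auto
  then show ?case by (intro exI[of _ "{1}"]) auto
next
  case (Suc s)
  have "{P\<in>C. 0 < D P} \<noteq> {}"
  proof
    assume "{P\<in>C. 0 < D P} = {}"
    then have "(\<Sum>P | P \<in> C \<and> 0 < D P. D P) = 0" by (intro sum.neutral) blast
    then show False using Suc(3) by simp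
  qed
  then obtain P where P: "P \<in> C" "0 < D P" by auto
  define D' where "D' = D(P := D P - 1)"
  have "(\<Sum>Q | Q \<in> C \<and> 0 < D' Q. D' Q) = (\<Sum>Q | Q \<in> C \<and> 0 < D Q. D' Q)"
    using P Suc(2) by (intro sum.mono_neutral_left) (auto simp: D'_def split: if_splits)
  also have "\<dots> = D' P + (\<Sum>Q \<in> {Q. Q \<in> C \<and> 0 < D Q} - {P}. D' Q)"
    using P Suc(2) by (intro sum.remove) auto
  also have "(\<Sum>Q \<in> {Q. Q \<in> C \<and> 0 < D Q} - {P}. D' Q) = (\<Sum>Q \<in> {Q. Q \<in> C \<and> 0 < D Q} - {P}. D Q)"
    by (intro sum.cong) (auto simp: D'_def)
  also have "D' P + \<dots> = (D P + (\<Sum>Q \<in> {Q. Q \<in> C \<and> 0 < D Q} - {P}. D Q)) - 1"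
    by (simp add: D'_def)
  also have "D P + (\<Sum>Q \<in> {Q. Q \<in> C \<and> 0 < D Q} - {P}. D Q) = (\<Sum>Q | Q \<in> C \<and> 0 < D Q. D Q)"
    using P Suc(2) by (intro sum.remove[symmetric]) auto
  finally have "(\<Sum>Q | Q \<in> C \<and> 0 < D' Q. D' Q) = int s" using Suc(3) by simp
  moreover have "finite {Q\<in>C. 0 < D' Q}"
    by (rule finite_subset[OF _ Suc(2)]) (use P in \<open>auto simp: D'_def split: if_splits\<close>)
  ultimately obtain B where B: "finite B" "card B \<le> Suc s" "riemann_roch_space D' \<subseteq> vs.span B"
    using Suc(1) by blast
  show ?case
  proof (cases "riemann_roch_space D \<subseteq> riemann_roch_space D'")
    case True
    then show ?thesis using B by (intro exI[of _ B]) auto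
  next
    case False
    then obtain g where g: "g \<in> riemann_roch_space D" "g \<notin> riemann_roch_space D'" by blast
    have g0: "g \<noteq> 0" using g by (auto simp: riemann_roch_space_def)
    have vg: "v P g = - D P"
    proof -
      obtain Q where Q: "Q \<in> C" "\<not> at_least Q (- D' Q) g" using g(2) by (auto simp: riemann_roch_space_def)
      have gD: "at_least Q (- D Q) g" "at_least P (- D P) g"
        using g(1) Q(1) P(1) by (auto simp: riemann_roch_space_def)
      have "Q = P" using Q(2) gD(1) by (auto simp: D'_def split: if_splits)
      then show ?thesis using Q(2) gD g0 by (auto simp: D'_def at_least_def)
    qed
    have "f \<in> vs.span (insert g B)" if f: "f \<in> riemann_roch_space D" for f
    proof -
      have "\<exists>c. f - \<iota> c * g \<in> riemann_roch_space D'"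
      proof (cases "f = 0")
        case True
        then show ?thesis by (intro exI[of _ 0]) (simp add: riemann_roch_space_def)
      next
        case f0: False
        have vf: "- D P \<le> v P f" using f f0 P by (auto simp: riemann_roch_space_def at_least_def)
        have "v P (f * inverse g) = v P f - v P g" using f0 g0 P by (simp add: v_mult v_inverse)
        then have "0 \<le> v P (f * inverse g)" using vf vg by simp
        then obtain c where "f * inverse g = \<iota> c \<or> 1 \<le> v P (f * inverse g - \<iota> c)"
          using v_residue[OF P(1), of "f * inverse g"] f0 g0 by auto
        then have "at_least P 1 (f * inverse g - \<iota> c)" by (auto simp: at_least_def)
        then have "at_least P (1 + (- D P)) ((f * inverse g - \<iota> c) * g)"
          using P vg by (intro at_least_mult) (auto simp: at_least_def)
        also have "(f * inverse g - \<iota> c) * g = f - \<iota> c * g" using g0 by (simp add: field_simps)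
        finally have 1: "at_least P (- D' P) (f - \<iota> c * g)" by (simp add: D'_def)
        have "at_least Q (- D Q) (f - \<iota> c * g)" if "Q \<in> C" for Q
        proof (rule at_least_diff[OF that])
          show "at_least Q (- D Q) f" using f that by (simp add: riemann_roch_space_def)
          have "at_least Q (0 + - D Q) (\<iota> c * g)"
            using that g by (intro at_least_mult at_least_const) (auto simp: riemann_roch_space_def)
          then show "at_least Q (- D Q) (\<iota> c * g)" by simp
        qed
        then have "at_least Q (- D' Q) (f - \<iota> c * g)" if "Q \<in> C" for Q
          using 1 that by (cases "Q = P") (auto simp: D'_def)
        then show ?thesis by (auto simp: riemann_roch_space_def)
      qed
      then obtain c where "f - \<iota> c * g \<in> vs.span B" using B by auto
      then show ?thesis using vs.span_breakdown_eq by blast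
    qed
    then show ?thesis using B
      by (intro exI[of _ "insert g B"]) (auto simp: card_insert_if)
  qed
qed

text \<open>A high power of a function that separates \<open>P\<close> from the other points outweighs the orders which
  a power of a uniformizer at \<open>P\<close> has there.\<close>

lemma exists_local_order:
  assumes S: "finite S" "S \<subseteq> C" "P \<in> S"
  shows "\<exists>e. e \<noteq> 0 \<and> v P e = int a \<and> (\<forall>Q\<in>S - {P}. m \<le> v Q e)"
proof -
  obtain t where t: "t \<noteq> 0" "v P t = 1" using v_uniformizer S by blast
  obtain g where g: "g \<noteq> 0" "v P g = 0" "\<forall>Q\<in>S - {P}. 1 \<le> v Q g"
    using v_separate[OF S] by blast
  define M where "M = (\<Sum>Q\<in>S. nat \<bar>m\<bar> + a * nat \<bar>v Q t\<bar>)"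
  have "m \<le> v Q (t ^ a * g ^ M)" if Q: "Q \<in> S - {P}" for Q
  proof -
    have "nat \<bar>m\<bar> + a * nat \<bar>v Q t\<bar> \<le> M"
      unfolding M_def using Q S by (intro member_le_sum) auto
    then have "int (nat \<bar>m\<bar> + a * nat \<bar>v Q t\<bar>) \<le> int M" by (simp only: of_nat_le_iff)
    then have "\<bar>m\<bar> + int a * \<bar>v Q t\<bar> \<le> int M" by simp
    moreover have "int M * 1 \<le> int M * v Q g" using g(3) Q by (intro mult_left_mono) auto
    moreover have "int a * (- \<bar>v Q t\<bar>) \<le> int a * v Q t" by (intro mult_left_mono) auto
    moreover have "v Q (t ^ a * g ^ M) = int a * v Q t + int M * v Q g"
    proof -
      have "Q \<in> C" using Q S by auto
      then show ?thesis using t g by (simp add: v_mult v_power)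
    qed
    ultimately show ?thesis by simp
  qed
  moreover have "v P (t ^ a * g ^ M) = int a"
  proof -
    have "P \<in> C" using S by auto
    then show ?thesis using t g by (simp add: v_mult v_power)
  qed
  ultimately show ?thesis using t g by (intro exI[of _ "t ^ a * g ^ M"]) auto
qed


text \<open>Let \<open>j\<close> be the least power of \<open>f\<close> that occurs in a relation, with the coefficient of \<open>e (P, a)\<close>
  nonzero, and \<open>a\<close> least possible for this \<open>P\<close>. Then this term has order \<open>j * v P f + a\<close> at \<open>P\<close>
  and all the others have larger order.\<close>

lemma local_basis_independent:
  fixes c :: "('p \<times> nat) \<times> nat \<Rightarrow> 'a"
  assumes Z: "finite Z" "Z \<subseteq> C" "\<And>P. P \<in> Z \<Longrightarrow> 0 < v P f" and f: "f \<noteq> 0"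
    and e: "\<And>P a. P \<in> Z \<Longrightarrow> a < nat (v P f) \<Longrightarrow>
              e (P, a) \<noteq> 0 \<and> v P (e (P, a)) = int a \<and> (\<forall>Q\<in>Z - {P}. v Q f \<le> v Q (e (P, a)))"
    and rel: "(\<Sum>(i, j)\<in>(SIGMA P:Z. {..<nat (v P f)}) \<times> {..l}. \<iota> (c (i, j)) * (f ^ j * e i)) = 0"
    and i: "i \<in> (SIGMA P:Z. {..<nat (v P f)})" "j \<le> l"
  shows "c (i, j) = 0"
proof (rule ccontr)
  define I where "I = (SIGMA P:Z. {..<nat (v P f)})"
  assume "c (i, j) \<noteq> 0"
  then have ex: "\<exists>j\<le>l. \<exists>i\<in>I. c (i, j) \<noteq> 0" using i by (auto simp: I_def)
  define j0 where "j0 = (LEAST j. j \<le> l \<and> (\<exists>i\<in>I. c (i, j) \<noteq> 0))"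
  have "j0 \<le> l \<and> (\<exists>i\<in>I. c (i, j0) \<noteq> 0)" unfolding j0_def using ex by (rule LeastI_ex)
  then obtain P a where Pa: "j0 \<le> l" "(P, a) \<in> I" "c ((P, a), j0) \<noteq> 0" by auto
  have low_j: "c (i, j) = 0" if "j < j0" "i \<in> I" for i j
    using not_less_Least[OF that(1)[unfolded j0_def]] that Pa(1) by auto
  define a0 where "a0 = (LEAST a. (P, a) \<in> I \<and> c ((P, a), j0) \<noteq> 0)"
  have a0: "(P, a0) \<in> I" "c ((P, a0), j0) \<noteq> 0"
    using LeastI[of "\<lambda>a. (P, a) \<in> I \<and> c ((P, a), j0) \<noteq> 0" a] Pa unfolding a0_def by auto
  have low_a: "c ((P, a), j0) = 0" if "a < a0" "(P, a) \<in> I" for a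
    using not_less_Least[OF that(1)[unfolded a0_def]] that by auto
  have P: "P \<in> Z" "P \<in> C" and a0n: "int a0 < v P f" using a0 Z by (auto simp: I_def)
  define n where "n = int j0 * v P f + int a0"
  define trm where "trm = (\<lambda>(i, j). \<iota> (c (i, j)) * (f ^ j * e i))"
  have others: "at_least P (n + 1) (trm x)" if x: "x \<in> I \<times> {..l} - {((P, a0), j0)}" for x
  proof -
    obtain Q b k where xeq: "x = ((Q, b), k)" by (metis surj_pair)
    have Qb: "(Q, b) \<in> I" "Q \<in> Z" "b < nat (v Q f)" using x xeq by (auto simp: I_def)
    have nz: "e (Q, b) \<noteq> 0" using e Qb by blast
    have pow: "v P (f ^ k * e (Q, b)) = int k * v P f + v P (e (Q, b))"
      using P f nz by (simp add: v_mult v_power)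
    have ve: "0 \<le> v P (e (Q, b))"
      using e[OF Qb(2,3)] P Z(3)[OF P(1)] by (cases "Q = P") force+
    have "c ((Q, b), k) = 0 \<or> n + 1 \<le> int k * v P f + v P (e (Q, b))"
    proof (cases k j0 rule: linorder_cases)
      case less
      then show ?thesis using low_j Qb by blast
    next
      case greater
      then have "int (j0 + 1) * v P f \<le> int k * v P f" using Z(3)[OF P(1)] by (intro mult_right_mono) auto
      then show ?thesis using ve a0n by (simp add: n_def algebra_simps)
    next
      case equal
      show ?thesis
      proof (cases "Q = P")
        case True
        then have "b \<noteq> a0" using x xeq equal by auto
        moreover have "v P (e (Q, b)) = int b" using e[OF Qb(2,3)] True by blast
        ultimately show ?thesis using low_a[of b] Qb True equal by (cases "b < a0") (auto simp: n_def)
      next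
        case False
        then have "v P f \<le> v P (e (Q, b))" using e[OF Qb(2,3)] P by blast
        then show ?thesis using equal a0n by (simp add: n_def)
      qed
    qed
    then show ?thesis
    proof
      assume "n + 1 \<le> int k * v P f + v P (e (Q, b))"
      then have "at_least P (0 + (n + 1)) (\<iota> (c ((Q, b), k)) * (f ^ k * e (Q, b)))"
        using P pow by (intro at_least_mult[of P 0] at_least_const) (simp_all add: at_least_def)
      then show ?thesis by (simp add: trm_def xeq)
    qed (simp add: trm_def xeq)
  qed
  have finI: "finite I" unfolding I_def using Z by auto
  have "(\<Sum>x\<in>I \<times> {..l}. trm x) = 0" using rel by (simp add: trm_def I_def)
  moreover have "(\<Sum>x\<in>I \<times> {..l}. trm x) = trm ((P, a0), j0) + (\<Sum>x\<in>I \<times> {..l} - {((P, a0), j0)}. trm x)"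
    using finI a0 Pa by (intro sum.remove) auto
  ultimately have "trm ((P, a0), j0) = - (\<Sum>x\<in>I \<times> {..l} - {((P, a0), j0)}. trm x)"
    by (simp add: eq_neg_iff_add_eq_0)
  then have "at_least P (n + 1) (trm ((P, a0), j0))"
    using at_least_uminus[OF P(2) at_least_sum[of P _ "n + 1" trm, OF P(2) others]] by metis
  moreover have "e (P, a0) \<noteq> 0" "v P (e (P, a0)) = int a0" using e[of P a0] a0 P by (auto simp: I_def)
  then have "v P (trm ((P, a0), j0)) = n" "trm ((P, a0), j0) \<noteq> 0"
    using P f a0(2) by (simp_all add: trm_def n_def v_mult v_power v_const)
  ultimately show False by (simp add: at_least_def)
qed

text \<open>The functions \<open>f ^ j * e i\<close> with \<open>j \<le> l\<close>, where \<open>i\<close> runs through as many indices as \<open>f\<close> has zeros,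
  are independent. Their poles are bounded by \<open>l\<close> times the poles of \<open>f\<close> plus a fixed divisor \<open>c\<close>, and
  this bounds their number. The inequality \<open>bound\<close> so obtained is divided by \<open>l\<close>, for large \<open>l\<close>.\<close>

lemma zeros_le_poles:
  assumes f: "f \<noteq> 0"
  shows "(\<Sum>P | P \<in> C \<and> v P f \<noteq> 0. max 0 (v P f)) \<le> (\<Sum>P | P \<in> C \<and> v P f \<noteq> 0. max 0 (- v P f))"
proof -
  define Z where "Z = {P \<in> C. 0 < v P f}"
  define I where "I = (SIGMA P:Z. {..<nat (v P f)})"
  have Z: "finite Z" "Z \<subseteq> C" "\<And>P. P \<in> Z \<Longrightarrow> 0 < v P f"
    by (auto simp: Z_def intro: finite_subset[OF _ v_finite[OF f]])
  have finI: "finite I" using Z by (auto simp: I_def)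
  define m where "m = (\<Sum>Q\<in>Z. v Q f)"
  have m: "v Q f \<le> m" if "Q \<in> Z" for Q
    unfolding m_def using that Z by (intro member_le_sum) (auto intro: less_imp_le)
  have "\<exists>x. \<forall>i\<in>I. x i \<noteq> 0 \<and> v (fst i) (x i) = int (snd i) \<and> (\<forall>Q\<in>Z - {fst i}. m \<le> v Q (x i))"
    by (rule bchoice) (use exists_local_order[OF Z(1,2)] in \<open>auto simp: I_def\<close>)
  then obtain e where e: "\<And>i. i \<in> I \<Longrightarrow> e i \<noteq> 0 \<and> v (fst i) (e i) = int (snd i) \<and> (\<forall>Q\<in>Z - {fst i}. m \<le> v Q (e i))"
    by blast
  define T where "T = {P \<in> C. v P f \<noteq> 0} \<union> (\<Union>i\<in>I. {P \<in> C. v P (e i) \<noteq> 0})"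
  have finT: "finite T" using v_finite f e finI by (auto simp: T_def)
  have TC: "T \<subseteq> C" by (auto simp: T_def)
  define \<beta> where "\<beta> = (\<Sum>Q\<in>T. max 0 (- v Q f))"
  define c where "c Q = (\<Sum>i\<in>I. max 0 (- v Q (e i)))" for Q
  define \<gamma> where "\<gamma> = (\<Sum>Q\<in>T. c Q)"
  have c0: "0 \<le> c Q" for Q unfolding c_def by (intro sum_nonneg) auto
  have \<beta>0: "0 \<le> \<beta>" unfolding \<beta>_def by (intro sum_nonneg) auto
  have \<gamma>0: "0 \<le> \<gamma>" unfolding \<gamma>_def by (intro sum_nonneg c0)
  have bound: "int (card I) * (int l + 1) \<le> 1 + int l * \<beta> + \<gamma>" for l :: nat
  proof -
    define D where "D Q = int l * max 0 (- v Q f) + c Q" for Q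
    have D0: "0 \<le> D Q" for Q using c0[of Q] by (simp add: D_def)
    have cT: "c Q = 0" if "Q \<in> C" "Q \<notin> T" for Q
      using that by (simp add: c_def T_def)
    have sub: "{Q \<in> C. 0 < D Q} \<subseteq> T" using cT by (auto simp: D_def T_def)
    have "(\<Sum>Q | Q \<in> C \<and> 0 < D Q. D Q) = (\<Sum>Q\<in>T. D Q)"
      using sub finT TC D0 by (intro sum.mono_neutral_left) (auto simp: less_le)
    also have "\<dots> = int l * \<beta> + \<gamma>"
      by (simp add: D_def \<beta>_def \<gamma>_def sum.distrib sum_distrib_left)
    finally have deg: "(\<Sum>Q | Q \<in> C \<and> 0 < D Q. D Q) = int (nat (int l * \<beta> + \<gamma>))"
      using \<beta>0 \<gamma>0 by simp
    obtain B where B: "finite B" "card B \<le> Suc (nat (int l * \<beta> + \<gamma>))" "riemann_roch_space D \<subseteq> vs.span B"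
      using riemann_roch_space_le_span[OF finite_subset[OF sub finT] deg] by blast
    have mem: "f ^ j * e i \<in> riemann_roch_space D" if ij: "i \<in> I" "j \<le> l" for i j
      unfolding riemann_roch_space_def
    proof (intro CollectI ballI)
      fix Q assume Q: "Q \<in> C"
      have "int j * max 0 (- v Q f) \<le> int l * max 0 (- v Q f)" using ij by (intro mult_right_mono) auto
      moreover have "int j * (- v Q f) \<le> int j * max 0 (- v Q f)" by (intro mult_left_mono) auto
      moreover have "max 0 (- v Q (e i)) \<le> c Q"
        unfolding c_def using ij finI by (intro member_le_sum) auto
      moreover have "v Q (f ^ j * e i) = int j * v Q f + v Q (e i)"
        using Q f e ij by (simp add: v_mult v_power)
      ultimately have "- D Q \<le> v Q (f ^ j * e i)" by (simp add: D_def)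
      then show "at_least Q (- D Q) (f ^ j * e i)" by (simp add: at_least_def)
    qed
    have "card (I \<times> {..l}) \<le> card B"
    proof (rule independent_family_card_le[where b = "\<lambda>(i, j). f ^ j * e i"])
      fix c x assume rel: "(\<Sum>x\<in>I \<times> {..l}. \<iota> (c x) * (case x of (i, j) \<Rightarrow> f ^ j * e i)) = 0"
        and x: "x \<in> I \<times> {..l}"
      have rel': "(\<Sum>(i, j)\<in>(SIGMA P:Z. {..<nat (v P f)}) \<times> {..l}. \<iota> (c (i, j)) * (f ^ j * e i)) = 0"
        using rel unfolding I_def[symmetric] by (simp add: case_prod_unfold)
      have e': "e (P, a) \<noteq> 0 \<and> v P (e (P, a)) = int a \<and> (\<forall>Q\<in>Z - {P}. v Q f \<le> v Q (e (P, a)))"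
        if "P \<in> Z" "a < nat (v P f)" for P a
      proof -
        have "(P, a) \<in> I" using that by (simp add: I_def)
        from e[OF this] show ?thesis using m by (auto intro: order.trans)
      qed
      have "c (fst x, snd x) = 0"
        by (rule local_basis_independent[OF Z f e' rel']) (use x in \<open>auto simp: I_def\<close>)
      then show "c x = 0" by simp
    qed (use finI B mem in auto)
    then have "card I * (l + 1) \<le> Suc (nat (int l * \<beta> + \<gamma>))" using B by (simp add: card_cartesian_product)
    then have "int (card I * (l + 1)) \<le> int (Suc (nat (int l * \<beta> + \<gamma>)))" by (simp only: of_nat_le_iff)
    then show ?thesis using \<beta>0 \<gamma>0 by (simp add: algebra_simps)
  qed
  have "int (card I) \<le> \<beta>"
  proof (rule ccontr)
    assume "\<not> int (card I) \<le> \<beta>"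
    then have "(\<beta> + 1) * (int (nat \<gamma> + 1) + 1) \<le> int (card I) * (int (nat \<gamma> + 1) + 1)"
      by (intro mult_right_mono) auto
    also have "\<dots> \<le> 1 + int (nat \<gamma> + 1) * \<beta> + \<gamma>" by (rule bound)
    finally show False using \<beta>0 \<gamma>0 by (simp add: algebra_simps)
  qed
  moreover have "int (card I) = (\<Sum>P | P \<in> C \<and> v P f \<noteq> 0. max 0 (v P f))"
  proof -
    have "int (card I) = (\<Sum>P\<in>Z. max 0 (v P f))"
      using Z by (auto simp: I_def card_SigmaI less_imp_le intro!: sum.cong)
    also have "\<dots> = (\<Sum>P | P \<in> C \<and> v P f \<noteq> 0. max 0 (v P f))"
      using v_finite[OF f] by (intro sum.mono_neutral_left) (auto simp: Z_def)
    finally show ?thesis .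
  qed
  moreover have "\<beta> = (\<Sum>P | P \<in> C \<and> v P f \<noteq> 0. max 0 (- v P f))"
    unfolding \<beta>_def using finT TC by (intro sum.mono_neutral_right) (auto simp: T_def)
  ultimately show ?thesis by simp
qed

text \<open>The zeros of \<open>1 / f\<close> are the poles of \<open>f\<close>.\<close>

theorem degree_principal_eq_0:
  assumes f: "f \<noteq> 0"
  shows "(\<Sum>P | P \<in> C \<and> v P f \<noteq> 0. v P f) = 0"
proof -
  let ?S = "{P \<in> C. v P f \<noteq> 0}"
  have S: "{P \<in> C. v P (inverse f) \<noteq> 0} = ?S" using f by (auto simp: v_inverse)
  have "(\<Sum>P\<in>?S. max 0 (- v P f)) \<le> (\<Sum>P\<in>?S. max 0 (v P f))"
  proof -
    have "(\<Sum>P\<in>?S. max 0 (v P (inverse f))) = (\<Sum>P\<in>?S. max 0 (- v P f))"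
      "(\<Sum>P\<in>?S. max 0 (- v P (inverse f))) = (\<Sum>P\<in>?S. max 0 (v P f))"
      using f by (auto simp: v_inverse intro!: sum.cong)
    then show ?thesis using zeros_le_poles[of "inverse f"] f unfolding S by simp
  qed
  then have "(\<Sum>P\<in>?S. max 0 (v P f)) - (\<Sum>P\<in>?S. max 0 (- v P f)) = 0"
    using zeros_le_poles[OF f] by simp
  moreover have "(\<Sum>P\<in>?S. max 0 (v P f)) - (\<Sum>P\<in>?S. max 0 (- v P f)) = (\<Sum>P\<in>?S. v P f)"
    unfolding sum_subtractf[symmetric] by (intro sum.cong) auto
  ultimately show ?thesis by simp
qed

definition pole_degree :: "('p \<Rightarrow> int) \<Rightarrow> 'f \<Rightarrow> 'p \<Rightarrow> int" where
  "pole_degree D f P = (if f = 0 then 0 else max 0 (- (v P f + D P)))"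

definition zero_degree :: "('p \<Rightarrow> int) \<Rightarrow> 'f \<Rightarrow> 'p \<Rightarrow> int" where
  "zero_degree D f P = (if f = 0 then 0 else max 0 (v P f + D P))"

lemma degree_principal_superset:
  assumes "f \<noteq> 0" "finite T" "T \<subseteq> C" "{P \<in> C. v P f \<noteq> 0} \<subseteq> T"
  shows "(\<Sum>P\<in>T. v P f) = 0"
proof -
  have "(\<Sum>P\<in>T. v P f) = (\<Sum>P | P \<in> C \<and> v P f \<noteq> 0. v P f)"
    using assms by (intro sum.mono_neutral_right) auto
  then show ?thesis using degree_principal_eq_0[OF assms(1)] by simp
qed

text \<open>At every point \<open>(f1 - f2) + D\<close> is bounded below by the indicator of \<open>A\<close> minus the polar parts of
  \<open>(f1) + D\<close> and \<open>(f2) + D\<close>: at a common pole because the polar parts are counted twice there, and at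
  the other points of \<open>A\<close> because the difference vanishes. Now take degrees.\<close>

theorem agreement_bound:
  assumes T: "finite T" "T \<subseteq> C" "{P \<in> C. D P \<noteq> 0} \<subseteq> T" and D: "(\<Sum>P\<in>T. D P) = 0"
    and T1: "f1 \<noteq> 0 \<Longrightarrow> {P \<in> C. v P f1 \<noteq> 0} \<subseteq> T" and T2: "f2 \<noteq> 0 \<Longrightarrow> {P \<in> C. v P f2 \<noteq> 0} \<subseteq> T"
    and neq: "f1 \<noteq> f2" and A: "A \<subseteq> T"
    and agree: "\<And>P. P \<in> A \<Longrightarrow>
      0 < pole_degree D f1 P \<and> 0 < pole_degree D f2 P \<or> at_least P (1 - D P) (f1 - f2)"
  shows "int (card A) \<le> (\<Sum>P\<in>T. zero_degree D f1 P) + (\<Sum>P\<in>T. zero_degree D f2 P)"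
proof -
  have balance: "(\<Sum>P\<in>T. zero_degree D f P) = (\<Sum>P\<in>T. pole_degree D f P)"
    if "f \<noteq> 0 \<Longrightarrow> {P \<in> C. v P f \<noteq> 0} \<subseteq> T" for f
  proof (cases "f = 0")
    case False
    have "(\<Sum>P\<in>T. zero_degree D f P) - (\<Sum>P\<in>T. pole_degree D f P) = (\<Sum>P\<in>T. v P f + D P)"
      unfolding sum_subtractf[symmetric]
      using False by (intro sum.cong) (auto simp: zero_degree_def pole_degree_def)
    also have "\<dots> = 0" using degree_principal_superset[OF False T(1,2)] that False D by (simp add: sum.distrib)
    finally show ?thesis by simp
  qed (simp add: zero_degree_def pole_degree_def)
  define g where "g = f1 - f2"
  have g0: "g \<noteq> 0" using neq by (simp add: g_def)
  define T' where "T' = T \<union> {P \<in> C. v P g \<noteq> 0}"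
  have T': "finite T'" "T' \<subseteq> C" "T \<subseteq> T'" using T v_finite[OF g0] by (auto simp: T'_def)
  have low: "(if P \<in> A then 1 else 0) - pole_degree D f1 P - pole_degree D f2 P \<le> v P g + D P"
    if P: "P \<in> C" for P
  proof -
    let ?q1 = "pole_degree D f1 P" and ?q2 = "pole_degree D f2 P"
    have q: "at_least P (- ?q1 - D P) f1" "at_least P (- ?q2 - D P) f2" "0 \<le> ?q1" "0 \<le> ?q2"
      by (auto simp: at_least_def pole_degree_def)
    have gen: "- k - D P \<le> v P g" if "?q1 \<le> k" "?q2 \<le> k" for k
    proof -
      have "at_least P (- k - D P) (f1 - f2)"
        using that q by (intro at_least_diff P) (auto intro: at_least_mono)
      then show ?thesis using g0 by (simp add: at_least_def g_def)
    qed
    show ?thesis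
    proof (cases "P \<in> A")
      case False
      then show ?thesis using gen[of "?q1 + ?q2"] q by simp
    next
      case True
      from agree[OF this] show ?thesis
      proof
        assume "0 < ?q1 \<and> 0 < ?q2"
        then show ?thesis using gen[of "?q1 + ?q2 - 1"] True by simp
      next
        assume "at_least P (1 - D P) (f1 - f2)"
        then show ?thesis using g0 q True by (simp add: at_least_def g_def)
      qed
    qed
  qed
  have ext: "(\<Sum>P\<in>T'. pole_degree D f P) = (\<Sum>P\<in>T. pole_degree D f P)"
    if "f \<noteq> 0 \<Longrightarrow> {P \<in> C. v P f \<noteq> 0} \<subseteq> T" for f
    using T T' that by (intro sum.mono_neutral_right) (fastforce simp: pole_degree_def)+
  have "(\<Sum>P\<in>T'. (if P \<in> A then 1 else 0) - pole_degree D f1 P - pole_degree D f2 P)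
      \<le> (\<Sum>P\<in>T'. v P g + D P)"
    by (rule sum_mono) (rule low, use T' in blast)
  also have "\<dots> = (\<Sum>P\<in>T'. D P)"
    using degree_principal_superset[OF g0 T'(1,2)] by (simp add: sum.distrib T'_def)
  also have "\<dots> = (\<Sum>P\<in>T. D P)" using T T' by (intro sum.mono_neutral_right) auto
  also have "(\<Sum>P\<in>T'. (if P \<in> A then 1 else 0) - pole_degree D f1 P - pole_degree D f2 P)
     = int (card A) - (\<Sum>P\<in>T. pole_degree D f1 P) - (\<Sum>P\<in>T. pole_degree D f2 P)"
  proof -
    have "(\<Sum>P\<in>T'. if P \<in> A then 1 else 0 :: int) = (\<Sum>P\<in>T' \<inter> A. 1)"
      using T' by (simp add: sum.If_cases Int_def)
    also have "T' \<inter> A = A" using A T' by auto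
    finally show ?thesis by (simp add: sum_subtractf ext T1 T2)
  qed
  finally show ?thesis using D balance[OF T1] balance[OF T2] by simp
qed

end

section \<open>Smooth local rings\<close>


context coefficient_field
begin

definition peval :: "'a poly \<Rightarrow> 'f \<Rightarrow> 'f" where
  "peval p u = poly (map_poly \<iota> p) u"

lemma peval_0 [simp]: "peval 0 u = 0"
  by (simp add: peval_def)

lemma peval_pCons [simp]: "peval (pCons a p) u = \<iota> a + u * peval p u"
  by (cases "pCons a p = 0") (simp_all add: peval_def map_poly_pCons)

lemma peval_add [simp]: "peval (p + q) u = peval p u + peval q u"
  by (induction p q rule: poly_induct2) (simp_all add: algebra_simps)

lemma peval_smult [simp]: "peval (smult c p) u = \<iota> c * peval p u"
  by (induction p) (simp_all add: algebra_simps)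

lemma peval_mult [simp]: "peval (p * q) u = peval p u * peval q u"
  by (induction p) (simp_all add: algebra_simps)

lemma peval_one [simp]: "peval 1 u = 1"
  by (simp add: one_pCons)

lemma peval_power [simp]: "peval (p ^ n) u = peval p u ^ n"
  by (induction n) simp_all

text \<open>Over a field of transcendence degree one every element \<open>u\<close> is related in this way to every
  \<open>s \<noteq> 0\<close>: divide any algebraic relation by the largest power of \<open>s\<close> that it contains.
  The polynomial \<open>q 0\<close>, to which it reduces modulo \<open>s\<close>, is then nontrivial.\<close>

definition alg_related :: "'f \<Rightarrow> 'f \<Rightarrow> bool" where
  "alg_related s u \<longleftrightarrow> (\<exists>N q. q 0 \<noteq> 0 \<and> (\<Sum>j\<le>N. s ^ j * peval (q j) u) = 0)"

end

locale subalgebra = coefficient_field \<iota> for \<iota> :: "'a::field \<Rightarrow> 'f::field" +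
  fixes A :: "'f set"
  assumes const_in [simp]: "\<iota> c \<in> A"
    and add_in [simp]: "f \<in> A \<Longrightarrow> g \<in> A \<Longrightarrow> f + g \<in> A"
    and mult_in [simp]: "f \<in> A \<Longrightarrow> g \<in> A \<Longrightarrow> f * g \<in> A"
begin

lemma zero_in [simp]: "0 \<in> A"
  using const_in[of 0] by simp

lemma one_in [simp]: "1 \<in> A"
  using const_in[of 1] by simp

lemma uminus_in [simp]: "f \<in> A \<Longrightarrow> - f \<in> A"
  using mult_in[OF const_in[of "-1"], of f] by simp

lemma diff_in [simp]: "f \<in> A \<Longrightarrow> g \<in> A \<Longrightarrow> f - g \<in> A"
  using add_in[of f "- g"] by simp

lemma power_in [simp]: "f \<in> A \<Longrightarrow> f ^ n \<in> A"
  by (induction n) simp_all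

lemma sum_in: "(\<And>i. i \<in> I \<Longrightarrow> f i \<in> A) \<Longrightarrow> sum f I \<in> A"
  by (induction I rule: infinite_finite_induct) simp_all

lemma prod_in: "(\<And>i. i \<in> I \<Longrightarrow> f i \<in> A) \<Longrightarrow> prod f I \<in> A"
  by (induction I rule: infinite_finite_induct) simp_all

lemma peval_in [simp]: "u \<in> A \<Longrightarrow> peval p u \<in> A"
  by (induction p) simp_all

lemma relation_mod:
  assumes "(\<Sum>j\<le>N. s ^ j * peval (q j) u) = 0" "s \<in> A" "u \<in> A"
  shows "\<exists>a\<in>A. peval (q 0) u = s * a"
proof -
  have "(\<Sum>j\<le>N. s ^ j * peval (q j) u) = peval (q 0) u + (\<Sum>j=1..N. s ^ j * peval (q j) u)"
    using sum.atLeast_Suc_atMost[of 0 N "\<lambda>j. s ^ j * peval (q j) u"] by (simp add: atMost_atLeast0)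
  also have "(\<Sum>j=1..N. s ^ j * peval (q j) u) = s * (\<Sum>j=1..N. s ^ (j - 1) * peval (q j) u)"
    unfolding sum_distrib_left
  proof (intro sum.cong refl)
    fix j assume "j \<in> {1..N}"
    then have "s ^ j = s * s ^ (j - 1)" by (cases j) auto
    then show "s ^ j * peval (q j) u = s * (s ^ (j - 1) * peval (q j) u)" by simp
  qed
  finally have "peval (q 0) u = s * (- (\<Sum>j=1..N. s ^ (j - 1) * peval (q j) u))"
    using assms(1) by (simp add: eq_neg_iff_add_eq_0)
  moreover have "- (\<Sum>j=1..N. s ^ (j - 1) * peval (q j) u) \<in> A"
    using assms(2,3) by (intro uminus_in sum_in) simp
  ultimately show ?thesis by blast
qed

end

text \<open>A local ring whose residue field is the field of constants; \<open>\<rho>\<close> is the evaluation at the point.\<close>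

locale residue_map = subalgebra \<iota> A for \<iota> :: "'a::field \<Rightarrow> 'f::field" and A +
  fixes \<rho> :: "'f \<Rightarrow> 'a"
  assumes rho_const [simp]: "\<rho> (\<iota> c) = c"
    and rho_add [simp]: "f \<in> A \<Longrightarrow> g \<in> A \<Longrightarrow> \<rho> (f + g) = \<rho> f + \<rho> g"
    and rho_mult [simp]: "f \<in> A \<Longrightarrow> g \<in> A \<Longrightarrow> \<rho> (f * g) = \<rho> f * \<rho> g"
    and inverse_in: "f \<in> A \<Longrightarrow> \<rho> f \<noteq> 0 \<Longrightarrow> inverse f \<in> A"
begin

lemma rho_0 [simp]: "\<rho> 0 = 0"
  using rho_const[of 0] by simp

lemma rho_1 [simp]: "\<rho> 1 = 1"
  using rho_const[of 1] by simp

lemma rho_uminus [simp]: "f \<in> A \<Longrightarrow> \<rho> (- f) = - \<rho> f"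
  using rho_mult[OF const_in[of "-1"], of f] rho_const[of "-1"] by (simp del: rho_const)

lemma rho_diff [simp]: "f \<in> A \<Longrightarrow> g \<in> A \<Longrightarrow> \<rho> (f - g) = \<rho> f - \<rho> g"
  using rho_add[of f "- g"] by simp

lemma rho_power [simp]: "f \<in> A \<Longrightarrow> \<rho> (f ^ n) = \<rho> f ^ n"
  by (induction n) simp_all

lemma rho_peval [simp]: "u \<in> A \<Longrightarrow> \<rho> (peval p u) = poly p (\<rho> u)"
  by (induction p) simp_all

lemma rho_inverse: "f \<in> A \<Longrightarrow> \<rho> f \<noteq> 0 \<Longrightarrow> \<rho> (inverse f) = inverse (\<rho> f)"
  using rho_mult[of f "inverse f"] inverse_in[of f] by (metis inverse_unique rho_0 rho_1 right_inverse)

lemma rho_relation: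
  assumes "(\<Sum>j\<le>N. s ^ j * peval (q j) u) = 0" "s \<in> A" "\<rho> s = 0" "u \<in> A"
  shows "poly (q 0) (\<rho> u) = 0"
  using relation_mod[OF assms(1,2,4)] assms by (metis mult_zero_left rho_mult rho_peval)

text \<open>The generators are eliminated one after the other: the coefficient \<open>1 - b k\<close> of \<open>z k\<close> in its own
  relation is a unit.\<close>

lemma nakayama:
  fixes z :: "'i \<Rightarrow> 'f"
  assumes T_add: "\<And>f g. f \<in> T \<Longrightarrow> g \<in> T \<Longrightarrow> f + g \<in> T" and T_0: "0 \<in> T"
    and T_mult: "\<And>a f. a \<in> A \<Longrightarrow> f \<in> T \<Longrightarrow> a * f \<in> T"
    and I: "finite I"
    and gen: "\<And>i. i \<in> I \<Longrightarrow> \<exists>b. (\<forall>j\<in>I. b j \<in> A \<and> \<rho> (b j) = 0) \<and> z i - (\<Sum>j\<in>I. b j * z j) \<in> T"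
  shows "i \<in> I \<Longrightarrow> z i \<in> T"
  using I gen
proof (induction I arbitrary: i rule: finite_induct)
  case (insert k I)
  obtain b where b: "\<forall>j\<in>insert k I. b j \<in> A \<and> \<rho> (b j) = 0"
    "z k - (\<Sum>j\<in>insert k I. b j * z j) \<in> T"
    using insert.prems(2)[of k] by auto
  define u where "u = inverse (1 - b k)"
  have u1: "1 - b k \<noteq> 0"
  proof
    assume "1 - b k = 0"
    then have "\<rho> (1 - b k) = 0" by simp
    then show False using b(1) by simp
  qed
  have u: "u \<in> A" unfolding u_def using b(1) by (intro inverse_in) auto
  have "u * (z k - (\<Sum>j\<in>insert k I. b j * z j)) \<in> T" using T_mult[OF u b(2)] .
  also have "u * (z k - (\<Sum>j\<in>insert k I. b j * z j)) = u * (1 - b k) * z k - u * (\<Sum>j\<in>I. b j * z j)"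
    using insert.hyps by (simp add: algebra_simps)
  also have "\<dots> = z k - (\<Sum>j\<in>I. u * b j * z j)"
    using u1 by (simp add: u_def sum_distrib_left mult.assoc)
  finally have zk: "z k - (\<Sum>j\<in>I. u * b j * z j) \<in> T" .
  have IH: "z j \<in> T" if "j \<in> I" for j
  proof (rule insert.IH[OF that])
    fix i assume "i \<in> I"
    obtain c where c: "\<forall>j\<in>insert k I. c j \<in> A \<and> \<rho> (c j) = 0"
      "z i - (\<Sum>j\<in>insert k I. c j * z j) \<in> T"
      using insert.prems(2)[of i] \<open>i \<in> I\<close> by auto
    let ?d = "\<lambda>j. c j + c k * (u * b j)"
    have "(z i - (\<Sum>j\<in>insert k I. c j * z j)) + c k * (z k - (\<Sum>j\<in>I. u * b j * z j)) \<in> T"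
      using c zk by (intro T_add T_mult) auto
    also have "(z i - (\<Sum>j\<in>insert k I. c j * z j)) + c k * (z k - (\<Sum>j\<in>I. u * b j * z j))
       = z i - (\<Sum>j\<in>I. ?d j * z j)"
      using insert.hyps by (simp add: algebra_simps sum.distrib sum_distrib_left)
    finally show "\<exists>d. (\<forall>j\<in>I. d j \<in> A \<and> \<rho> (d j) = 0) \<and> z i - (\<Sum>j\<in>I. d j * z j) \<in> T"
      using b c u by (intro exI[of _ ?d]) auto
  qed
  have "(\<Sum>j\<in>J. u * b j * z j) \<in> T" if "J \<subseteq> I" for J
    using finite_subset[OF that insert.hyps(1)] that
    by (induction J rule: finite_induct) (use IH T_0 T_mult T_add u b in auto)
  then have "(z k - (\<Sum>j\<in>I. u * b j * z j)) + (\<Sum>j\<in>I. u * b j * z j) \<in> T" using zk by (intro T_add) auto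
  then have "z k \<in> T" by simp
  then show ?case using insert.prems(1) IH by auto
qed simp

text \<open>These mirror \<open>uniformizer\<close> and \<open>ord_at\<close>, so that an isomorphism carries one to the
  other.\<close>

definition is_uniformizer :: "'f \<Rightarrow> bool" where
  "is_uniformizer t \<longleftrightarrow> {f \<in> A. \<rho> f = 0} = {t * a | a. a \<in> A}"

definition ord :: "'f \<Rightarrow> int" where
  "ord f = (THE n. \<exists>t u. is_uniformizer t \<and> u \<in> A \<and> \<rho> u \<noteq> 0 \<and> f = u * t powi n)"

end

text \<open>The local ring of a smooth point of a curve. The assumption \<open>cotangent\<close> says that one of
  the generators \<open>z i\<close> of the maximal ideal spans it modulo its square.\<close>

locale smooth_local_ring = residue_map \<iota> A \<rho> for \<iota> :: "'a::field \<Rightarrow> 'f::field" and A \<rho> +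
  fixes z :: "'i::finite \<Rightarrow> 'f"
  assumes fraction: "\<exists>a b. a \<in> A \<and> b \<in> A \<and> b \<noteq> 0 \<and> f = a / b"
    and z_max: "z i \<in> A" "\<rho> (z i) = 0"
    and z_gen: "f \<in> A \<Longrightarrow> \<rho> f = 0 \<Longrightarrow> \<exists>b. (\<forall>i. b i \<in> A) \<and> f = (\<Sum>i\<in>UNIV. b i * z i)"
    and cotangent: "\<exists>i0. \<forall>i. \<exists>c b. (\<forall>j. b j \<in> A \<and> \<rho> (b j) = 0) \<and>
           z i = \<iota> c * z i0 + (\<Sum>j\<in>UNIV. b j * z j)"
    and related: "s \<noteq> 0 \<Longrightarrow> alg_related s u"
    and nonconst: "\<exists>x. x \<notin> range \<iota>"
begin

lemma exists_uniformizer: "\<exists>t. is_uniformizer t"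
proof -
  obtain i0 where i0: "\<And>i. \<exists>c b. (\<forall>j. b j \<in> A \<and> \<rho> (b j) = 0) \<and> z i = \<iota> c * z i0 + (\<Sum>j\<in>UNIV. b j * z j)"
    using cotangent by blast
  define T where "T = {z i0 * a | a. a \<in> A}"
  have T_add: "f + g \<in> T" if fg: "f \<in> T" "g \<in> T" for f g
  proof -
    obtain a b where "a \<in> A" "b \<in> A" "f = z i0 * a" "g = z i0 * b" using fg by (auto simp: T_def)
    then show ?thesis unfolding T_def by (intro CollectI exI[of _ "a + b"]) (simp add: algebra_simps)
  qed
  have T_mult: "a * f \<in> T" if af: "a \<in> A" "f \<in> T" for a f
  proof -
    obtain b where "b \<in> A" "f = z i0 * b" using af by (auto simp: T_def)
    then show ?thesis unfolding T_def using af by (intro CollectI exI[of _ "a * b"]) (simp add: algebra_simps)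
  qed
  have T_0: "0 \<in> T" unfolding T_def by (intro CollectI exI[of _ 0]) simp
  have zT: "z i \<in> T" for i
  proof (rule nakayama[OF T_add T_0 T_mult finite_class.finite_UNIV])
    fix i :: 'i
    obtain c b where b: "\<forall>j. b j \<in> A \<and> \<rho> (b j) = 0" "z i = \<iota> c * z i0 + (\<Sum>j\<in>UNIV. b j * z j)"
      using i0 by blast
    have "z i - (\<Sum>j\<in>UNIV. b j * z j) = z i0 * \<iota> c" by (simp add: b(2))
    then have "z i - (\<Sum>j\<in>UNIV. b j * z j) \<in> T" by (auto simp: T_def)
    then show "\<exists>b. (\<forall>j\<in>UNIV. b j \<in> A \<and> \<rho> (b j) = 0) \<and> z i - (\<Sum>j\<in>UNIV. b j * z j) \<in> T"
      using b by blast
  qed auto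
  have "{f \<in> A. \<rho> f = 0} = T"
  proof (intro equalityI subsetI)
    fix f assume "f \<in> {f \<in> A. \<rho> f = 0}"
    then obtain b where b: "\<forall>i. b i \<in> A" "f = (\<Sum>i\<in>UNIV. b i * z i)" using z_gen by blast
    have "(\<Sum>i\<in>J. b i * z i) \<in> T" if "finite J" for J
      using that by (induction J rule: finite_induct) (use T_0 T_add T_mult zT b in auto)
    then show "f \<in> T" using b by simp
  next
    fix f assume "f \<in> T"
    then show "f \<in> {f \<in> A. \<rho> f = 0}" using z_max by (auto simp: T_def)
  qed
  then show ?thesis unfolding is_uniformizer_def T_def by blast
qed

lemma uniformizer_in:
  assumes "is_uniformizer t" shows "t \<in> A" "\<rho> t = 0" "t \<noteq> 0"
proof -
  have "t \<in> {t * a | a. a \<in> A}" by (intro CollectI exI[of _ 1]) simp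
  then show t: "t \<in> A" "\<rho> t = 0" using assms unfolding is_uniformizer_def by blast+
  show "t \<noteq> 0"
  proof
    assume "t = 0"
    then have m: "f = 0" if "f \<in> A" "\<rho> f = 0" for f
      using assms that unfolding is_uniformizer_def by auto
    have c: "f = \<iota> (\<rho> f)" if "f \<in> A" for f
      using m[of "f - \<iota> (\<rho> f)"] that by simp
    have "x \<in> range \<iota>" for x
    proof -
      obtain a b where "a \<in> A" "b \<in> A" "x = a / b" using fraction by blast
      then have "x = \<iota> (\<rho> a / \<rho> b)" using c[of a] c[of b] by simp
      then show ?thesis by blast
    qed
    then show False using nonconst by blast
  qed
qed

lemma uniformizer_dvd:
  "is_uniformizer t \<Longrightarrow> f \<in> A \<Longrightarrow> \<rho> f = 0 \<Longrightarrow> \<exists>a\<in>A. f = t * a"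
  unfolding is_uniformizer_def by blast

text \<open>Only finitely many powers of a uniformizer divide a nonzero \<open>f\<close>: a relation between \<open>f\<close> and
  \<open>t\<close> shows that \<open>f\<close> itself divides a power of \<open>t\<close> up to a unit.\<close>

lemma unit_times_power:
  assumes t: "is_uniformizer t" and f: "f \<in> A" "f \<noteq> 0"
  shows "\<exists>n u. u \<in> A \<and> \<rho> u \<noteq> 0 \<and> f = u * t ^ n"
proof -
  note tA = uniformizer_in[OF t]
  obtain N q where q: "q 0 \<noteq> 0" "(\<Sum>j\<le>N. f ^ j * peval (q j) t) = 0"
    using related[OF f(2), of t] by (auto simp: alg_related_def)
  obtain h where h: "h \<in> A" "peval (q 0) t = f * h" using relation_mod[OF q(2) f(1) tA(1)] by blast
  obtain e r where r: "q 0 = [:- 0, 1:] ^ e * r" "poly r 0 \<noteq> 0"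
    by (metis order_decomp[OF q(1)] dvd_iff_poly_eq_0 minus_zero)
  have e: "t ^ e * peval r t = f * h" using h(2) r(1) by simp
  define w where "w = peval r t"
  have w: "w \<in> A" "\<rho> w \<noteq> 0" using tA r by (simp_all add: w_def)
  have bound: "\<not> (\<exists>g\<in>A. f = t ^ Suc e * g)"
  proof
    assume "\<exists>g\<in>A. f = t ^ Suc e * g"
    then obtain g where g: "g \<in> A" "f = t ^ Suc e * g" by blast
    have "t ^ e * w = t ^ e * (t * g * h)" using e g by (simp add: w_def algebra_simps)
    then have "w = t * g * h" using tA by simp
    then show False using w tA g h by simp
  qed
  have "\<exists>n. (\<exists>g\<in>A. f = t ^ n * g) \<and> \<not> (\<exists>g\<in>A. f = t ^ Suc n * g)"
  proof (rule ccontr)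
    assume "\<not> ?thesis"
    then have step: "\<exists>g\<in>A. f = t ^ Suc n * g" if "\<exists>g\<in>A. f = t ^ n * g" for n
      using that by blast
    have "\<exists>g\<in>A. f = t ^ n * g" for n
      by (induction n) (use f step in auto)
    then show False using bound by blast
  qed
  then obtain n g where g: "g \<in> A" "f = t ^ n * g" "\<not> (\<exists>g\<in>A. f = t ^ Suc n * g)" by blast
  have "\<rho> g \<noteq> 0"
  proof
    assume "\<rho> g = 0"
    then obtain a where "a \<in> A" "g = t * a" using uniformizer_dvd[OF t g(1)] by blast
    then have "f = t ^ Suc n * a" using g by simp
    then show False using g(3) \<open>a \<in> A\<close> by blast
  qed
  then show ?thesis using g by (intro exI[of _ n] exI[of _ g]) simp
qed

lemma unit_powi:
  assumes "u \<in> A" "\<rho> u \<noteq> 0" shows "u powi n \<in> A" "\<rho> (u powi n) \<noteq> 0"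
  using assms by (auto simp: power_int_def inverse_in rho_inverse)

lemma unit_times_powi:
  assumes t: "is_uniformizer t" and f: "f \<noteq> 0"
  shows "\<exists>n u. u \<in> A \<and> \<rho> u \<noteq> 0 \<and> f = u * t powi n"
proof -
  note tA = uniformizer_in[OF t]
  obtain a b where ab: "a \<in> A" "b \<in> A" "b \<noteq> 0" "f = a / b" using fraction by blast
  then have "a \<noteq> 0" using f by auto
  obtain m u where u: "u \<in> A" "\<rho> u \<noteq> 0" "a = u * t ^ m" using unit_times_power[OF t ab(1) \<open>a \<noteq> 0\<close>] by blast
  obtain n w where w: "w \<in> A" "\<rho> w \<noteq> 0" "b = w * t ^ n" using unit_times_power[OF t ab(2,3)] by blast
  have "f = (u * inverse w) * t powi (int m - int n)"
    using ab(3,4) u(3) w(3) tA(3) by (simp add: power_int_diff field_simps)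
  moreover have "\<rho> (u * inverse w) \<noteq> 0" using u w by (auto simp: inverse_in rho_inverse)
  ultimately show ?thesis using u w inverse_in by (metis mult_in)
qed

lemma exponent_le:
  assumes t: "is_uniformizer t" and u: "u \<in> A" "\<rho> u \<noteq> 0" and w: "w \<in> A"
    and eq: "u * t powi n = w * t powi m"
  shows "m \<le> n"
proof (rule ccontr)
  note tA = uniformizer_in[OF t]
  assume "\<not> m \<le> n"
  then have "m - n = int (Suc (nat (m - n) - 1))" by simp
  then have "t powi (m - n) = t * t ^ (nat (m - n) - 1)" by (metis power_Suc power_int_of_nat)
  moreover have "u = w * t powi (m - n)" using eq tA(3) by (simp add: power_int_diff field_simps)
  ultimately show False using u w tA by simp
qed

text \<open>Two uniformizers differ by a unit, so the exponent does not depend on their choice.\<close>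

lemma ord_eqI:
  assumes t: "is_uniformizer t" and u: "u \<in> A" "\<rho> u \<noteq> 0"
  shows "ord (u * t powi n) = n"
  unfolding ord_def
proof (rule the_equality)
  show "\<exists>t' u'. is_uniformizer t' \<and> u' \<in> A \<and> \<rho> u' \<noteq> 0 \<and> u * t powi n = u' * t' powi n"
    using assms by blast
  fix m assume "\<exists>t' u'. is_uniformizer t' \<and> u' \<in> A \<and> \<rho> u' \<noteq> 0 \<and> u * t powi n = u' * t' powi m"
  then obtain t' u' where t': "is_uniformizer t'" and u': "u' \<in> A" "\<rho> u' \<noteq> 0"
    and eq: "u * t powi n = u' * t' powi m" by blast
  obtain a where a: "a \<in> A" "t' = t * a" using uniformizer_dvd[OF t uniformizer_in(1,2)[OF t']] by blast
  obtain b where b: "b \<in> A" "t = t' * b" using uniformizer_dvd[OF t' uniformizer_in(1,2)[OF t]] by blast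
  have "a * b = 1" using a b uniformizer_in(3)[OF t] by (metis mult.assoc mult_cancel_left1)
  then have "\<rho> a * \<rho> b = 1" using a b by (metis rho_1 rho_mult)
  then have ra: "\<rho> a \<noteq> 0" by auto
  have eq': "u * t powi n = (u' * a powi m) * t powi m"
    using eq by (simp add: a power_int_mult_distrib)
  have unit: "u' * a powi m \<in> A" "\<rho> (u' * a powi m) \<noteq> 0"
    using u' unit_powi[OF a(1) ra, of m] by auto
  show "m = n"
    using exponent_le[OF t u unit(1) eq'] exponent_le[OF t unit u(1) eq'[symmetric]] by simp
qed

lemma ord_decomp:
  assumes t: "is_uniformizer t" and f: "f \<noteq> 0"
  shows "\<exists>u. u \<in> A \<and> \<rho> u \<noteq> 0 \<and> f = u * t powi ord f"
  using unit_times_powi[OF t f] ord_eqI[OF t] by metis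

lemma ord_mult:
  assumes "f \<noteq> 0" "g \<noteq> 0" shows "ord (f * g) = ord f + ord g"
proof -
  obtain t where t: "is_uniformizer t" using exists_uniformizer by blast
  obtain u where u: "u \<in> A" "\<rho> u \<noteq> 0" "f = u * t powi ord f" using ord_decomp[OF t assms(1)] by blast
  obtain w where w: "w \<in> A" "\<rho> w \<noteq> 0" "g = w * t powi ord g" using ord_decomp[OF t assms(2)] by blast
  have "f * g = (u * w) * t powi (ord f + ord g)"
    using u(3) w(3) uniformizer_in(3)[OF t] by (subst power_int_add) (metis mult.assoc mult.left_commute)+
  then show ?thesis using ord_eqI[OF t, of "u * w" "ord f + ord g"] u w by simp
qed

lemma ord_uniformizer: "is_uniformizer t \<Longrightarrow> ord t = 1"
  using ord_eqI[of t 1 1] by simp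

lemma ord_nonneg_iff:
  assumes f: "f \<noteq> 0" shows "0 \<le> ord f \<longleftrightarrow> f \<in> A"
proof -
  obtain t where t: "is_uniformizer t" using exists_uniformizer by blast
  note tA = uniformizer_in[OF t]
  obtain u where u: "u \<in> A" "\<rho> u \<noteq> 0" "f = u * t powi ord f" using ord_decomp[OF t f] by blast
  show ?thesis
  proof
    assume "0 \<le> ord f"
    then have "f = u * t ^ nat (ord f)" using u(3) by (simp add: power_int_def)
    then show "f \<in> A" using u tA by (metis mult_in power_in)
  next
    assume "f \<in> A"
    then show "0 \<le> ord f" using exponent_le[OF t u(1,2), of f "ord f" 0] u(3) by simp
  qed
qed

lemma ord_pos_iff:
  assumes f: "f \<noteq> 0" shows "1 \<le> ord f \<longleftrightarrow> f \<in> A \<and> \<rho> f = 0"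
proof -
  obtain t where t: "is_uniformizer t" using exists_uniformizer by blast
  note tA = uniformizer_in[OF t]
  obtain u where u: "u \<in> A" "\<rho> u \<noteq> 0" "f = u * t powi ord f" using ord_decomp[OF t f] by blast
  show ?thesis
  proof
    assume "1 \<le> ord f"
    then have "f = u * t ^ nat (ord f)" "nat (ord f) \<noteq> 0" using u(3) by (simp_all add: power_int_def)
    moreover have "\<rho> (u * t ^ nat (ord f)) = 0" using u tA calculation(2) by simp
    ultimately show "f \<in> A \<and> \<rho> f = 0" using u tA by (metis mult_in power_in)
  next
    assume fA: "f \<in> A \<and> \<rho> f = 0"
    then have "0 \<le> ord f" using ord_nonneg_iff[OF f] by simp
    moreover have "ord f \<noteq> 0"
    proof
      assume "ord f = 0"
      then have "f = u" using u(3) by simp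
      then show False using fA u by simp
    qed
    ultimately show "1 \<le> ord f" by simp
  qed
qed

lemma ord_add:
  assumes "f \<noteq> 0" "g \<noteq> 0" "f + g \<noteq> 0" shows "min (ord f) (ord g) \<le> ord (f + g)"
proof -
  have main: "ord f \<le> ord (f + g)" if fg: "f \<noteq> 0" "g \<noteq> 0" "f + g \<noteq> 0" "ord f \<le> ord g" for f g
  proof -
    have "ord g = ord f + ord (g / f)" using ord_mult[of f "g / f"] fg by simp
    then have "g / f \<in> A" using ord_nonneg_iff[of "g / f"] fg by simp
    then have "1 + g / f \<in> A" by simp
    moreover have "1 + g / f \<noteq> 0" using fg by (simp add: field_simps)
    ultimately have "0 \<le> ord (1 + g / f)" using ord_nonneg_iff by simp
    moreover have "ord (f + g) = ord f + ord (1 + g / f)"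
    proof -
      have "f * (1 + g / f) = f + g" using fg by (simp add: field_simps)
      then show ?thesis using ord_mult[of f "1 + g / f"] fg \<open>1 + g / f \<noteq> 0\<close> by simp
    qed
    ultimately show ?thesis by simp
  qed
  show ?thesis
    using main[of f g] main[of g f] assms by (cases "ord f \<le> ord g") (auto simp: add.commute)
qed

lemma residue_exists:
  assumes "f \<noteq> 0" "0 \<le> ord f" shows "f = \<iota> (\<rho> f) \<or> 1 \<le> ord (f - \<iota> (\<rho> f))"
  using ord_pos_iff[of "f - \<iota> (\<rho> f)"] ord_nonneg_iff[OF assms(1)] assms by auto

end

section \<open>Homogeneous polynomials and the Jacobian criterion\<close>

(* The components of vectors and the coefficients of formal power series share an infix sign. *)

no_notation fps_nth (infixl \<open>$\<close> 75)

definition monomial_value :: "('n::finite \<Rightarrow>\<^sub>0 nat) \<Rightarrow> 'f::field ^ 'n \<Rightarrow> 'f" where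
  "monomial_value m w = (\<Prod>i\<in>UNIV. (w $ i) ^ Poly_Mapping.lookup m i)"

lemma monomial_value_0 [simp]: "monomial_value 0 w = 1"
  by (simp add: monomial_value_def)

lemma monomial_value_add [simp]: "monomial_value (m + m') w = monomial_value m w * monomial_value m' w"
  by (simp add: monomial_value_def lookup_add power_add prod.distrib)

lemma monomial_value_single [simp]: "monomial_value (Poly_Mapping.single i k) w = (w $ i) ^ k"
proof -
  have "monomial_value (Poly_Mapping.single i k) w = (\<Prod>j\<in>UNIV. if j = i then (w $ i) ^ k else 1)"
    unfolding monomial_value_def by (intro prod.cong) (auto simp: lookup_single when_def)
  then show ?thesis by simp
qed

lemma mpol_sum_monomials:
  fixes F :: "('n::finite, 'a::field) mpol"
  shows "F = (\<Sum>m\<in>Poly_Mapping.keys F. Poly_Mapping.single m (Poly_Mapping.lookup F m))"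
proof (rule poly_mapping_eqI)
  fix k
  have "Poly_Mapping.lookup (\<Sum>m\<in>Poly_Mapping.keys F. Poly_Mapping.single m (Poly_Mapping.lookup F m)) k
      = (\<Sum>m\<in>Poly_Mapping.keys F. if m = k then Poly_Mapping.lookup F k else 0)"
    unfolding lookup_sum by (intro sum.cong) (auto simp: lookup_single when_def)
  then show "Poly_Mapping.lookup F k = Poly_Mapping.lookup
      (\<Sum>m\<in>Poly_Mapping.keys F. Poly_Mapping.single m (Poly_Mapping.lookup F m)) k"
    by (simp add: in_keys_iff)
qed

context coefficient_field
begin

no_notation fps_nth (infixl \<open>$\<close> 75)

text \<open>For the identity on the coefficients this is \<open>mpol_eval\<close>.\<close>

definition geval :: "('n::finite, 'a) mpol \<Rightarrow> 'f ^ 'n \<Rightarrow> 'f" where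
  "geval F w = (\<Sum>m\<in>Poly_Mapping.keys F. \<iota> (Poly_Mapping.lookup F m) * monomial_value m w)"

lemma geval_superset:
  assumes "finite S" "Poly_Mapping.keys F \<subseteq> S"
  shows "geval F w = (\<Sum>m\<in>S. \<iota> (Poly_Mapping.lookup F m) * monomial_value m w)"
  unfolding geval_def using assms by (intro sum.mono_neutral_left) (auto simp: in_keys_iff)

lemma geval_0 [simp]: "geval 0 w = 0"
  by (simp add: geval_def)

lemma geval_single [simp]: "geval (Poly_Mapping.single m c) w = \<iota> c * monomial_value m w"
  by (subst geval_superset[of "{m}"]) auto

lemma geval_1 [simp]: "geval 1 w = 1"
  using geval_single[of 0 1 w] by simp

lemma geval_add [simp]: "geval (F + G) w = geval F w + geval G w"
proof -
  let ?S = "Poly_Mapping.keys F \<union> Poly_Mapping.keys G"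
  have "geval (F + G) w = (\<Sum>m\<in>?S. \<iota> (Poly_Mapping.lookup (F + G) m) * monomial_value m w)"
    using keys_add[of F G] by (intro geval_superset) auto
  also have "\<dots> = (\<Sum>m\<in>?S. \<iota> (Poly_Mapping.lookup F m) * monomial_value m w)
      + (\<Sum>m\<in>?S. \<iota> (Poly_Mapping.lookup G m) * monomial_value m w)"
    by (simp add: lookup_add sum.distrib algebra_simps)
  also have "\<dots> = geval F w + geval G w" by (simp add: geval_superset[of ?S])
  finally show ?thesis .
qed

lemma geval_sum: "geval (sum F I) w = (\<Sum>i\<in>I. geval (F i) w)"
  by (induction I rule: infinite_finite_induct) simp_all

lemma geval_uminus [simp]: "geval (- F) w = - geval F w"
  using geval_add[of F "- F" w] by (simp add: eq_neg_iff_add_eq_0 add.commute)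

lemma geval_diff [simp]: "geval (F - G) w = geval F w - geval G w"
  using geval_add[of F "- G" w] by simp

lemma geval_mult [simp]: "geval (F * G) w = geval F w * geval G w"
proof -
  have "F * G = (\<Sum>m\<in>Poly_Mapping.keys F. \<Sum>k\<in>Poly_Mapping.keys G.
      Poly_Mapping.single (m + k) (Poly_Mapping.lookup F m * Poly_Mapping.lookup G k))"
    by (subst mpol_sum_monomials[of F], subst mpol_sum_monomials[of G])
      (simp add: sum_product mult_single)
  then have "geval (F * G) w = (\<Sum>m\<in>Poly_Mapping.keys F. \<Sum>k\<in>Poly_Mapping.keys G.
      (\<iota> (Poly_Mapping.lookup F m) * monomial_value m w) * (\<iota> (Poly_Mapping.lookup G k) * monomial_value k w))"
    by (simp add: geval_sum algebra_simps)
  then show ?thesis by (simp add: geval_def sum_product)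
qed

lemma geval_prod: "geval (prod F I) w = (\<Prod>i\<in>I. geval (F i) w)"
  by (induction I rule: infinite_finite_induct) simp_all

lemma geval_const [simp]: "geval (mpol_const c) w = \<iota> c"
  by (simp add: mpol_const_def)

lemma geval_scale:
  assumes "homogeneous d F"
  shows "geval F (c *s w) = c ^ d * geval F w"
proof -
  have "monomial_value m (c *s w) = c ^ d * monomial_value m w" if "m \<in> Poly_Mapping.keys F" for m
  proof -
    have "(\<Prod>i\<in>UNIV. c ^ Poly_Mapping.lookup m i) = c ^ d"
      using assms that by (simp add: power_sum[symmetric] homogeneous_def)
    then show ?thesis by (simp add: monomial_value_def power_mult_distrib prod.distrib)
  qed
  then show ?thesis by (simp add: geval_def sum_distrib_left algebra_simps)
qed

end

lemma coefficient_field_id: "coefficient_field (\<lambda>x :: 'a::field. x)"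
  by unfold_locales auto

lemma geval_id: "coefficient_field.geval (\<lambda>x :: 'a::field. x) = (mpol_eval :: ('n::finite, 'a) mpol \<Rightarrow> _)"
  by (intro ext) (simp add: coefficient_field.geval_def[OF coefficient_field_id] mpol_eval_def monomial_value_def)

lemma mpol_eval_monomials:
  "mpol_eval F w = (\<Sum>m\<in>Poly_Mapping.keys F. Poly_Mapping.lookup F m * monomial_value m w)"
  by (simp add: mpol_eval_def monomial_value_def)

lemmas mpol_eval_0 [simp] = coefficient_field.geval_0[OF coefficient_field_id, unfolded geval_id]
  and mpol_eval_1 [simp] = coefficient_field.geval_1[OF coefficient_field_id, unfolded geval_id]
  and mpol_eval_single [simp] = coefficient_field.geval_single[OF coefficient_field_id, unfolded geval_id]
  and mpol_eval_add [simp] = coefficient_field.geval_add[OF coefficient_field_id, unfolded geval_id]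
  and mpol_eval_uminus [simp] = coefficient_field.geval_uminus[OF coefficient_field_id, unfolded geval_id]
  and mpol_eval_diff [simp] = coefficient_field.geval_diff[OF coefficient_field_id, unfolded geval_id]
  and mpol_eval_mult [simp] = coefficient_field.geval_mult[OF coefficient_field_id, unfolded geval_id]
  and mpol_eval_sum = coefficient_field.geval_sum[OF coefficient_field_id, unfolded geval_id]
  and mpol_eval_const [simp] = coefficient_field.geval_const[OF coefficient_field_id, unfolded geval_id]
  and mpol_eval_scale = coefficient_field.geval_scale[OF coefficient_field_id, unfolded geval_id]

lemma homogeneous_0 [simp]: "homogeneous d 0"
  by (simp add: homogeneous_def)

lemma homogeneous_single: "(\<Sum>i\<in>UNIV. Poly_Mapping.lookup m i) = d \<Longrightarrow> homogeneous d (Poly_Mapping.single m c)"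
  by (simp add: homogeneous_def)

lemma homogeneous_const [simp]: "homogeneous 0 (mpol_const c)"
  unfolding mpol_const_def by (rule homogeneous_single) simp

lemma homogeneous_1 [simp]: "homogeneous 0 1"
  using homogeneous_const[of 1] by (simp add: mpol_const_def)

lemma homogeneous_add: "homogeneous d F \<Longrightarrow> homogeneous d G \<Longrightarrow> homogeneous d (F + G)"
  using keys_add[of F G] by (auto simp: homogeneous_def)

lemma homogeneous_uminus: "homogeneous d F \<Longrightarrow> homogeneous d (- F)"
  by (simp add: homogeneous_def)

lemma homogeneous_diff: "homogeneous d F \<Longrightarrow> homogeneous d G \<Longrightarrow> homogeneous d (F - G)"
  using homogeneous_add[of d F "- G"] homogeneous_uminus[of d G] by simp

lemma homogeneous_mult:
  assumes "homogeneous d F" "homogeneous e G" shows "homogeneous (d + e) (F * G)"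
  unfolding homogeneous_def
proof
  fix m assume "m \<in> Poly_Mapping.keys (F * G)"
  then obtain a b where "a \<in> Poly_Mapping.keys F" "b \<in> Poly_Mapping.keys G" "m = a + b"
    using keys_mult[of F G] by blast
  then show "(\<Sum>i\<in>UNIV. Poly_Mapping.lookup m i) = d + e"
    using assms by (simp add: homogeneous_def lookup_add sum.distrib)
qed

lemma homogeneous_sum: "(\<And>i. i \<in> I \<Longrightarrow> homogeneous d (F i)) \<Longrightarrow> homogeneous d (sum F I)"
  by (induction I rule: infinite_finite_induct) (auto intro: homogeneous_add)

definition linear_form :: "('n::finite \<Rightarrow> 'a::field) \<Rightarrow> ('n, 'a) mpol" where
  "linear_form c = (\<Sum>i\<in>UNIV. Poly_Mapping.single (Poly_Mapping.single i 1) (c i))"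

lemma homogeneous_linear_form [simp]:
  fixes c :: "'n::finite \<Rightarrow> 'a::field"
  shows "homogeneous 1 (linear_form c)"
proof -
  have "(\<Sum>j\<in>UNIV. Poly_Mapping.lookup (Poly_Mapping.single i (1::nat)) j) = 1" for i :: 'n
  proof -
    have "(\<Sum>j\<in>UNIV. Poly_Mapping.lookup (Poly_Mapping.single i (1::nat)) j) = (\<Sum>j\<in>UNIV. if j = i then 1 else 0)"
      by (intro sum.cong) (auto simp: lookup_single when_def)
    then show ?thesis by simp
  qed
  then show ?thesis unfolding linear_form_def by (intro homogeneous_sum homogeneous_single)
qed

lemma (in coefficient_field) geval_linear_form [simp]:
  "geval (linear_form c) w = (\<Sum>i\<in>UNIV. \<iota> (c i) * w $ i)"
  by (simp add: linear_form_def geval_sum)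

lemmas mpol_eval_linear_form [simp] = coefficient_field.geval_linear_form[OF coefficient_field_id, unfolded geval_id]

lemma sum_delta_mult: "(\<Sum>i\<in>UNIV. (if i = j then 1 else 0) * g i) = (g j :: 'f::field)" for j :: "'n::finite"
proof -
  have "(\<Sum>i\<in>UNIV. (if i = j then 1 else 0) * g i) = (\<Sum>i\<in>UNIV. if i = j then g i else 0)"
    by (intro sum.cong) auto
  then show ?thesis by simp
qed

definition coordinate :: "'n::finite \<Rightarrow> ('n, 'a::field) mpol" where
  "coordinate j = linear_form (\<lambda>i. if i = j then 1 else 0)"

lemma homogeneous_coordinate [simp]: "homogeneous 1 (coordinate j)"
  unfolding coordinate_def by (rule homogeneous_linear_form)

lemma (in coefficient_field) geval_coordinate [simp]: "geval (coordinate j) w = w $ j"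
proof -
  have "geval (coordinate j) w = (\<Sum>i\<in>UNIV. (if i = j then 1 else 0) * w $ i)"
    unfolding coordinate_def geval_linear_form by (intro sum.cong) auto
  then show ?thesis by (simp add: sum_delta_mult)
qed

lemmas mpol_eval_coordinate [simp] = coefficient_field.geval_coordinate[OF coefficient_field_id, unfolded geval_id]

lemma gradient_nth:
  "gradient F v $ i = (\<Sum>m\<in>Poly_Mapping.keys F. Poly_Mapping.lookup F m *
      (of_nat (Poly_Mapping.lookup m i) * v $ i ^ (Poly_Mapping.lookup m i - 1) *
        (\<Prod>j\<in>UNIV - {i}. v $ j ^ Poly_Mapping.lookup m j)))"
proof -
  have "monomial_value (m - Poly_Mapping.single i 1) v = v $ i ^ (Poly_Mapping.lookup m i - 1) *
        (\<Prod>j\<in>UNIV - {i}. v $ j ^ Poly_Mapping.lookup m j)" for m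
    unfolding monomial_value_def
    by (subst prod.remove[of UNIV i]) (auto simp: lookup_minus lookup_single when_def intro!: prod.cong)
  then show ?thesis
    by (simp add: gradient_def mpol_pderiv_def mpol_eval_sum algebra_simps)
qed

text \<open>Hence at a zero of \<open>F\<close> the gradient is orthogonal to the point itself.\<close>

lemma euler_homogeneous:
  assumes "homogeneous d F"
  shows "(\<Sum>i\<in>UNIV. v $ i * gradient F v $ i) = of_nat d * mpol_eval F v"
proof -
  have 1: "v $ i * (of_nat k * v $ i ^ (k - 1) * r) = of_nat k * (v $ i ^ k * r)" for i k and r
    by (cases k) (simp_all add: algebra_simps)
  have "v $ i * gradient F v $ i
      = (\<Sum>m\<in>Poly_Mapping.keys F. of_nat (Poly_Mapping.lookup m i) * (Poly_Mapping.lookup F m * monomial_value m v))" for i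
  proof -
    have "v $ i * gradient F v $ i = (\<Sum>m\<in>Poly_Mapping.keys F. Poly_Mapping.lookup F m *
      (v $ i * (of_nat (Poly_Mapping.lookup m i) * v $ i ^ (Poly_Mapping.lookup m i - 1) *
        (\<Prod>j\<in>UNIV - {i}. v $ j ^ Poly_Mapping.lookup m j))))"
      unfolding gradient_nth sum_distrib_left by (intro sum.cong) (simp_all add: mult.left_commute)
    also have "\<dots> = (\<Sum>m\<in>Poly_Mapping.keys F. Poly_Mapping.lookup F m *
      (of_nat (Poly_Mapping.lookup m i) * monomial_value m v))"
      unfolding 1 monomial_value_def by (subst prod.remove[of UNIV i]) simp_all
    finally show ?thesis by (simp only: mult.left_commute)
  qed
  then have "(\<Sum>i\<in>UNIV. v $ i * gradient F v $ i) = (\<Sum>m\<in>Poly_Mapping.keys F. \<Sum>i\<in>UNIV.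
      of_nat (Poly_Mapping.lookup m i) * (Poly_Mapping.lookup F m * monomial_value m v))"
    using sum.swap by simp
  also have "\<dots> = (\<Sum>m\<in>Poly_Mapping.keys F. of_nat d * (Poly_Mapping.lookup F m * monomial_value m v))"
    using assms by (intro sum.cong) (auto simp: homogeneous_def sum_distrib_right[symmetric] of_nat_sum[symmetric] simp del: of_nat_sum)
  finally show ?thesis by (simp add: mpol_eval_monomials sum_distrib_left)
qed

lemma proj_point_mem: "v \<in> proj_point v"
  unfolding proj_point_def by (intro CollectI exI[of _ 1]) simp

lemma proj_point_eq:
  assumes "w \<in> proj_point v" shows "proj_point w = proj_point v"
proof -
  obtain c where c: "c \<noteq> 0" "w = c *s v" using assms by (auto simp: proj_point_def)
  show ?thesis
  proof (intro equalityI subsetI)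
    fix x assume "x \<in> proj_point w"
    then obtain d where "d \<noteq> 0" "x = d *s w" by (auto simp: proj_point_def)
    then have "d * c \<noteq> 0" "x = (d * c) *s v" using c by (simp_all add: vector_smult_assoc)
    then show "x \<in> proj_point v" unfolding proj_point_def by blast
  next
    fix x assume "x \<in> proj_point v"
    then obtain d where "d \<noteq> 0" "x = d *s v" by (auto simp: proj_point_def)
    then have "d / c \<noteq> 0" "x = (d / c) *s w" using c by (simp_all add: vector_smult_assoc)
    then show "x \<in> proj_point w" unfolding proj_point_def by blast
  qed
qed

lemma proj_space_cases:
  assumes "P \<in> proj_space" "v \<in> P" shows "P = proj_point v" "v \<noteq> 0"
proof -
  obtain u where u: "u \<noteq> 0" "P = proj_point u" using assms by (auto simp: proj_space_def)
  show "P = proj_point v" using u assms proj_point_eq by blast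
  obtain c where "c \<noteq> 0" "v = c *s u" using u assms by (auto simp: proj_point_def)
  then show "v \<noteq> 0" using u by (simp add: vec_eq_iff)
qed

lemma homogeneous_zero_iff:
  assumes "homogeneous d F" "P \<in> proj_space" "v \<in> P" "w \<in> P"
  shows "mpol_eval F v = 0 \<longleftrightarrow> mpol_eval F w = 0"
proof -
  have "P = proj_point v" using proj_space_cases assms by blast
  then obtain c where "c \<noteq> 0" "w = c *s v" using assms by (auto simp: proj_point_def)
  then show ?thesis using mpol_eval_scale[OF assms(1)] by simp
qed

lemma homogeneous_ratio_eq:
  assumes "homogeneous d F" "homogeneous d G" "P \<in> proj_space" "v \<in> P" "w \<in> P"
  shows "mpol_eval F v / mpol_eval G v = mpol_eval F w / mpol_eval G w"
proof -
  have "P = proj_point v" using proj_space_cases assms by blast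
  then obtain c where "c \<noteq> 0" "w = c *s v" using assms by (auto simp: proj_point_def)
  then show ?thesis using mpol_eval_scale[OF assms(1)] mpol_eval_scale[OF assms(2)] by simp
qed

context residue_map
begin

no_notation fps_nth (infixl \<open>$\<close> 75)

text \<open>When the \<open>z j\<close> generate the maximal ideal, this is its square.\<close>

definition square_ideal :: "('n::finite \<Rightarrow> 'f) \<Rightarrow> 'f set" where
  "square_ideal z = {\<Sum>j\<in>UNIV. b j * z j | b. \<forall>j. b j \<in> A \<and> \<rho> (b j) = 0}"

lemma square_idealI: "(\<And>j. b j \<in> A) \<Longrightarrow> (\<And>j. \<rho> (b j) = 0) \<Longrightarrow> (\<Sum>j\<in>UNIV. b j * z j) \<in> square_ideal z"
  unfolding square_ideal_def by blast

lemma square_ideal_0 [simp]: "0 \<in> square_ideal z"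
  using square_idealI[of "\<lambda>_. 0" z] by simp

lemma square_ideal_add:
  assumes "f \<in> square_ideal z" "g \<in> square_ideal z" shows "f + g \<in> square_ideal z"
proof -
  obtain b c where "\<forall>j. b j \<in> A \<and> \<rho> (b j) = 0" "f = (\<Sum>j\<in>UNIV. b j * z j)"
    "\<forall>j. c j \<in> A \<and> \<rho> (c j) = 0" "g = (\<Sum>j\<in>UNIV. c j * z j)"
    using assms unfolding square_ideal_def by blast
  then show ?thesis using square_idealI[of "\<lambda>j. b j + c j" z] by (simp add: algebra_simps sum.distrib)
qed

lemma square_ideal_mult:
  assumes "f \<in> square_ideal z" "a \<in> A" shows "a * f \<in> square_ideal z"
proof -
  obtain b where "\<forall>j. b j \<in> A \<and> \<rho> (b j) = 0" "f = (\<Sum>j\<in>UNIV. b j * z j)"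
    using assms unfolding square_ideal_def by blast
  then show ?thesis using square_idealI[of "\<lambda>j. a * b j" z] assms(2) by (simp add: algebra_simps sum_distrib_left)
qed

text \<open>\<open>taylor z f a d\<close>: to first order in the local parameters \<open>z i\<close>, \<open>f\<close> has value \<open>a\<close> and
  partial derivatives \<open>d i\<close>.\<close>

definition taylor :: "('n::finite \<Rightarrow> 'f) \<Rightarrow> 'f \<Rightarrow> 'a \<Rightarrow> ('n \<Rightarrow> 'a) \<Rightarrow> bool" where
  "taylor z f a d \<longleftrightarrow> f - (\<iota> a + (\<Sum>i\<in>UNIV. \<iota> (d i) * z i)) \<in> square_ideal z"

lemma taylor_const: "taylor z (\<iota> c) c (\<lambda>_. 0)"
  by (simp add: taylor_def)

lemma taylor_add:
  assumes "taylor z f a d" "taylor z g b e" shows "taylor z (f + g) (a + b) (\<lambda>i. d i + e i)"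
proof -
  have "f + g - (\<iota> (a + b) + (\<Sum>i\<in>UNIV. \<iota> (d i + e i) * z i))
     = (f - (\<iota> a + (\<Sum>i\<in>UNIV. \<iota> (d i) * z i))) + (g - (\<iota> b + (\<Sum>i\<in>UNIV. \<iota> (e i) * z i)))"
    by (simp add: ring_distribs sum.distrib)
  also have "\<dots> \<in> square_ideal z" using assms unfolding taylor_def by (rule square_ideal_add)
  finally show ?thesis unfolding taylor_def .
qed

lemma taylor_sum:
  "finite I \<Longrightarrow> (\<And>i. i \<in> I \<Longrightarrow> taylor z (f i) (a i) (d i)) \<Longrightarrow>
    taylor z (\<Sum>i\<in>I. f i) (\<Sum>i\<in>I. a i) (\<lambda>j. \<Sum>i\<in>I. d i j)"
proof (induction I rule: finite_induct)
  case empty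
  show ?case using taylor_const[of z 0] by simp
next
  case (insert k I)
  then show ?case using taylor_add[of z "f k" "a k" "d k" "sum f I" "sum a I"] by simp
qed

lemma taylor_mult:
  assumes z: "\<And>i. z i \<in> A" "\<And>i. \<rho> (z i) = 0" and g: "g \<in> A"
    and f: "taylor z f a d" and g': "taylor z g b e"
  shows "taylor z (f * g) (a * b) (\<lambda>i. d i * b + a * e i)"
proof -
  define D where "D = (\<Sum>i\<in>UNIV. \<iota> (d i) * z i)"
  define E where "E = (\<Sum>i\<in>UNIV. \<iota> (e i) * z i)"
  have dA: "D \<in> A" unfolding D_def using z by (intro sum_in) auto
  have eA: "E \<in> A" unfolding E_def using z by (intro sum_in) auto
  have e0: "\<rho> E = 0"
  proof -
    have "(\<Sum>i\<in>J. \<iota> (e i) * z i) \<in> A \<and> \<rho> (\<Sum>i\<in>J. \<iota> (e i) * z i) = 0" if "finite J" for J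
      using that by (induction J rule: finite_induct) (use z in auto)
    then show ?thesis by (simp add: E_def)
  qed
  have "D * E = (\<Sum>i\<in>UNIV. (\<iota> (d i) * E) * z i)"
    unfolding D_def sum_distrib_right by (intro sum.cong) (simp_all add: ac_simps)
  then have de: "D * E \<in> square_ideal z" using square_idealI[of "\<lambda>i. \<iota> (d i) * E" z] eA e0 by simp
  have "(\<Sum>i\<in>UNIV. \<iota> (d i * b + a * e i) * z i) = (\<Sum>i\<in>UNIV. \<iota> b * (\<iota> (d i) * z i) + \<iota> a * (\<iota> (e i) * z i))"
    by (intro sum.cong) (simp_all add: ring_distribs ac_simps)
  also have "\<dots> = \<iota> b * D + \<iota> a * E" by (simp add: D_def E_def sum.distrib sum_distrib_left)
  finally have S: "(\<Sum>i\<in>UNIV. \<iota> (d i * b + a * e i) * z i) = \<iota> b * D + \<iota> a * E" .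
  have "f * g - (\<iota> a * \<iota> b + (\<iota> b * D + \<iota> a * E))
      = g * (f - (\<iota> a + D)) + (\<iota> a + D) * (g - (\<iota> b + E)) + D * E"
    by (simp add: algebra_simps)
  also have "\<dots> \<in> square_ideal z"
    using f g' dA g unfolding taylor_def D_def[symmetric] E_def[symmetric]
    by (intro square_ideal_add square_ideal_mult de) auto
  finally show ?thesis unfolding taylor_def S by simp
qed

lemma taylor_coordinate:
  fixes y :: "'f ^ 'n::finite"
  shows "taylor (\<lambda>i. y $ i - \<iota> (v $ i)) (y $ j) (v $ j) (\<lambda>i. if i = j then 1 else 0)"
proof -
  have "(\<Sum>i\<in>UNIV. \<iota> (if i = j then 1 else 0) * (y $ i - \<iota> (v $ i)))
      = (\<Sum>i\<in>UNIV. (if i = j then 1 else 0) * (y $ i - \<iota> (v $ i)))" by (intro sum.cong) auto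
  then show ?thesis by (simp add: taylor_def sum_delta_mult)
qed

lemma taylor_mpol:
  fixes y :: "'f ^ 'n::finite" and v :: "'a ^ 'n"
  assumes y: "\<And>i. y $ i \<in> A" "\<And>i. \<rho> (y $ i) = v $ i"
  shows "taylor (\<lambda>i. y $ i - \<iota> (v $ i)) (geval F y) (mpol_eval F v) (\<lambda>i. gradient F v $ i)"
proof -
  let ?z = "\<lambda>i. y $ i - \<iota> (v $ i)"
  have z: "?z i \<in> A" "\<rho> (?z i) = 0" for i using y by auto
  note mult = taylor_mult[where z = ?z, OF z]
  have pow: "taylor ?z (y $ j ^ k) (v $ j ^ k) (\<lambda>i. if i = j then of_nat k * v $ j ^ (k - 1) else 0)" for j k
  proof (induction k)
    case 0
    show ?case using taylor_const[of ?z 1] by (simp cong: if_cong)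
  next
    case (Suc k)
    have "taylor ?z (y $ j * y $ j ^ k) (v $ j * v $ j ^ k)
      (\<lambda>i. (if i = j then 1 else 0) * v $ j ^ k + v $ j * (if i = j then of_nat k * v $ j ^ (k - 1) else 0))"
      using y by (intro mult taylor_coordinate Suc) auto
    also have "(\<lambda>i. (if i = j then 1 else 0) * v $ j ^ k + v $ j * (if i = j then of_nat k * v $ j ^ (k - 1) else 0))
      = (\<lambda>i. if i = j then of_nat (Suc k) * v $ j ^ (Suc k - 1) else 0)"
      by (cases k) (auto simp: algebra_simps)
    finally show ?case by simp
  qed
  have prod: "taylor ?z (\<Prod>j\<in>J. y $ j ^ k j) (\<Prod>j\<in>J. v $ j ^ k j)
      (\<lambda>i. if i \<in> J then of_nat (k i) * v $ i ^ (k i - 1) * (\<Prod>j\<in>J - {i}. v $ j ^ k j) else 0)"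
    if "finite J" for J k
    using that
  proof (induction J rule: finite_induct)
    case empty
    show ?case using taylor_const[of ?z 1] by simp
  next
    case (insert l J)
    have PA: "(\<Prod>j\<in>J. y $ j ^ k j) \<in> A" using y by (intro prod_in) auto
    have "taylor ?z (y $ l ^ k l * (\<Prod>j\<in>J. y $ j ^ k j)) (v $ l ^ k l * (\<Prod>j\<in>J. v $ j ^ k j))
      (\<lambda>i. (if i = l then of_nat (k l) * v $ l ^ (k l - 1) else 0) * (\<Prod>j\<in>J. v $ j ^ k j)
        + v $ l ^ k l * (if i \<in> J then of_nat (k i) * v $ i ^ (k i - 1) * (\<Prod>j\<in>J - {i}. v $ j ^ k j) else 0))"
      by (intro mult PA pow insert.IH)
    also have "(\<lambda>i. (if i = l then of_nat (k l) * v $ l ^ (k l - 1) else 0) * (\<Prod>j\<in>J. v $ j ^ k j)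
        + v $ l ^ k l * (if i \<in> J then of_nat (k i) * v $ i ^ (k i - 1) * (\<Prod>j\<in>J - {i}. v $ j ^ k j) else 0))
      = (\<lambda>i. if i \<in> insert l J then of_nat (k i) * v $ i ^ (k i - 1) * (\<Prod>j\<in>insert l J - {i}. v $ j ^ k j) else 0)"
    proof
      fix i
      show "(if i = l then of_nat (k l) * v $ l ^ (k l - 1) else 0) * (\<Prod>j\<in>J. v $ j ^ k j)
        + v $ l ^ k l * (if i \<in> J then of_nat (k i) * v $ i ^ (k i - 1) * (\<Prod>j\<in>J - {i}. v $ j ^ k j) else 0)
        = (if i \<in> insert l J then of_nat (k i) * v $ i ^ (k i - 1) * (\<Prod>j\<in>insert l J - {i}. v $ j ^ k j) else 0)"
      proof (cases "i = l")
        case True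
        then show ?thesis using insert.hyps by simp
      next
        case False
        then have "insert l J - {i} = insert l (J - {i})" by auto
        then show ?thesis using False insert.hyps by (simp add: algebra_simps)
      qed
    qed
    finally show ?case using insert.hyps by simp
  qed
  have mono: "taylor ?z (\<iota> c * monomial_value m y) (c * monomial_value m v)
      (\<lambda>i. c * (of_nat (Poly_Mapping.lookup m i) * v $ i ^ (Poly_Mapping.lookup m i - 1) *
        (\<Prod>j\<in>UNIV - {i}. v $ j ^ Poly_Mapping.lookup m j)))" for c m
  proof -
    have mA: "monomial_value m y \<in> A" unfolding monomial_value_def using y by (intro prod_in) auto
    have "taylor ?z (monomial_value m y) (monomial_value m v)
      (\<lambda>i. of_nat (Poly_Mapping.lookup m i) * v $ i ^ (Poly_Mapping.lookup m i - 1) *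
        (\<Prod>j\<in>UNIV - {i}. v $ j ^ Poly_Mapping.lookup m j))"
      using prod[of UNIV "Poly_Mapping.lookup m"] by (simp add: monomial_value_def)
    from mult[OF mA taylor_const[of ?z c] this] show ?thesis by simp
  qed
  show ?thesis
    unfolding geval_def mpol_eval_monomials gradient_nth
    by (rule taylor_sum) (simp, rule mono)
qed

text \<open>The linear forms in the parameters that vanish to second order contain the gradients of the
  equations and, as \<open>z j = 0\<close>, a further vector, which by Euler's relation is independent of them.
  So these forms have codimension at most one.\<close>

lemma jacobian_cotangent:
  fixes z :: "'n::finite \<Rightarrow> 'f" and v :: "'a ^ 'n"
  assumes dim: "vec.dim G + 2 = CARD('n)"
    and j: "v $ j = 1" "z j = 0"
    and orth: "\<And>g. g \<in> G \<Longrightarrow> (\<Sum>i\<in>UNIV. v $ i * g $ i) = 0"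
    and G: "\<And>g. g \<in> G \<Longrightarrow> (\<Sum>i\<in>UNIV. \<iota> (g $ i) * z i) \<in> square_ideal z"
  shows "\<exists>i0. \<forall>i. \<exists>c. z i - \<iota> c * z i0 \<in> square_ideal z"
proof -
  define W where "W = {w :: 'a ^ 'n. (\<Sum>i\<in>UNIV. \<iota> (w $ i) * z i) \<in> square_ideal z}"
  have W: "vec.subspace W"
  proof (rule vec.subspaceI)
    show "0 \<in> W" by (simp add: W_def)
  next
    fix x w assume "x \<in> W" "w \<in> W"
    then have "(\<Sum>i\<in>UNIV. \<iota> (x $ i) * z i) + (\<Sum>i\<in>UNIV. \<iota> (w $ i) * z i) \<in> square_ideal z"
      unfolding W_def by (blast intro: square_ideal_add)
    moreover have "(\<Sum>i\<in>UNIV. \<iota> ((x + w) $ i) * z i) = (\<Sum>i\<in>UNIV. \<iota> (x $ i) * z i) + (\<Sum>i\<in>UNIV. \<iota> (w $ i) * z i)"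
      by (simp add: ring_distribs sum.distrib)
    ultimately show "x + w \<in> W" unfolding W_def by (simp only: mem_Collect_eq)
  next
    fix c x assume "x \<in> W"
    then have "\<iota> c * (\<Sum>i\<in>UNIV. \<iota> (x $ i) * z i) \<in> square_ideal z"
      unfolding W_def by (blast intro: square_ideal_mult const_in)
    moreover have "(\<Sum>i\<in>UNIV. \<iota> ((c *s x) $ i) * z i) = \<iota> c * (\<Sum>i\<in>UNIV. \<iota> (x $ i) * z i)"
      unfolding sum_distrib_left by (intro sum.cong) (simp_all add: mult.assoc)
    ultimately show "c *s x \<in> W" unfolding W_def by (simp only: mem_Collect_eq)
  qed
  have ax: "(\<Sum>i\<in>UNIV. \<iota> (axis k 1 $ i) * z i) = z k" for k
  proof -
    have "(\<Sum>i\<in>UNIV. \<iota> (axis k 1 $ i) * z i) = (\<Sum>i\<in>UNIV. (if i = k then 1 else 0) * z i)"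
      by (intro sum.cong) (auto simp: axis_def)
    then show ?thesis by (simp add: sum_delta_mult)
  qed
  have "axis j 1 \<notin> vec.span G"
  proof
    assume "axis j 1 \<in> vec.span G"
    moreover have "vec.subspace {w :: 'a ^ 'n. (\<Sum>i\<in>UNIV. v $ i * w $ i) = 0}"
    proof (rule vec.subspaceI)
      fix c and x :: "'a ^ 'n"
      assume "x \<in> {w. (\<Sum>i\<in>UNIV. v $ i * w $ i) = 0}"
      then have "c * (\<Sum>i\<in>UNIV. v $ i * x $ i) = 0" by simp
      then show "c *s x \<in> {w. (\<Sum>i\<in>UNIV. v $ i * w $ i) = 0}"
        by (simp add: sum_distrib_left mult.left_commute)
    qed (auto simp: algebra_simps sum.distrib)
    ultimately have "(\<Sum>i\<in>UNIV. v $ i * axis j 1 $ i) = 0"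
      using vec.span_minimal[of G "{w. (\<Sum>i\<in>UNIV. v $ i * w $ i) = 0}"] orth by blast
    moreover have "(\<Sum>i\<in>UNIV. v $ i * axis j 1 $ i) = (\<Sum>i\<in>UNIV. (if i = j then 1 else 0) * v $ i)"
      by (intro sum.cong) (auto simp: axis_def)
    ultimately show False using j by (simp add: sum_delta_mult)
  qed
  then have "vec.dim (insert (axis j 1) G) = vec.dim G + 1" by (simp add: vec.dim_insert)
  moreover have "insert (axis j 1) G \<subseteq> W" using G ax j by (auto simp: W_def)
  then have "vec.dim (insert (axis j 1) G) \<le> vec.dim W" by (rule vec.dim_subset)
  ultimately have dW: "CARD('n) \<le> vec.dim W + 1" using dim by simp
  show ?thesis
  proof (cases "\<forall>i. axis i 1 \<in> W")
    case True
    then have "z i \<in> square_ideal z" for i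
      unfolding W_def mem_Collect_eq ax by blast
    then show ?thesis by (intro exI allI exI[of _ 0]) simp
  next
    case False
    then obtain i0 where i0: "axis i0 1 \<notin> W" by blast
    have sW: "vec.span W = W" using W by (simp only: vec.span_eq_iff)
    have "vec.dim (insert (axis i0 1) W) = vec.dim W + 1" using i0 by (simp only: vec.dim_insert sW if_False Suc_eq_plus1)
    then have "vec.dim (insert (axis i0 1) W) = CARD('n)"
      using dW dim_subset_UNIV_cart_gen[of "insert (axis i0 1) W"] by simp
    then have full: "vec.span (insert (axis i0 1) W) = UNIV"
      using vec.dim_eq_full[of "insert (axis i0 1) W"] by (simp add: vec.dimension_def card_cart_basis)
    show ?thesis
    proof (intro exI allI)
      fix i
      have "\<exists>c. axis i 1 - c *s axis i0 1 \<in> W"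
        using full vec.span_breakdown_eq[of "axis i 1" "axis i0 1" W] sW by auto
      then obtain c where "axis i 1 - c *s axis i0 1 \<in> W" by blast
      then have "(\<Sum>k\<in>UNIV. \<iota> (axis i 1 $ k) * z k) - \<iota> c * (\<Sum>k\<in>UNIV. \<iota> (axis i0 1 $ k) * z k) \<in> square_ideal z"
        by (simp add: W_def ring_distribs sum_subtractf sum_distrib_left mult.assoc)
      then show "z i - \<iota> (SOME c. z i - \<iota> c * z i0 \<in> square_ideal z) * z i0 \<in> square_ideal z"
        unfolding ax by (rule someI)
    qed
  qed
qed

end

section \<open>Valuation rings avoiding a given function\<close>

lemma infinite_alg_closed: "infinite (UNIV :: 'a::alg_closed_field set)"
proof
  assume fin: "finite (UNIV :: 'a set)"
  define p :: "'a poly" where "p = (\<Prod>a\<in>UNIV. [:- a, 1:]) + 1"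
  have val: "poly p x = 1" for x
  proof -
    have "(\<Prod>a\<in>UNIV. x - a) = 0" using fin by (intro prod_zero) auto
    then show ?thesis by (simp add: p_def poly_prod)
  qed
  have deg: "degree (\<Prod>a\<in>UNIV. [:- a, 1:] :: 'a poly) = card (UNIV :: 'a set)"
    by (subst degree_prod_eq_sum_degree) auto
  have "card (UNIV :: 'a set) > 0" using fin by (simp add: card_gt_0_iff)
  then have "degree p > 0" unfolding p_def using deg by (subst degree_add_eq_left) auto
  then obtain x where "poly p x = 0" using alg_closed_imp_poly_has_root by blast
  then show False using val by simp
qed

lemma poly_root_induct_alg_closed [consumes 1, case_names const step]:
  fixes p :: "'a::alg_closed_field poly"
  assumes "p \<noteq> 0"
    and const: "\<And>c. c \<noteq> 0 \<Longrightarrow> Q [:c:]"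
    and step: "\<And>a p. p \<noteq> 0 \<Longrightarrow> Q p \<Longrightarrow> Q ([:- a, 1:] * p)"
  shows "Q p"
  using assms(1)
proof (induction "degree p" arbitrary: p)
  case 0
  then obtain c where "p = [:c:]" by (metis degree_eq_zeroE)
  then show ?case using const 0 by auto
next
  case (Suc n)
  then obtain a where "poly p a = 0" using alg_closed_imp_poly_has_root[of p] by auto
  then obtain q where q: "p = [:- a, 1:] * q" by (metis dvdE poly_eq_0_iff_dvd)
  then have "q \<noteq> 0" using Suc by auto
  moreover have "degree p = Suc (degree q)" using q \<open>q \<noteq> 0\<close> by (subst q, subst degree_mult_eq) auto
  ultimately show ?case using Suc step q by auto
qed

locale alg_closed_coefficients = coefficient_field \<iota>
  for \<iota> :: "'a::alg_closed_field \<Rightarrow> 'f::field"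
begin

lemma algebraic_imp_const:
  assumes "p \<noteq> 0" "peval p s = 0" shows "s \<in> range \<iota>"
  using assms
proof (induction p rule: poly_root_induct_alg_closed)
  case (step a p)
  then have "(s - \<iota> a) * peval p s = 0" by (subst (asm) peval_mult) simp
  then show ?case using step by auto
qed simp

end

context subalgebra
begin

definition adjoin :: "'f \<Rightarrow> 'f set" where
  "adjoin x = {poly p x | p. \<forall>i. coeff p i \<in> A}"

lemma adjoinI: "(\<And>i. coeff p i \<in> A) \<Longrightarrow> poly p x \<in> adjoin x"
  unfolding adjoin_def by blast

lemma subset_adjoin: "A \<subseteq> adjoin x"
proof
  fix a assume "a \<in> A"
  then have "poly [:a:] x \<in> adjoin x" by (intro adjoinI) (simp add: coeff_pCons split: nat.split)
  then show "a \<in> adjoin x" by simp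
qed

lemma mem_adjoin: "x \<in> adjoin x"
proof -
  have "poly [:0, 1:] x \<in> adjoin x" by (intro adjoinI) (simp add: coeff_pCons split: nat.split)
  then show ?thesis by simp
qed

lemma subalgebra_adjoin: "subalgebra \<iota> (adjoin x)"
proof unfold_locales
  show "\<iota> c \<in> adjoin x" for c using subset_adjoin[of x] const_in by blast
  fix f g assume "f \<in> adjoin x" "g \<in> adjoin x"
  then obtain p q where pq: "\<forall>i. coeff p i \<in> A" "f = poly p x" "\<forall>i. coeff q i \<in> A" "g = poly q x"
    by (auto simp: adjoin_def)
  have "poly (p + q) x \<in> adjoin x" "poly (p * q) x \<in> adjoin x"
    using pq by (intro adjoinI; auto simp: coeff_mult intro!: sum_in)+
  then show "f + g \<in> adjoin x" "f * g \<in> adjoin x" using pq by simp_all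
qed

text \<open>If \<open>A\<close> is maximal among the subalgebras that contain \<open>1 / f\<close> but not \<open>f\<close>, then it is a
  valuation ring: \<open>1 - b\<close> is invertible in \<open>A\<close> for every multiple \<open>b\<close> of \<open>1 / f\<close>, and when
  \<open>f\<close> lies both in \<open>A[x]\<close> and in \<open>A[1/x]\<close>, relations of least degree witnessing this shorten
  each other.\<close>

lemma maximal_avoiding_unit:
  assumes s: "f \<notin> A" "inverse f \<in> A" and max: "\<And>x. x \<notin> A \<Longrightarrow> f \<in> adjoin x" and r: "r \<in> A"
  shows "1 - inverse f * r \<noteq> 0" "inverse (1 - inverse f * r) \<in> A"
proof -
  have f0: "f \<noteq> 0" using s by auto
  define u where "u = 1 - inverse f * r"
  have uA: "u \<in> A" using s r by (simp add: u_def)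
  show u0: "1 - inverse f * r \<noteq> 0"
  proof
    assume "1 - inverse f * r = 0"
    then have "f = r" using f0 by (simp add: field_simps)
    then show False using s r by simp
  qed
  have pow: "\<exists>r\<in>A. u ^ n = 1 - inverse f * r" for n
  proof (induction n)
    case (Suc n)
    then obtain r' where r': "r' \<in> A" "u ^ n = 1 - inverse f * r'" by blast
    have "u ^ Suc n = u * (1 - inverse f * r')" using r'(2) by simp
    also have "\<dots> = 1 - inverse f * (r + r' - inverse f * r * r')" by (simp add: u_def algebra_simps)
    finally have "u ^ Suc n = 1 - inverse f * (r + r' - inverse f * r * r')" .
    then show ?case using r' r s by (intro bexI[of _ "r + r' - inverse f * r * r'"]) auto
  qed (auto intro: bexI[of _ 0])
  show "inverse (1 - inverse f * r) \<in> A"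
  proof (rule ccontr)
    assume "inverse (1 - inverse f * r) \<notin> A"
    then have "f \<in> adjoin (inverse u)" using max by (simp add: u_def)
    then obtain p where p: "\<forall>i. coeff p i \<in> A" "f = poly p (inverse u)" by (auto simp: adjoin_def)
    have "f * u ^ degree p = (\<Sum>i\<le>degree p. coeff p i * inverse u ^ i * u ^ degree p)"
      by (subst p(2)) (simp add: poly_altdef sum_distrib_right)
    also have "\<dots> = (\<Sum>i\<le>degree p. coeff p i * u ^ (degree p - i))"
    proof (intro sum.cong refl)
      fix i assume "i \<in> {..degree p}"
      then have "u ^ degree p = u ^ i * u ^ (degree p - i)" by (simp add: power_add[symmetric])
      moreover have "inverse u ^ i * u ^ i = 1" using u0 by (simp add: u_def power_mult_distrib[symmetric])
      ultimately show "coeff p i * inverse u ^ i * u ^ degree p = coeff p i * u ^ (degree p - i)"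
        by (simp add: mult.assoc[symmetric])
    qed
    also have "\<dots> \<in> A" using p(1) uA by (intro sum_in) simp
    finally have fu: "f * u ^ degree p \<in> A" .
    obtain r' where "r' \<in> A" "u ^ degree p = 1 - inverse f * r'" using pow by blast
    then have "f = f * u ^ degree p + r'" using f0 by (simp add: field_simps)
    then show False using fu \<open>r' \<in> A\<close> s(1) by (metis add_in)
  qed
qed

lemma relation_shorten:
  assumes s: "f \<notin> A" "inverse f \<in> A" and max: "\<And>x. x \<notin> A \<Longrightarrow> f \<in> adjoin x" and x: "x \<noteq> 0"
    and p: "\<And>i. \<exists>r\<in>A. coeff p i = inverse f * r" "poly p x = 1"
    and q: "\<And>i. \<exists>r\<in>A. coeff q i = inverse f * r" "poly q (inverse x) = 1"
    and le: "degree q \<le> degree p"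
  shows "\<exists>p'. (\<forall>i. \<exists>r\<in>A. coeff p' i = inverse f * r) \<and> poly p' x = 1 \<and> degree p' < degree p"
proof -
  define I where "I = {inverse f * r | r. r \<in> A}"
  have I_add: "a + b \<in> I" if "a \<in> I" "b \<in> I" for a b
  proof -
    obtain r r' where "r \<in> A" "r' \<in> A" "a = inverse f * r" "b = inverse f * r'" using \<open>a \<in> I\<close> \<open>b \<in> I\<close> by (auto simp: I_def)
    then show ?thesis unfolding I_def by (intro CollectI exI[of _ "r + r'"]) (simp add: algebra_simps)
  qed
  have I_mult: "a * b \<in> I" if "a \<in> I" "b \<in> A" for a b
  proof -
    obtain r where "r \<in> A" "a = inverse f * r" using \<open>a \<in> I\<close> by (auto simp: I_def)
    then show ?thesis using \<open>b \<in> A\<close> unfolding I_def by (intro CollectI exI[of _ "r * b"]) (simp add: algebra_simps)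
  qed
  have IA: "I \<subseteq> A" using s by (auto simp: I_def)
  have I_0: "0 \<in> I" unfolding I_def by (intro CollectI exI[of _ 0]) simp
  have pI: "coeff p i \<in> I" and qI: "coeff q i \<in> I" for i using p(1)[of i] q(1)[of i] by (auto simp: I_def)
  define n where "n = degree p"
  define m where "m = degree q"
  define b0 where "b0 = coeff q 0"
  obtain r0 where r0: "r0 \<in> A" "b0 = inverse f * r0" using q(1)[of 0] by (auto simp: b0_def)
  have u: "1 - b0 \<noteq> 0" "inverse (1 - b0) \<in> A"
    using maximal_avoiding_unit[OF s max r0(1)] r0(2) by auto
  define a where "a = coeff p n * inverse (1 - b0)"
  have aI: "a \<in> I" using I_mult pI u by (simp add: a_def)
  have n0: "n > 0"
  proof (rule ccontr)
    assume "\<not> n > 0"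
    then have "degree q = 0" using le by (simp add: n_def)
    then have "poly q (inverse x) = b0" by (metis b0_def degree_eq_zeroE coeff_pCons_0 poly_const_conv)
    then show False using q(2) u by simp
  qed
  have xn: "(1 - b0) * x ^ n = (\<Sum>j=1..m. coeff q j * x ^ (n - j))"
  proof -
    have "1 = (\<Sum>j\<le>m. coeff q j * inverse x ^ j)" using q(2) by (simp add: poly_altdef m_def)
    also have "\<dots> = b0 + (\<Sum>j=1..m. coeff q j * inverse x ^ j)"
      using sum.atLeast_Suc_atMost[of 0 m "\<lambda>j. coeff q j * inverse x ^ j"] by (simp add: atMost_atLeast0 b0_def)
    finally have "(1 - b0) * x ^ n = (\<Sum>j=1..m. coeff q j * inverse x ^ j * x ^ n)"
      by (metis add_diff_cancel_left' sum_distrib_right)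
    also have "\<dots> = (\<Sum>j=1..m. coeff q j * x ^ (n - j))"
    proof (intro sum.cong refl)
      fix j assume "j \<in> {1..m}"
      then have "x ^ n = x ^ j * x ^ (n - j)" using le by (simp add: power_add[symmetric] n_def m_def)
      moreover have "inverse x ^ j * x ^ j = 1" using x by (simp add: power_mult_distrib[symmetric])
      ultimately show "coeff q j * inverse x ^ j * x ^ n = coeff q j * x ^ (n - j)"
        by (simp add: mult.assoc[symmetric])
    qed
    finally show ?thesis .
  qed
  define p' where "p' = (p - monom (coeff p n) n) + (\<Sum>j=1..m. monom (a * coeff q j) (n - j))"
  have "coeff p' i \<in> I" for i
  proof -
    have "(\<Sum>j\<in>J. coeff (monom (a * coeff q j) (n - j)) i) \<in> I" if "finite J" for J
      using that
    proof (induction J rule: finite_induct)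
      case (insert j J)
      have "coeff (monom (a * coeff q j) (n - j)) i \<in> I" using I_mult aI qI IA I_0 by auto
      then show ?case using insert I_add by simp
    qed (use I_0 in simp)
    moreover have "coeff (p - monom (coeff p n) n) i \<in> I" using pI I_0 by simp
    ultimately show ?thesis using I_add by (simp add: p'_def coeff_sum)
  qed
  moreover have "poly p' x = 1"
  proof -
    have "(\<Sum>j=1..m. a * coeff q j * x ^ (n - j)) = a * ((1 - b0) * x ^ n)"
      by (simp add: xn sum_distrib_left mult.assoc)
    also have "\<dots> = coeff p n * x ^ n" using u by (simp add: a_def)
    finally show ?thesis using p(2) by (simp add: p'_def poly_sum poly_monom)
  qed
  moreover have "degree p' < n"
  proof (rule degree_lessI)
    show "p' \<noteq> 0 \<or> 0 < n" using n0 by simp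
    show "\<forall>k\<ge>n. coeff p' k = 0"
      using n0 by (auto simp: p'_def coeff_sum n_def coeff_eq_0 intro!: sum.neutral)
  qed
  ultimately show ?thesis unfolding I_def n_def by blast
qed

lemma maximal_avoiding_valuation_ring:
  assumes s: "f \<notin> A" "inverse f \<in> A" and max: "\<And>x. x \<notin> A \<Longrightarrow> f \<in> adjoin x" and x: "x \<noteq> 0"
  shows "x \<in> A \<or> inverse x \<in> A"
proof (rule ccontr)
  assume neg: "\<not> (x \<in> A \<or> inverse x \<in> A)"
  have f0: "f \<noteq> 0" using s by auto
  let ?R = "\<lambda>x p. (\<forall>i. \<exists>r\<in>A. coeff p i = inverse f * r) \<and> poly p x = 1"
  have ex: "\<exists>p. ?R w p" if "w \<notin> A" for w
  proof -
    obtain p where "\<forall>i. coeff p i \<in> A" "f = poly p w" using max[OF \<open>w \<notin> A\<close>] by (auto simp: adjoin_def)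
    then show ?thesis using f0 by (intro exI[of _ "smult (inverse f) p"]) auto
  qed
  obtain p where p: "?R x p" "\<And>p'. ?R x p' \<Longrightarrow> degree p \<le> degree p'"
    using ex_has_least_nat[of "?R x" _ degree] ex[of x] neg by blast
  obtain q where q: "?R (inverse x) q" "\<And>q'. ?R (inverse x) q' \<Longrightarrow> degree q \<le> degree q'"
    using ex_has_least_nat[of "?R (inverse x)" _ degree] ex[of "inverse x"] neg by blast
  show False
  proof (cases "degree q \<le> degree p")
    case True
    then show False
      using relation_shorten[OF s max x, of p q] p q(1) by (meson leD)
  next
    case False
    then show False
      using relation_shorten[OF s max, of "inverse x" q p] q p(1) x by (simp add: linorder_not_le) (meson leD less_imp_le)
  qed
qed

end

context alg_closed_coefficients
begin

text \<open>By Zorn's lemma, starting from the polynomials in \<open>1 / f\<close>. If \<open>f\<close> were one of them, it would be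
  algebraic over the constants and so be constant.\<close>

lemma exists_maximal_avoiding:
  assumes f: "f \<notin> range \<iota>"
  shows "\<exists>R. subalgebra \<iota> R \<and> f \<notin> R \<and> inverse f \<in> R \<and> (\<forall>x. x \<notin> R \<longrightarrow> f \<in> subalgebra.adjoin R x)"
proof -
  define family where "family = {B. subalgebra \<iota> B \<and> f \<notin> B \<and> inverse f \<in> B}"
  have f0: "f \<noteq> 0" using f iota_zero by (metis rangeI)
  have "subalgebra \<iota> (range \<iota>)"
    by unfold_locales (auto simp flip: iota_add iota_mult)
  then interpret k: subalgebra \<iota> "range \<iota>" .
  have "f \<notin> k.adjoin (inverse f)"
  proof
    assume "f \<in> k.adjoin (inverse f)"
    then obtain p where p: "\<forall>i. coeff p i \<in> range \<iota>" "f = poly p (inverse f)" by (auto simp: k.adjoin_def)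
    define p0 where "p0 = map_poly (inv_into UNIV \<iota>) p"
    have inv0: "inv_into UNIV \<iota> 0 = 0"
      using inv_into_f_f[of \<iota> UNIV 0] by (simp add: inj_def)
    have inv: "\<iota> (inv_into UNIV \<iota> a) = a" if "a \<in> range \<iota>" for a
      using that by (rule f_inv_into_f)
    have "map_poly \<iota> p0 = p"
      by (rule poly_eqI) (use p(1) in \<open>simp add: p0_def coeff_map_poly inv0 inv\<close>)
    then have "peval (pCons (-1) p0) (inverse f) = 0"
      using p(2) f0 by (simp add: peval_def[of p0])
    then have "inverse f \<in> range \<iota>" by (intro algebraic_imp_const[of "pCons (-1) p0"]) auto
    then obtain c where "inverse f = \<iota> c" by blast
    then have "f = \<iota> (inverse c)" by (metis iota_inverse inverse_inverse_eq)
    then show False using f by blast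
  qed
  then have "k.adjoin (inverse f) \<in> family"
    using k.subalgebra_adjoin k.mem_adjoin by (auto simp: family_def)
  then have "family \<noteq> {}" by blast
  then have "\<exists>M\<in>family. \<forall>R\<in>family. M \<subseteq> R \<longrightarrow> R = M"
  proof (rule subset_Zorn_nonempty)
    fix \<C> assume \<C>: "\<C> \<noteq> {}" "subset.chain family \<C>"
    then have sub: "\<C> \<subseteq> family" by (simp add: subset.chain_def)
    have common: "\<exists>R\<in>\<C>. a \<in> R \<and> b \<in> R" if ab: "a \<in> \<Union>\<C>" "b \<in> \<Union>\<C>" for a b
    proof -
      obtain R1 R2 where R: "R1 \<in> \<C>" "a \<in> R1" "R2 \<in> \<C>" "b \<in> R2" using ab by blast
      then have "R1 \<subseteq> R2 \<or> R2 \<subseteq> R1" using \<C>(2) by (auto simp: subset.chain_def)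
      then show ?thesis using R by blast
    qed
    have alg: "subalgebra \<iota> R" if "R \<in> \<C>" for R using sub that by (auto simp: family_def)
    have "subalgebra \<iota> (\<Union>\<C>)"
    proof unfold_locales
      show "\<iota> c \<in> \<Union>\<C>" for c
      proof -
        obtain R where "R \<in> \<C>" using \<C>(1) by blast
        then show ?thesis using subalgebra.const_in[OF alg] by blast
      qed
      show "a + b \<in> \<Union>\<C>" "a * b \<in> \<Union>\<C>" if ab: "a \<in> \<Union>\<C>" "b \<in> \<Union>\<C>" for a b
      proof -
        obtain R where "R \<in> \<C>" "a \<in> R" "b \<in> R" using common[OF ab] by blast
        then show "a + b \<in> \<Union>\<C>" "a * b \<in> \<Union>\<C>"
          using subalgebra.add_in[OF alg] subalgebra.mult_in[OF alg] by blast+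
      qed
    qed
    moreover have "f \<notin> \<Union>\<C>" using sub by (auto simp: family_def)
    moreover have "inverse f \<in> \<Union>\<C>" using sub \<C>(1) by (auto simp: family_def)
    ultimately show "\<Union>\<C> \<in> family" by (simp add: family_def)
  qed
  then obtain M where M: "M \<in> family" "\<And>R. R \<in> family \<Longrightarrow> M \<subseteq> R \<Longrightarrow> R = M" by blast
  then interpret M: subalgebra \<iota> M by (simp add: family_def)
  have "f \<in> M.adjoin x" if "x \<notin> M" for x
  proof (rule ccontr)
    assume "f \<notin> M.adjoin x"
    then have "M.adjoin x \<in> family"
      using M.subalgebra_adjoin M.subset_adjoin M(1) by (auto simp: family_def)
    then show False using M(2) M.subset_adjoin M.mem_adjoin that by blast
  qed
  then show ?thesis using M(1) unfolding family_def by blast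
qed

text \<open>The residue field is no larger than the field of constants: modulo \<open>1 / f\<close>, a relation between
  \<open>1 / f\<close> and \<open>u\<close> becomes a nontrivial equation for \<open>u\<close> over the constants, which splits into
  linear factors. One of them must lie in the maximal ideal \<open>M\<close>.\<close>

lemma exists_valuation_ring:
  assumes f: "f \<notin> range \<iota>" and rel: "\<And>s u. s \<noteq> 0 \<Longrightarrow> alg_related s u"
  shows "\<exists>R \<rho>. residue_map \<iota> R \<rho> \<and> f \<notin> R \<and> (\<forall>x. x \<noteq> 0 \<longrightarrow> x \<in> R \<or> inverse x \<in> R)"
proof -
  obtain R where R: "subalgebra \<iota> R" "f \<notin> R" "inverse f \<in> R" "\<And>x. x \<notin> R \<Longrightarrow> f \<in> subalgebra.adjoin R x"
    using exists_maximal_avoiding[OF f] by blast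
  interpret R: subalgebra \<iota> R by (rule R(1))
  have val: "x \<in> R \<or> inverse x \<in> R" if "x \<noteq> 0" for x
    using R.maximal_avoiding_valuation_ring[OF R(2,3,4) that] by blast
  have f0: "f \<noteq> 0" using R by auto
  define M where "M = {x \<in> R. x = 0 \<or> inverse x \<notin> R}"
  have M_mult: "a * x \<in> M" if "a \<in> R" "x \<in> M" for a x
  proof (cases "a * x = 0")
    case False
    have "inverse (a * x) \<notin> R"
    proof
      assume "inverse (a * x) \<in> R"
      then have "a * inverse (a * x) \<in> R" using that by simp
      moreover have "a * inverse (a * x) = inverse x" using False by simp
      ultimately have "inverse x \<in> R" by (simp only:)
      then show False using that False by (simp add: M_def)
    qed
    then show ?thesis using that by (simp add: M_def)
  qed (auto simp: M_def)
  have M_add: "x + w \<in> M" if xw: "x \<in> M" "w \<in> M" for x w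
  proof -
    have *: "x + w \<in> M" if "x \<in> M" "w \<in> M" "w \<noteq> 0" "x * inverse w \<in> R" for x w
    proof -
      have "x + w = (x * inverse w + 1) * w" using that by (simp add: algebra_simps)
      then show ?thesis using M_mult[of "x * inverse w + 1" w] that by simp
    qed
    show ?thesis
    proof (cases "x = 0 \<or> w = 0")
      case False
      then have "x * inverse w \<in> R \<or> w * inverse x \<in> R"
        using val[of "x * inverse w"] by (auto simp: mult.commute)
      then show ?thesis using *[of x w] *[of w x] xw False by (auto simp: add.commute)
    qed (use xw in auto)
  qed
  have M_const: "c = 0" if "\<iota> c \<in> M" for c
    using that by (auto simp: M_def simp flip: iota_inverse)
  have res: "\<exists>c. u - \<iota> c \<in> M" if u: "u \<in> R" for u
  proof (rule ccontr)
    assume neg: "\<nexists>c. u - \<iota> c \<in> M"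
    have unit: "peval p u \<noteq> 0 \<and> inverse (peval p u) \<in> R" if "p \<noteq> 0" for p
      using that
    proof (induction p rule: poly_root_induct_alg_closed)
      case (const c)
      then show ?case by (simp flip: iota_inverse)
    next
      case (step a p)
      have "u - \<iota> a \<notin> M" using neg by blast
      then have "u - \<iota> a \<noteq> 0" "inverse (u - \<iota> a) \<in> R" using u by (auto simp: M_def)
      moreover have "peval ([:- a, 1:] * p) u = (u - \<iota> a) * peval p u" by (subst peval_mult) simp
      ultimately show ?case using step by (simp del: mult_pCons_left)
    qed
    obtain N q where q: "q 0 \<noteq> 0" "(\<Sum>j\<le>N. inverse f ^ j * peval (q j) u) = 0"
      using rel[of "inverse f" u] f0 by (auto simp: alg_related_def)
    obtain a where a: "a \<in> R" "peval (q 0) u = inverse f * a"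
      using R.relation_mod[OF q(2) R(3) u] by blast
    have "f = a * inverse (peval (q 0) u)" using a(2) unit[OF q(1)] f0 by (simp add: field_simps)
    then show False using R(2) a(1) unit[OF q(1)] by (metis R.mult_in)
  qed
  define \<rho> where "\<rho> u = (SOME c. u - \<iota> c \<in> M)" for u
  have \<rho>: "u - \<iota> (\<rho> u) \<in> M" if "u \<in> R" for u
    unfolding \<rho>_def using someI_ex[OF res[OF that]] .
  have \<rho>_eq: "\<rho> u = c" if "u \<in> R" "u - \<iota> c \<in> M" for u c
  proof -
    have "\<iota> (\<rho> u - c) = (u - \<iota> c) + \<iota> (-1) * (u - \<iota> (\<rho> u))" by simp
    also have "\<dots> \<in> M" by (intro M_add M_mult \<rho> that R.const_in)
    finally show ?thesis using M_const[of "\<rho> u - c"] by simp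
  qed
  have M_0: "0 \<in> M" by (simp add: M_def)
  have "residue_map \<iota> R \<rho>"
  proof unfold_locales
    show "\<rho> (\<iota> c) = c" for c by (rule \<rho>_eq) (simp_all add: M_0)
    show "\<rho> (a + b) = \<rho> a + \<rho> b" if "a \<in> R" "b \<in> R" for a b
    proof (rule \<rho>_eq)
      have "a + b - \<iota> (\<rho> a + \<rho> b) = (a - \<iota> (\<rho> a)) + (b - \<iota> (\<rho> b))" by simp
      then show "a + b - \<iota> (\<rho> a + \<rho> b) \<in> M" using M_add \<rho> that by metis
    qed (use that in simp)
    show "\<rho> (a * b) = \<rho> a * \<rho> b" if "a \<in> R" "b \<in> R" for a b
    proof (rule \<rho>_eq)
      have "a * b - \<iota> (\<rho> a * \<rho> b) = b * (a - \<iota> (\<rho> a)) + \<iota> (\<rho> a) * (b - \<iota> (\<rho> b))"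
        by (simp add: algebra_simps)
      then show "a * b - \<iota> (\<rho> a * \<rho> b) \<in> M" using M_add M_mult \<rho> that R.const_in by metis
    qed (use that in simp)
    show "inverse a \<in> R" if "a \<in> R" "\<rho> a \<noteq> 0" for a
    proof (rule ccontr)
      assume "inverse a \<notin> R"
      then have "a - \<iota> 0 \<in> M" using that by (simp add: M_def)
      then show False using \<rho>_eq that by blast
    qed
  qed
  then show ?thesis using R(2) val by blast
qed

end

context residue_map
begin

lemma rho_prod: "(\<And>i. i \<in> I \<Longrightarrow> f i \<in> A) \<Longrightarrow> \<rho> (prod f I) = (\<Prod>i\<in>I. \<rho> (f i))"
  by (induction I rule: infinite_finite_induct) (simp_all add: prod_in)

lemma rho_sum: "(\<And>i. i \<in> I \<Longrightarrow> f i \<in> A) \<Longrightarrow> \<rho> (sum f I) = (\<Sum>i\<in>I. \<rho> (f i))"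
  by (induction I rule: infinite_finite_induct) (simp_all add: sum_in)

lemma rho_geval:
  assumes w: "\<And>i. w $ i \<in> A" "\<And>i. \<rho> (w $ i) = a $ i"
  shows "geval F w \<in> A" "\<rho> (geval F w) = mpol_eval F a"
proof -
  have m: "monomial_value m w \<in> A" "\<rho> (monomial_value m w) = monomial_value m a" for m
    unfolding monomial_value_def using w by (simp_all add: prod_in rho_prod)
  show "geval F w \<in> A" unfolding geval_def using m by (intro sum_in) simp
  show "\<rho> (geval F w) = mpol_eval F a"
    unfolding geval_def mpol_eval_monomials using m by (subst rho_sum) simp_all
qed

end

section \<open>The valuations of a smooth projective curve\<close>

lemma homogeneous_power: "homogeneous d F \<Longrightarrow> homogeneous (n * d) (F ^ n)"
  by (induction n) (auto intro: homogeneous_mult)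

lemma (in coefficient_field) geval_power [simp]: "geval (F ^ n) w = geval F w ^ n"
  by (induction n) simp_all

lemmas mpol_eval_power [simp] = coefficient_field.geval_power[OF coefficient_field_id, unfolded geval_id]

text \<open>A form for the smaller set is corrected by a multiple \<open>e\<close> of a coordinate; each vector excludes at
  most one \<open>e\<close>.\<close>

lemma exists_nonvanishing_linear_form:
  fixes S :: "('a::alg_closed_field ^ 'n::finite) set"
  assumes "finite S" "0 \<notin> S"
  shows "\<exists>c. \<forall>w\<in>S. mpol_eval (linear_form c) w \<noteq> 0"
  using assms
proof (induction S rule: finite_induct)
  case (insert x S)
  then obtain c where c: "\<forall>w\<in>S. mpol_eval (linear_form c) w \<noteq> 0" by auto
  have "\<exists>i. x $ i \<noteq> 0" using insert.prems by (auto simp: vec_eq_iff)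
  then obtain i where i: "x $ i \<noteq> 0" by blast
  define bad where "bad = (\<lambda>w. - mpol_eval (linear_form c) w / w $ i) ` insert x S"
  have "finite (insert 0 bad)" using insert.hyps by (simp add: bad_def)
  then obtain e where e: "e \<notin> insert 0 bad" using infinite_alg_closed ex_new_if_finite by blast
  define c' where "c' k = c k + e * (if k = i then 1 else 0)" for k
  have ev: "mpol_eval (linear_form c') w = mpol_eval (linear_form c) w + e * w $ i" for w
  proof -
    have "mpol_eval (linear_form c') w = mpol_eval (linear_form c) w + e * (\<Sum>k\<in>UNIV. (if k = i then 1 else 0) * w $ k)"
      by (simp add: c'_def ring_distribs sum.distrib sum_distrib_left mult.assoc)
    then show ?thesis by (simp add: sum_delta_mult)
  qed
  have "mpol_eval (linear_form c') w \<noteq> 0" if w: "w \<in> insert x S" for w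
  proof (cases "w $ i = 0")
    case True
    then show ?thesis using w i c unfolding ev by auto
  next
    case False
    show ?thesis
    proof
      assume "mpol_eval (linear_form c') w = 0"
      then have "e = - mpol_eval (linear_form c) w / w $ i" using False unfolding ev by (simp add: field_simps eq_neg_iff_add_eq_0)
      then show False using e w unfolding bad_def by blast
    qed
  qed
  then show ?case by blast
qed simp

lemma finite_vectors:
  assumes "\<And>i. finite (B i)"
  shows "finite {w :: 'a ^ 'n::finite. \<forall>i. w $ i \<in> B i}"
proof -
  have "{w :: 'a ^ 'n. \<forall>i. w $ i \<in> B i} \<subseteq> vec_lambda ` (PiE UNIV B)"
  proof
    fix w :: "'a ^ 'n" assume "w \<in> {w. \<forall>i. w $ i \<in> B i}"
    then have "($) w \<in> PiE UNIV B" by auto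
    then show "w \<in> vec_lambda ` (PiE UNIV B)" by (metis image_eqI vec_nth_inverse)
  qed
  then show ?thesis using assms by (meson finite_PiE finite_class.finite_UNIV finite_imageI finite_subset)
qed

text \<open>The function field \<open>'f\<close> of the curve with equations \<open>E\<close> is given by its generic point \<open>y\<close>: a
  homogeneous polynomial vanishes at \<open>y\<close> just if it vanishes on the curve, and every element is
  a quotient of two values at \<open>y\<close>.\<close>

locale projective_curve = alg_closed_coefficients \<iota> for \<iota> :: "'a::alg_closed_field \<Rightarrow> 'f::field" +
  fixes E :: "('n::finite, 'a) mpol set" and y :: "'f ^ 'n"
  assumes E_homogeneous: "F \<in> E \<Longrightarrow> \<exists>d. homogeneous d F"
    and generic: "homogeneous d F \<Longrightarrow> geval F y = 0 \<longleftrightarrow> vanishes_on (zero_locus E) F"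
    and fraction: "\<exists>d F G. homogeneous d F \<and> homogeneous d G \<and> geval G y \<noteq> 0 \<and> f = geval F y / geval G y"
    and related: "s \<noteq> 0 \<Longrightarrow> alg_related s u"
    and nonconst: "\<exists>x. x \<notin> range \<iota>"
    and nonempty: "zero_locus E \<noteq> {}"
    and smooth: "P \<in> zero_locus E \<Longrightarrow> v \<in> P \<Longrightarrow> vec.dim ((\<lambda>F. gradient F v) ` E) + 2 = CARD('n)"
begin

abbreviation pts :: "('a, 'n) ppoint set" where "pts \<equiv> zero_locus E"

text \<open>The local ring of \<open>P\<close> and the evaluation at \<open>P\<close>.\<close>

definition stalk :: "('a, 'n) ppoint \<Rightarrow> 'f set" where
  "stalk P = {geval F y / geval G y | F G. (\<exists>d. homogeneous d F \<and> homogeneous d G) \<and> (\<exists>w\<in>P. mpol_eval G w \<noteq> 0)}"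

definition stalk_value :: "('a, 'n) ppoint \<Rightarrow> 'f \<Rightarrow> 'a" where
  "stalk_value P f = (THE c. \<exists>F G. (\<exists>d. homogeneous d F \<and> homogeneous d G) \<and> f = geval F y / geval G y \<and>
     (\<exists>w\<in>P. mpol_eval G w \<noteq> 0 \<and> c = mpol_eval F w / mpol_eval G w))"

lemma pts_proj: "P \<in> pts \<Longrightarrow> P \<in> proj_space"
  by (simp add: zero_locus_def)

lemma nonvanishing:
  assumes "P \<in> pts" "w \<in> P" "homogeneous d G" "mpol_eval G w \<noteq> 0" shows "geval G y \<noteq> 0"
  using assms generic[OF assms(3)] by (auto simp: vanishes_on_def)

lemma stalk_cases:
  assumes "P \<in> pts" "w \<in> P" "f \<in> stalk P"
  obtains d F G where "homogeneous d F" "homogeneous d G" "mpol_eval G w \<noteq> 0" "f = geval F y / geval G y"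
proof -
  obtain d F G w' where *: "homogeneous d F" "homogeneous d G" "w' \<in> P" "mpol_eval G w' \<noteq> 0" "f = geval F y / geval G y"
    using assms(3) unfolding stalk_def by blast
  then have "mpol_eval G w \<noteq> 0" using homogeneous_zero_iff[OF *(2) pts_proj[OF assms(1)]] assms(2) by blast
  then show thesis using * that by blast
qed

lemma stalkI:
  "w \<in> P \<Longrightarrow> homogeneous d F \<Longrightarrow> homogeneous d G \<Longrightarrow> mpol_eval G w \<noteq> 0 \<Longrightarrow> geval F y / geval G y \<in> stalk P"
  unfolding stalk_def by blast

lemma stalk_value_eq:
  assumes P: "P \<in> pts" and w: "w \<in> P" and F: "homogeneous d F" "homogeneous d G" "mpol_eval G w \<noteq> 0"
  shows "stalk_value P (geval F y / geval G y) = mpol_eval F w / mpol_eval G w"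
  unfolding stalk_value_def
proof (rule the_equality)
  fix c assume "\<exists>F' G'. (\<exists>d. homogeneous d F' \<and> homogeneous d G') \<and> geval F y / geval G y = geval F' y / geval G' y \<and>
     (\<exists>w\<in>P. mpol_eval G' w \<noteq> 0 \<and> c = mpol_eval F' w / mpol_eval G' w)"
  then obtain F' G' d' w' where F': "homogeneous d' F'" "homogeneous d' G'" "w' \<in> P" "mpol_eval G' w' \<noteq> 0"
    and eq: "geval F y / geval G y = geval F' y / geval G' y" and c: "c = mpol_eval F' w' / mpol_eval G' w'" by blast
  have G'w: "mpol_eval G' w \<noteq> 0" using homogeneous_zero_iff[OF F'(2) pts_proj[OF P] F'(3) w] F'(4) by blast
  have "geval (F * G' - F' * G) y = 0"
    using eq nonvanishing[OF P w F(2,3)] nonvanishing[OF P w F'(2) G'w] by (simp add: frac_eq_eq)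
  moreover have "homogeneous (d + d') (F * G' - F' * G)"
    using F F' by (metis add.commute homogeneous_diff homogeneous_mult)
  ultimately have "vanishes_on pts (F * G' - F' * G)" using generic by blast
  then have "mpol_eval (F * G' - F' * G) w = 0"
    using P w unfolding vanishes_on_def by blast
  then have "mpol_eval F' w / mpol_eval G' w = mpol_eval F w / mpol_eval G w"
    using G'w F(3) by (simp add: frac_eq_eq)
  then show "c = mpol_eval F w / mpol_eval G w"
    using c homogeneous_ratio_eq[OF F'(1,2) pts_proj[OF P] F'(3) w] by simp
qed (use assms in blast)

lemma stalk_residue_map:
  assumes P: "P \<in> pts" shows "residue_map \<iota> (stalk P) (stalk_value P)"
proof -
  obtain w where w: "w \<in> P" using pts_proj[OF P] proj_point_mem by (auto simp: proj_space_def)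
  note nv = nonvanishing[OF P w] and val = stalk_value_eq[OF P w] and st = stalkI[OF w]
  show ?thesis
  proof unfold_locales
    fix c
    have c: "\<iota> c = geval (mpol_const c) y / geval 1 y" by simp
    show "\<iota> c \<in> stalk P" unfolding c by (rule st[of 0]) auto
    have "stalk_value P (\<iota> c) = mpol_eval (mpol_const c) w / mpol_eval 1 w"
      unfolding c by (rule val[of 0]) auto
    then show "stalk_value P (\<iota> c) = c" by simp
  next
    fix f g assume f: "f \<in> stalk P" and g: "g \<in> stalk P"
    obtain d F G where F: "homogeneous d F" "homogeneous d G" "mpol_eval G w \<noteq> 0" "f = geval F y / geval G y"
      using stalk_cases[OF P w f] .
    obtain d' F' G' where F': "homogeneous d' F'" "homogeneous d' G'" "mpol_eval G' w \<noteq> 0" "g = geval F' y / geval G' y"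
      using stalk_cases[OF P w g] .
    have hom: "homogeneous (d + d') (F * G' + F' * G)" "homogeneous (d + d') (F * F')" "homogeneous (d + d') (G * G')"
      using F F' by (metis add.commute homogeneous_add homogeneous_mult)+
    have add: "f + g = geval (F * G' + F' * G) y / geval (G * G') y"
      using F(4) F'(4) nv[OF F(2,3)] nv[OF F'(2,3)] by (simp add: add_frac_eq)
    have mul: "f * g = geval (F * F') y / geval (G * G') y" using F(4) F'(4) by simp
    have GG: "mpol_eval (G * G') w \<noteq> 0" using F F' by simp
    show "f + g \<in> stalk P" unfolding add by (rule st[OF hom(1,3) GG])
    show "f * g \<in> stalk P" unfolding mul by (rule st[OF hom(2,3) GG])
    have fv: "stalk_value P f = mpol_eval F w / mpol_eval G w" "stalk_value P g = mpol_eval F' w / mpol_eval G' w"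
      using val F F' by auto
    have "stalk_value P (f + g) = mpol_eval (F * G' + F' * G) w / mpol_eval (G * G') w"
      unfolding add by (rule val[OF hom(1,3) GG])
    then show "stalk_value P (f + g) = stalk_value P f + stalk_value P g"
      unfolding fv using F(3) F'(3) by (simp add: add_frac_eq)
    have "stalk_value P (f * g) = mpol_eval (F * F') w / mpol_eval (G * G') w"
      unfolding mul by (rule val[OF hom(2,3) GG])
    then show "stalk_value P (f * g) = stalk_value P f * stalk_value P g"
      unfolding fv by simp
  next
    fix f assume f: "f \<in> stalk P" and f0: "stalk_value P f \<noteq> 0"
    obtain d F G where F: "homogeneous d F" "homogeneous d G" "mpol_eval G w \<noteq> 0" "f = geval F y / geval G y"
      using stalk_cases[OF P w f] .
    then have "mpol_eval F w \<noteq> 0" using val[OF F(1-3)] f0 by auto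
    then have "geval G y / geval F y \<in> stalk P" using st F by blast
    then show "inverse f \<in> stalk P" using F(4) by simp
  qed
qed

lemma normalized_representative:
  assumes "P \<in> pts" obtains w j where "w \<in> P" "w $ j = 1"
proof -
  obtain u where u: "u \<noteq> 0" "P = proj_point u" using pts_proj[OF assms] by (auto simp: proj_space_def)
  then obtain j where j: "u $ j \<noteq> 0" by (auto simp: vec_eq_iff)
  then have "(1 / u $ j) *s u \<in> P" unfolding u proj_point_def by (intro CollectI exI[of _ "1 / u $ j"]) simp
  moreover have "((1 / u $ j) *s u) $ j = 1" using j by simp
  ultimately show thesis using that by blast
qed

lemma coordinate_nonzero:
  assumes "P \<in> pts" "w \<in> P" "w $ j \<noteq> 0" shows "y $ j \<noteq> 0"
  using nonvanishing[OF assms(1,2) homogeneous_coordinate[of j]] assms(3) by simp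

lemma affine_coordinates:
  assumes P: "P \<in> pts" and w: "w \<in> P" "w $ j = 1"
  shows "y $ i / y $ j \<in> stalk P" "stalk_value P (y $ i / y $ j) = w $ i"
proof -
  have "geval (coordinate i) y / geval (coordinate j) y \<in> stalk P"
    by (rule stalkI[OF w(1) homogeneous_coordinate homogeneous_coordinate]) (use w in auto)
  then show "y $ i / y $ j \<in> stalk P" by simp
  have "stalk_value P (geval (coordinate i) y / geval (coordinate j) y) = mpol_eval (coordinate i) w / mpol_eval (coordinate j) w"
    by (rule stalk_value_eq[OF P w(1) homogeneous_coordinate homogeneous_coordinate]) (use w in auto)
  then show "stalk_value P (y $ i / y $ j) = w $ i" using w by simp
qed

lemma geval_affine:
  assumes "homogeneous d F" shows "geval F (\<chi> i. y $ i / y $ j) = geval F y / (y $ j) ^ d"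
proof -
  have "(\<chi> i. y $ i / y $ j) = (1 / y $ j) *s y" by (simp add: vec_eq_iff)
  then show ?thesis using geval_scale[OF assms] by (simp add: power_divide)
qed

lemma affine_quotient:
  assumes "homogeneous d F" "homogeneous d G" "y $ j \<noteq> 0"
  shows "geval F y / geval G y = geval F (\<chi> i. y $ i / y $ j) / geval G (\<chi> i. y $ i / y $ j)"
  using assms by (simp add: geval_affine)

text \<open>In the affine chart \<open>w $ j = 1\<close> the maximal ideal is generated by the coordinates minus their values
  at \<open>P\<close>. By Taylor expansion every equation \<open>F\<close> of the curve gives a linear relation among these
  generators modulo the square of the ideal, whose coefficients are the gradient of \<open>F\<close>.\<close>

lemma stalk_smooth_local_ring:
  assumes P: "P \<in> pts" and w: "w \<in> P" "w $ j = 1"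
  shows "smooth_local_ring \<iota> (stalk P) (stalk_value P) (\<lambda>i. y $ i / y $ j - \<iota> (w $ i))"
proof -
  interpret residue_map \<iota> "stalk P" "stalk_value P" by (rule stalk_residue_map[OF P])
  define u where "u = (\<chi> i. y $ i / y $ j)"
  define z where "z i = u $ i - \<iota> (w $ i)" for i
  have yj: "y $ j \<noteq> 0" using coordinate_nonzero[OF P w(1), of j] w by simp
  have u: "u $ i \<in> stalk P" "stalk_value P (u $ i) = w $ i" for i
    using affine_coordinates[OF P w] by (simp_all add: u_def)
  note ev = rho_geval[of u w, OF u]
  have z: "z i \<in> stalk P" "stalk_value P (z i) = 0" for i using u by (simp_all add: z_def)
  have tay: "taylor z (geval F u) (mpol_eval F w) (\<lambda>i. gradient F w $ i)" for F
    unfolding z_def by (rule taylor_mpol[OF u])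
  have "smooth_local_ring \<iota> (stalk P) (stalk_value P) z"
  proof unfold_locales
    fix f
    obtain d F G where F: "homogeneous d F" "homogeneous d G" "geval G y \<noteq> 0" "f = geval F y / geval G y"
      using fraction by blast
    have "geval G u \<noteq> 0" using F yj by (simp add: u_def geval_affine)
    moreover have "f = geval F u / geval G u"
      unfolding u_def F(4) by (rule affine_quotient[OF F(1,2) yj])
    ultimately show "\<exists>a b. a \<in> stalk P \<and> b \<in> stalk P \<and> b \<noteq> 0 \<and> f = a / b" using ev(1) by blast
  next
    fix f assume f: "f \<in> stalk P" "stalk_value P f = 0"
    obtain d F G where F: "homogeneous d F" "homogeneous d G" "mpol_eval G w \<noteq> 0" "f = geval F y / geval G y"
      using stalk_cases[OF P w(1) f(1)] .
    have Fw: "mpol_eval F w = 0" using stalk_value_eq[OF P w(1) F(1-3)] f(2) F(3,4) by simp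
    obtain b where b: "\<forall>j. b j \<in> stalk P \<and> stalk_value P (b j) = 0"
      "geval F u - (\<iota> 0 + (\<Sum>i\<in>UNIV. \<iota> (gradient F w $ i) * z i)) = (\<Sum>j\<in>UNIV. b j * z j)"
      using tay[of F] unfolding Fw taylor_def square_ideal_def by blast
    have Gu: "inverse (geval G u) \<in> stalk P" using ev F(3) by (intro inverse_in) auto
    have "f = inverse (geval G u) * geval F u"
      unfolding u_def F(4) using affine_quotient[OF F(1,2) yj] by (simp add: field_simps)
    also have "geval F u = (\<Sum>i\<in>UNIV. (\<iota> (gradient F w $ i) + b i) * z i)"
      using b(2) by (simp add: ring_distribs sum.distrib algebra_simps)
    finally have "f = (\<Sum>i\<in>UNIV. (inverse (geval G u) * (\<iota> (gradient F w $ i) + b i)) * z i)"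
      by (simp add: sum_distrib_left mult.assoc)
    then show "\<exists>b. (\<forall>i. b i \<in> stalk P) \<and> f = (\<Sum>i\<in>UNIV. b i * z i)"
      using b(1) Gu by (intro exI[of _ "\<lambda>i. inverse (geval G u) * (\<iota> (gradient F w $ i) + b i)"]) auto
  next
    have "\<exists>i0. \<forall>i. \<exists>c. z i - \<iota> c * z i0 \<in> square_ideal z"
    proof (rule jacobian_cotangent)
      show "vec.dim ((\<lambda>F. gradient F w) ` E) + 2 = CARD('n)" by (rule smooth[OF P w(1)])
      show "w $ j = 1" by (rule w(2))
      show "z j = 0" using w yj by (simp add: z_def u_def)
    next
      fix g assume "g \<in> (\<lambda>F. gradient F w) ` E"
      then obtain F where F: "F \<in> E" "g = gradient F w" by blast
      obtain d where d: "homogeneous d F" using E_homogeneous F by blast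
      have Fw: "mpol_eval F w = 0" using P w F by (auto simp: zero_locus_def)
      show "(\<Sum>i\<in>UNIV. w $ i * g $ i) = 0" using euler_homogeneous[OF d, of w] Fw F by simp
      have "geval F y = 0" using generic[OF d] F by (auto simp: vanishes_on_def zero_locus_def)
      then have "geval F u = 0" using d by (simp add: u_def geval_affine)
      then have "- (\<Sum>i\<in>UNIV. \<iota> (g $ i) * z i) \<in> square_ideal z"
        using tay[of F] Fw by (simp add: taylor_def F(2))
      then have "\<iota> (-1) * - (\<Sum>i\<in>UNIV. \<iota> (g $ i) * z i) \<in> square_ideal z"
        by (rule square_ideal_mult) (rule const_in)
      then show "(\<Sum>i\<in>UNIV. \<iota> (g $ i) * z i) \<in> square_ideal z" by simp
    qed
    then obtain i0 where i0: "\<And>i. \<exists>c. z i - \<iota> c * z i0 \<in> square_ideal z" by blast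
    show "\<exists>i0. \<forall>i. \<exists>c b. (\<forall>j. b j \<in> stalk P \<and> stalk_value P (b j) = 0) \<and> z i = \<iota> c * z i0 + (\<Sum>j\<in>UNIV. b j * z j)"
    proof (intro exI[of _ i0] allI)
      fix i
      obtain c where "z i - \<iota> c * z i0 \<in> square_ideal z" using i0 by blast
      then obtain b where "\<forall>j. b j \<in> stalk P \<and> stalk_value P (b j) = 0" "z i - \<iota> c * z i0 = (\<Sum>j\<in>UNIV. b j * z j)"
        unfolding square_ideal_def by blast
      then show "\<exists>c b. (\<forall>j. b j \<in> stalk P \<and> stalk_value P (b j) = 0) \<and> z i = \<iota> c * z i0 + (\<Sum>j\<in>UNIV. b j * z j)"
        by (intro exI[of _ c] exI[of _ b]) (simp add: algebra_simps)
    qed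
  qed (use z related nonconst in auto)
  moreover have "z = (\<lambda>i. y $ i / y $ j - \<iota> (w $ i))" by (simp add: fun_eq_iff z_def u_def)
  ultimately show ?thesis by simp
qed

definition val :: "('a, 'n) ppoint \<Rightarrow> 'f \<Rightarrow> int" where
  "val P = residue_map.ord (stalk P) (stalk_value P)"

text \<open>In an affine chart let \<open>s\<close> be the function given by \<open>F\<close>. Where \<open>s\<close> vanishes, the relation between
  \<open>s\<close> and a coordinate becomes an equation with finitely many roots for the value of this coordinate.\<close>

lemma finite_zeros:
  assumes F: "homogeneous d F" "geval F y \<noteq> 0"
  shows "finite {P \<in> pts. \<exists>w\<in>P. mpol_eval F w = 0}"
proof -
  define chart where "chart j = {P \<in> pts. \<exists>w\<in>P. w $ j = 1 \<and> mpol_eval F w = 0}" for j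
  have "finite (chart j)" for j
  proof (cases "y $ j = 0")
    case True
    then have "chart j = {}" using coordinate_nonzero unfolding chart_def by fastforce
    then show ?thesis by simp
  next
    case yj: False
    define s where "s = geval F (\<chi> i. y $ i / y $ j)"
    have s0: "s \<noteq> 0" using F yj by (simp add: s_def geval_affine)
    have "\<exists>q. q \<noteq> 0 \<and> (\<forall>P\<in>pts. \<forall>w\<in>P. w $ j = 1 \<longrightarrow> mpol_eval F w = 0 \<longrightarrow> poly q (w $ i) = 0)" for i
    proof -
      obtain N q where q: "q 0 \<noteq> 0" "(\<Sum>k\<le>N. s ^ k * peval (q k) (y $ i / y $ j)) = 0"
        using related[OF s0, of "y $ i / y $ j"] unfolding alg_related_def by blast
      have "poly (q 0) (w $ i) = 0" if P: "P \<in> pts" and w: "w \<in> P" "w $ j = 1" and Fw: "mpol_eval F w = 0" for P w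
      proof -
        interpret residue_map \<iota> "stalk P" "stalk_value P" by (rule stalk_residue_map[OF P])
        note u = affine_coordinates[OF P w]
        have "s \<in> stalk P" "stalk_value P s = 0"
          unfolding s_def using rho_geval[of "\<chi> i. y $ i / y $ j" w] u Fw by simp_all
        then show ?thesis using rho_relation[OF q(2) _ _ u(1)] u(2) by simp
      qed
      then show ?thesis using q(1) by blast
    qed
    then obtain q where q: "\<And>i. q i \<noteq> 0"
      "\<And>i P w. P \<in> pts \<Longrightarrow> w \<in> P \<Longrightarrow> w $ j = 1 \<Longrightarrow> mpol_eval F w = 0 \<Longrightarrow> poly (q i) (w $ i) = 0"
      by metis
    have "chart j \<subseteq> proj_point ` {w. \<forall>i. w $ i \<in> {a. poly (q i) a = 0}}"
    proof
      fix P assume "P \<in> chart j"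
      then obtain w where "P \<in> pts" "w \<in> P" "w $ j = 1" "mpol_eval F w = 0" by (auto simp: chart_def)
      moreover from this have "P = proj_point w" using proj_space_cases pts_proj by blast
      ultimately show "P \<in> proj_point ` {w. \<forall>i. w $ i \<in> {a. poly (q i) a = 0}}" using q(2) by blast
    qed
    moreover have "finite {w :: 'a ^ 'n. \<forall>i. w $ i \<in> {a. poly (q i) a = 0}}"
      using q(1) poly_roots_finite by (intro finite_vectors) blast
    ultimately show ?thesis by (meson finite_imageI finite_subset)
  qed
  moreover have "{P \<in> pts. \<exists>w\<in>P. mpol_eval F w = 0} \<subseteq> (\<Union>j\<in>UNIV. chart j)"
  proof
    fix P assume P: "P \<in> {P \<in> pts. \<exists>w\<in>P. mpol_eval F w = 0}"
    then obtain w j where "w \<in> P" "w $ j = 1" using normalized_representative by blast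
    moreover from this have "mpol_eval F w = 0" using P homogeneous_zero_iff[OF F(1)] pts_proj by blast
    ultimately show "P \<in> (\<Union>j\<in>UNIV. chart j)" using P by (auto simp: chart_def)
  qed
  ultimately show ?thesis by (meson finite_UN finite_class.finite_UNIV finite_subset)
qed

text \<open>The quotient of a linear form through \<open>Q\<close> but not \<open>P\<close> by a linear form through no point of \<open>S\<close>.\<close>

lemma exists_separating_function:
  assumes S: "finite S" "S \<subseteq> pts" "P \<in> S" "Q \<in> S" "Q \<noteq> P"
  shows "\<exists>g. g \<noteq> 0 \<and> stalk_value P g \<noteq> 0 \<and> stalk_value Q g = 0 \<and> (\<forall>R\<in>S. g \<in> stalk R)"
proof -
  define r where "r R = (SOME w. w \<in> R)" for R :: "('a, 'n) ppoint"
  have r: "r R \<in> R" if "R \<in> S" for R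
  proof -
    obtain w where "w \<in> R" using normalized_representative[of R] S(2) \<open>R \<in> S\<close> by blast
    then show ?thesis unfolding r_def by (rule someI)
  qed
  have prj: "R = proj_point (r R)" "r R \<noteq> 0" if "R \<in> S" for R
    using proj_space_cases[OF pts_proj r[OF that]] that S(2) by blast+
  have "finite (r ` S)" "0 \<notin> r ` S" using S(1) prj(2) by auto
  from exists_nonvanishing_linear_form[OF this]
  obtain c where c: "\<forall>w\<in>r ` S. mpol_eval (linear_form c) w \<noteq> 0" ..
  obtain j where j: "r Q $ j \<noteq> 0" using prj(2)[OF S(4)] by (auto simp: vec_eq_iff)
  have "\<exists>i. r P $ i * r Q $ j \<noteq> r P $ j * r Q $ i"
  proof (rule ccontr)
    assume "\<not> ?thesis"
    then have eq: "r P = (r P $ j / r Q $ j) *s r Q" using j by (simp add: vec_eq_iff field_simps)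
    then have "r P $ j / r Q $ j \<noteq> 0" using prj(2)[OF S(3)] by (metis vector_smult_lzero)
    then have "r P \<in> proj_point (r Q)" using eq unfolding proj_point_def by blast
    then have "proj_point (r P) = proj_point (r Q)" by (rule proj_point_eq)
    then show False using prj S by metis
  qed
  then obtain i where i: "r P $ i * r Q $ j \<noteq> r P $ j * r Q $ i" by blast
  define L where "L = mpol_const (r Q $ j) * coordinate i - mpol_const (r Q $ i) * coordinate j"
  have L: "homogeneous 1 L"
    unfolding L_def using homogeneous_mult[OF homogeneous_const homogeneous_coordinate]
    by (intro homogeneous_diff) auto
  have val: "stalk_value R (geval L y / geval (linear_form c) y) = mpol_eval L (r R) / mpol_eval (linear_form c) (r R)"
    "geval L y / geval (linear_form c) y \<in> stalk R" if "R \<in> S" for R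
  proof -
    have R: "R \<in> pts" "mpol_eval (linear_form c) (r R) \<noteq> 0" using that S(2) c by blast+
    show "stalk_value R (geval L y / geval (linear_form c) y) = mpol_eval L (r R) / mpol_eval (linear_form c) (r R)"
      by (rule stalk_value_eq[OF R(1) r[OF that] L homogeneous_linear_form R(2)])
    show "geval L y / geval (linear_form c) y \<in> stalk R"
      by (rule stalkI[OF r[OF that] L homogeneous_linear_form R(2)])
  qed
  have "mpol_eval L (r P) \<noteq> 0" using i by (simp add: L_def algebra_simps)
  moreover have "geval L y \<noteq> 0" using nonvanishing[OF _ r[OF S(3)] L calculation] S by blast
  moreover have "geval (linear_form c) y \<noteq> 0"
    using nonvanishing[OF _ r[OF S(3)] homogeneous_linear_form] S c by blast
  moreover have "mpol_eval L (r Q) = 0" by (simp add: L_def)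
  moreover have "mpol_eval (linear_form c) (r P) \<noteq> 0" using S c by blast
  ultimately show ?thesis
    using val[OF S(3)] val[OF S(4)] val(2)
    by (intro exI[of _ "geval L y / geval (linear_form c) y"]) (simp del: geval_linear_form mpol_eval_linear_form)
qed

text \<open>Here the curve being projective is used. If \<open>f\<close> is not constant, then it has a pole at some valuation
  ring \<open>R\<close>. Divided by the one of least valuation, the homogeneous coordinates of the generic point
  lie in \<open>R\<close>; their residues are the coordinates of a point of the curve, whose local ring
  is contained in \<open>R\<close>. So \<open>f\<close> is not regular there.\<close>

lemma regular_everywhere_const:
  assumes "\<And>P. P \<in> pts \<Longrightarrow> f \<in> stalk P"
  shows "f \<in> range \<iota>"
proof (rule ccontr)
  assume "f \<notin> range \<iota>"
  then obtain R \<rho> where R: "residue_map \<iota> R \<rho>" "f \<notin> R" "\<And>x. x \<noteq> 0 \<Longrightarrow> x \<in> R \<or> inverse x \<in> R"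
    using exists_valuation_ring related by blast
  interpret R: residue_map \<iota> R \<rho> by (rule R(1))
  obtain P0 where "P0 \<in> pts" using nonempty by blast
  then obtain w0 j0 where "w0 \<in> P0" "w0 $ j0 = 1" by (rule normalized_representative)
  then have j0: "y $ j0 \<noteq> 0" using coordinate_nonzero \<open>P0 \<in> pts\<close> by (metis zero_neq_one)
  have largest: "\<exists>j\<in>I. \<forall>i\<in>I. y $ i / y $ j \<in> R" if "finite I" "I \<noteq> {}" "\<forall>i\<in>I. y $ i \<noteq> 0" for I
    using that
  proof (induction I rule: finite_ne_induct)
    case (insert k I)
    then obtain j where j: "j \<in> I" "\<forall>i\<in>I. y $ i / y $ j \<in> R" by auto
    have "y $ k / y $ j \<in> R \<or> y $ j / y $ k \<in> R"
      using R(3)[of "y $ k / y $ j"] insert.prems j by auto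
    then show ?case
    proof
      assume k: "y $ j / y $ k \<in> R"
      have "y $ i / y $ k \<in> R" if "i \<in> I" for i
      proof -
        have "y $ i / y $ k = (y $ i / y $ j) * (y $ j / y $ k)" using insert.prems j by simp
        then show ?thesis using j(2) k that by (metis R.mult_in)
      qed
      moreover have "y $ k / y $ k \<in> R" using insert.prems by simp
      ultimately show ?thesis by blast
    qed (use j in blast)
  qed simp
  define I where "I = {i. y $ i \<noteq> 0}"
  have "finite I" "I \<noteq> {}" "\<forall>i\<in>I. y $ i \<noteq> 0" using j0 by (auto simp: I_def)
  from largest[OF this] obtain j where "j \<in> I" "\<forall>i\<in>I. y $ i / y $ j \<in> R" by blast
  then have j: "y $ j \<noteq> 0" "\<And>i. y $ i \<noteq> 0 \<Longrightarrow> y $ i / y $ j \<in> R" by (simp_all add: I_def)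
  define u where "u = (\<chi> i. y $ i / y $ j)"
  define a where "a = (\<chi> i. \<rho> (u $ i))"
  have uR: "u $ i \<in> R" for i using j(2)[of i] by (cases "y $ i = 0") (simp_all add: u_def)
  have ev: "geval F u \<in> R" "\<rho> (geval F u) = mpol_eval F a" for F
    using R.rho_geval[of u a F] uR by (simp_all add: a_def)
  have aj: "a $ j = 1" using j by (simp add: a_def u_def)
  have "proj_point a \<in> proj_space" unfolding proj_space_def using aj by (metis (mono_tags, lifting) mem_Collect_eq zero_index zero_neq_one)
  have "mpol_eval F a = 0" if F: "F \<in> E" for F
  proof -
    obtain d where d: "homogeneous d F" using E_homogeneous F by blast
    have "geval F y = 0" using generic[OF d] F by (auto simp: vanishes_on_def zero_locus_def)
    then have "geval F u = 0" using d by (simp add: u_def geval_affine)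
    then show ?thesis using ev(2)[of F] by simp
  qed
  then have "proj_point a \<in> pts"
    unfolding zero_locus_def using \<open>proj_point a \<in> proj_space\<close> E_homogeneous homogeneous_zero_iff proj_point_mem by blast
  then obtain d F G where F: "homogeneous d F" "homogeneous d G" "mpol_eval G a \<noteq> 0" "f = geval F y / geval G y"
    using stalk_cases[OF _ proj_point_mem assms] by metis
  have "f = geval F u * inverse (geval G u)"
    unfolding F(4) u_def using affine_quotient[OF F(1,2) j(1)] by (simp add: divide_inverse)
  moreover have "inverse (geval G u) \<in> R" using R.inverse_in[of "geval G u"] ev F(3) by simp
  ultimately show False using R(2) ev(1) by (metis R.mult_in)
qed

lemma
  fixes f g :: 'f
  assumes P: "P \<in> pts"
  shows val_mult: "f \<noteq> 0 \<Longrightarrow> g \<noteq> 0 \<Longrightarrow> val P (f * g) = val P f + val P g"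
    and val_nonneg_iff: "f \<noteq> 0 \<Longrightarrow> 0 \<le> val P f \<longleftrightarrow> f \<in> stalk P"
    and val_pos_iff: "f \<noteq> 0 \<Longrightarrow> 1 \<le> val P f \<longleftrightarrow> f \<in> stalk P \<and> stalk_value P f = 0"
proof -
  obtain w j where w: "w \<in> P" "w $ j = 1" using normalized_representative[OF P] .
  interpret smooth_local_ring \<iota> "stalk P" "stalk_value P" "\<lambda>i. y $ i / y $ j - \<iota> (w $ i)"
    by (rule stalk_smooth_local_ring[OF P w])
  show "f \<noteq> 0 \<Longrightarrow> g \<noteq> 0 \<Longrightarrow> val P (f * g) = val P f + val P g"
    "f \<noteq> 0 \<Longrightarrow> 0 \<le> val P f \<longleftrightarrow> f \<in> stalk P"
    "f \<noteq> 0 \<Longrightarrow> 1 \<le> val P f \<longleftrightarrow> f \<in> stalk P \<and> stalk_value P f = 0"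
    unfolding val_def using ord_mult ord_nonneg_iff ord_pos_iff by simp_all
qed

lemma val_zero_iff: "P \<in> pts \<Longrightarrow> f \<noteq> 0 \<Longrightarrow> val P f = 0 \<longleftrightarrow> f \<in> stalk P \<and> stalk_value P f \<noteq> 0"
  using val_nonneg_iff[of P f] val_pos_iff[of P f] by linarith

sublocale valuations \<iota> pts val
proof unfold_locales
  fix P and f g :: 'f assume P: "P \<in> pts" and fg: "f \<noteq> 0" "g \<noteq> 0" "f + g \<noteq> 0"
  obtain w j where w: "w \<in> P" "w $ j = 1" using normalized_representative[OF P] .
  interpret smooth_local_ring \<iota> "stalk P" "stalk_value P" "\<lambda>i. y $ i / y $ j - \<iota> (w $ i)"
    by (rule stalk_smooth_local_ring[OF P w])
  show "min (val P f) (val P g) \<le> val P (f + g)" unfolding val_def using ord_add fg by blast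
next
  fix P and c :: 'a assume P: "P \<in> pts" and c: "c \<noteq> 0"
  interpret residue_map \<iota> "stalk P" "stalk_value P" by (rule stalk_residue_map[OF P])
  show "val P (\<iota> c) = 0" using val_zero_iff[OF P] c by simp
next
  fix P and f :: 'f assume P: "P \<in> pts" and f: "f \<noteq> 0" "0 \<le> val P f"
  obtain w j where w: "w \<in> P" "w $ j = 1" using normalized_representative[OF P] .
  interpret smooth_local_ring \<iota> "stalk P" "stalk_value P" "\<lambda>i. y $ i / y $ j - \<iota> (w $ i)"
    by (rule stalk_smooth_local_ring[OF P w])
  show "\<exists>c. f = \<iota> c \<or> 1 \<le> val P (f - \<iota> c)" using residue_exists f unfolding val_def by blast
next
  fix P assume P: "P \<in> pts"
  obtain w j where w: "w \<in> P" "w $ j = 1" using normalized_representative[OF P] .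
  interpret smooth_local_ring \<iota> "stalk P" "stalk_value P" "\<lambda>i. y $ i / y $ j - \<iota> (w $ i)"
    by (rule stalk_smooth_local_ring[OF P w])
  show "\<exists>t. t \<noteq> 0 \<and> val P t = 1"
    using exists_uniformizer ord_uniformizer uniformizer_in(3) unfolding val_def by blast
next
  fix f :: 'f assume f: "f \<noteq> 0"
  obtain d F G where F: "homogeneous d F" "homogeneous d G" "geval G y \<noteq> 0" "f = geval F y / geval G y"
    using fraction by blast
  have Fy: "geval F y \<noteq> 0" using f F by auto
  have "{P \<in> pts. val P f \<noteq> 0} \<subseteq> {P \<in> pts. \<exists>w\<in>P. mpol_eval F w = 0} \<union> {P \<in> pts. \<exists>w\<in>P. mpol_eval G w = 0}"
  proof (intro subsetI, rule ccontr)
    fix P assume P: "P \<in> {P \<in> pts. val P f \<noteq> 0}"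
      and neg: "P \<notin> {P \<in> pts. \<exists>w\<in>P. mpol_eval F w = 0} \<union> {P \<in> pts. \<exists>w\<in>P. mpol_eval G w = 0}"
    obtain w j where w: "w \<in> P" "w $ j = 1" using normalized_representative P by blast
    have nz: "mpol_eval F w \<noteq> 0" "mpol_eval G w \<noteq> 0" using neg P w by auto
    then have "f \<in> stalk P" "stalk_value P f \<noteq> 0"
      using stalkI[OF w(1) F(1,2)] stalk_value_eq[OF _ w(1) F(1,2)] F(4) P by auto
    then show False using val_zero_iff f P by blast
  qed
  then show "finite {P \<in> pts. val P f \<noteq> 0}"
    using finite_zeros[OF F(1) Fy] finite_zeros[OF F(2,3)] by (meson finite_Un finite_subset)
next
  fix f :: 'f assume "f \<noteq> 0" "\<And>P. P \<in> pts \<Longrightarrow> 0 \<le> val P f"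
  then show "f \<in> range \<iota>" using regular_everywhere_const val_nonneg_iff by blast
next
  fix S P assume S: "finite S" "S \<subseteq> pts" "P \<in> S"
  have "\<exists>g. g \<noteq> 0 \<and> val P g = 0 \<and> (\<forall>Q\<in>T. 1 \<le> val Q g) \<and> (\<forall>R\<in>S. 0 \<le> val R g)"
    if "finite T" "T \<subseteq> S - {P}" for T
    using that
  proof (induction T rule: finite_induct)
    case empty
    have "val R 1 = 0" if "R \<in> pts" for R
    proof -
      interpret residue_map \<iota> "stalk R" "stalk_value R" by (rule stalk_residue_map[OF that])
      show ?thesis using val_zero_iff[OF that, of 1] by simp
    qed
    then show ?case using S by (intro exI[of _ 1]) auto
  next
    case (insert Q T)
    then obtain g where g: "g \<noteq> 0" "val P g = 0" "\<forall>Q\<in>T. 1 \<le> val Q g" "\<forall>R\<in>S. 0 \<le> val R g" by auto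
    obtain h where h: "h \<noteq> 0" "stalk_value P h \<noteq> 0" "stalk_value Q h = 0" "\<forall>R\<in>S. h \<in> stalk R"
      using exists_separating_function[OF S, of Q] insert.prems by auto
    have Q: "Q \<in> S" "Q \<noteq> P" using insert.prems by auto
    have h': "val P h = 0" "1 \<le> val Q h" "\<forall>R\<in>S. 0 \<le> val R h"
      using h S Q val_zero_iff[of P h] val_pos_iff[of Q h] val_nonneg_iff[of _ h] by auto
    have mult: "val R (g * h) = val R g + val R h" if "R \<in> S" for R
      using val_mult[of R g h] g(1) h(1) that S(2) by blast
    show ?case
    proof (intro exI[of _ "g * h"] conjI ballI)
      show "g * h \<noteq> 0" using g h by simp
      show "val P (g * h) = 0" using mult[OF S(3)] g h' by simp
      show "1 \<le> val R (g * h)" if "R \<in> insert Q T" for R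
      proof -
        have "R \<in> S" using that insert.prems by auto
        then show ?thesis using that mult g h' by fastforce
      qed
      show "0 \<le> val R (g * h)" if "R \<in> S" for R using mult g h' that by simp
    qed
  qed
  from this[of "S - {P}"] show "\<exists>g. g \<noteq> 0 \<and> val P g = 0 \<and> (\<forall>Q\<in>S - {P}. 1 \<le> val Q g)"
    using S by blast
qed (simp_all add: val_mult)

end

section \<open>Algebraic dependence in transcendence degree one\<close>

context coefficient_field
begin

text \<open>Algebraicity over the field generated by \<open>x\<close>, with denominators cleared.\<close>

definition algebraic_over :: "'f \<Rightarrow> 'f \<Rightarrow> bool" where
  "algebraic_over x u \<longleftrightarrow> (\<exists>n p. peval (p n) x \<noteq> 0 \<and> (\<Sum>i\<le>n. peval (p i) x * u ^ i) = 0)"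

lemma peval_uminus [simp]: "peval (- p) u = - peval p u"
  using peval_add[of p "- p" u] by (simp add: eq_neg_iff_add_eq_0 add.commute)

lemma peval_altdef:
  assumes "degree p \<le> n" shows "peval p u = (\<Sum>k\<le>n. \<iota> (coeff p k) * u ^ k)"
proof -
  have "peval p u = (\<Sum>k\<le>degree p. \<iota> (coeff p k) * u ^ k)"
    by (simp add: peval_def poly_altdef degree_map_poly coeff_map_poly)
  also have "\<dots> = (\<Sum>k\<le>n. \<iota> (coeff p k) * u ^ k)"
    using assms by (intro sum.mono_neutral_left) (auto simp: coeff_eq_0)
  finally show ?thesis .
qed

text \<open>If \<open>s\<close> and \<open>u\<close> have degrees at most \<open>a\<close> and \<open>b\<close> over the field generated by \<open>x\<close>, then up to
  denominators in \<open>x\<close> these monomials span the field generated by \<open>x\<close>, \<open>s\<close>, \<open>u\<close> as \<open>e\<close> grows.\<close>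

definition monomial_box :: "'f \<Rightarrow> 'f \<Rightarrow> 'f \<Rightarrow> nat \<Rightarrow> nat \<Rightarrow> nat \<Rightarrow> 'f set" where
  "monomial_box x s u a b e = (\<lambda>(k, i, j). x ^ k * s ^ i * u ^ j) ` ({..e} \<times> {..<a} \<times> {..<b})"

lemma monomial_box_card: "card (monomial_box x s u a b e) \<le> (e + 1) * (a * b)" "finite (monomial_box x s u a b e)"
proof -
  have "card (monomial_box x s u a b e) \<le> card ({..e} \<times> {..<a} \<times> {..<b})"
    unfolding monomial_box_def by (rule card_image_le) auto
  then show "card (monomial_box x s u a b e) \<le> (e + 1) * (a * b)" by (simp add: card_cartesian_product)
qed (simp add: monomial_box_def)

lemma monomial_box_swap: "monomial_box x s u a b e = monomial_box x u s b a e"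
  unfolding monomial_box_def by (force simp: image_iff ac_simps)

lemma monomial_box_mult_poly:
  assumes "degree Q \<le> D" "k \<le> e" "i < a" "j < b"
  shows "peval Q x * (x ^ k * s ^ i * u ^ j) \<in> vs.span (monomial_box x s u a b (e + D))"
proof -
  have "peval Q x * (x ^ k * s ^ i * u ^ j) = (\<Sum>l\<le>D. \<iota> (coeff Q l) * (x ^ (k + l) * s ^ i * u ^ j))"
    unfolding peval_altdef[OF assms(1)] sum_distrib_right
    by (intro sum.cong) (simp_all add: power_add ac_simps)
  also have "\<dots> \<in> vs.span (monomial_box x s u a b (e + D))"
  proof (intro vs.span_sum vs.span_scale vs.span_base)
    fix l assume "l \<in> {..D}"
    then have "(k + l, i, j) \<in> {..e + D} \<times> {..<a} \<times> {..<b}" using assms by auto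
    then show "x ^ (k + l) * s ^ i * u ^ j \<in> monomial_box x s u a b (e + D)"
      unfolding monomial_box_def by (rule rev_image_eqI) simp
  qed
  finally show ?thesis .
qed

text \<open>Multiplication by \<open>s\<close> may produce \<open>s ^ a\<close>. The leading coefficient \<open>p a\<close> allows this to be
  replaced by lower powers, at the cost of raising the degree in \<open>x\<close> by a constant.\<close>

lemma monomial_box_mult:
  assumes p: "(\<Sum>i\<le>a. peval (p i) x * s ^ i) = 0" and a: "a > 0"
    and deg: "\<And>i. i \<le> a \<Longrightarrow> degree (p i * r) \<le> D"
    and f: "f \<in> vs.span (monomial_box x s u a b e)"
  shows "peval (p a * r) x * s * f \<in> vs.span (monomial_box x s u a b (e + D))"
    and "peval (p a * r) x * f \<in> vs.span (monomial_box x s u a b (e + D))"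
proof -
  have gen1: "peval (p a * r) x * g \<in> vs.span (monomial_box x s u a b (e + D))"
    and gen2: "peval (p a * r) x * s * g \<in> vs.span (monomial_box x s u a b (e + D))"
    if "g \<in> monomial_box x s u a b e" for g
  proof -
    obtain k i j where g: "g = x ^ k * s ^ i * u ^ j" "k \<le> e" "i < a" "j < b"
      using \<open>g \<in> _\<close> by (auto simp: monomial_box_def)
    show "peval (p a * r) x * g \<in> vs.span (monomial_box x s u a b (e + D))"
      unfolding g(1) using g deg[of a] by (intro monomial_box_mult_poly) auto
    show "peval (p a * r) x * s * g \<in> vs.span (monomial_box x s u a b (e + D))"
    proof (cases "Suc i < a")
      case True
      have "peval (p a * r) x * s * g = peval (p a * r) x * (x ^ k * s ^ Suc i * u ^ j)"
        by (simp only: g(1) power_Suc ac_simps)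
      then show ?thesis using True g deg[of a] by (simp only:) (intro monomial_box_mult_poly, auto)
    next
      case False
      then have i: "Suc i = a" using g by simp
      have "peval (p a) x * s ^ a = - (\<Sum>l<a. peval (p l) x * s ^ l)"
        using p by (simp add: lessThan_Suc_atMost[symmetric] eq_neg_iff_add_eq_0 add.commute)
      then have "peval (p a) x * s ^ a * (peval r x * (x ^ k * u ^ j)) =
          - (\<Sum>l<a. peval (p l) x * s ^ l) * (peval r x * (x ^ k * u ^ j))" by simp
      also have "\<dots> = (\<Sum>l<a. \<iota> (-1) * (peval (p l * r) x * (x ^ k * s ^ l * u ^ j)))"
        unfolding minus_mult_left[symmetric] sum_distrib_right sum_negf[symmetric]
        by (intro sum.cong) (simp_all add: ac_simps)
      also have "\<dots> \<in> vs.span (monomial_box x s u a b (e + D))"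
        using g deg by (intro vs.span_sum vs.span_scale monomial_box_mult_poly) auto
      also have "peval (p a) x * s ^ a * (peval r x * (x ^ k * u ^ j)) = peval (p a * r) x * s * g"
        unfolding g(1) i[symmetric] by (simp add: ac_simps)
      finally show ?thesis .
    qed
  qed
  show "peval (p a * r) x * f \<in> vs.span (monomial_box x s u a b (e + D))"
    using f
  proof (induction rule: vs.span_induct_alt)
    case (step c g h)
    have "peval (p a * r) x * (\<iota> c * g + h) = \<iota> c * (peval (p a * r) x * g) + peval (p a * r) x * h"
      by (simp only: ring_distribs ac_simps)
    then show ?case using step gen1 by (simp only: vs.span_add vs.span_scale)
  qed (simp add: vs.span_zero)
  show "peval (p a * r) x * s * f \<in> vs.span (monomial_box x s u a b (e + D))"
    using f
  proof (induction rule: vs.span_induct_alt)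
    case (step c g h)
    have "peval (p a * r) x * s * (\<iota> c * g + h) = \<iota> c * (peval (p a * r) x * s * g) + peval (p a * r) x * s * h"
      by (simp only: ring_distribs ac_simps)
    then show ?case using step gen2 by (simp only: vs.span_add vs.span_scale)
  qed (simp add: vs.span_zero)
qed

text \<open>The products \<open>s ^ i * u ^ j\<close> with \<open>i, j \<le> m\<close> are quadratically many in \<open>m\<close>, but after
  multiplication by a power of the leading coefficients they lie in a space whose dimension grows
  linearly in \<open>m\<close>.\<close>

lemma dependent_products:
  assumes s: "algebraic_over x s" and u: "algebraic_over x u"
  shows "\<exists>m c i j. i \<le> m \<and> j \<le> m \<and> c (i, j) \<noteq> 0 \<and>
           (\<Sum>(i, j)\<in>{..m} \<times> {..m}. \<iota> (c (i, j)) * (s ^ i * u ^ j)) = 0"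
proof -
  obtain a p where p: "peval (p a) x \<noteq> 0" "(\<Sum>i\<le>a. peval (p i) x * s ^ i) = 0"
    using s unfolding algebraic_over_def by blast
  obtain b r where r: "peval (r b) x \<noteq> 0" "(\<Sum>i\<le>b. peval (r i) x * u ^ i) = 0"
    using u unfolding algebraic_over_def by blast
  have ab: "a > 0" "b > 0" using p r by (auto intro!: gr0I)
  define D where "D = Max ((\<lambda>(i, j). degree (p i * r j)) ` ({..a} \<times> {..b}))"
  have D: "degree (p i * r j) \<le> D" if "i \<le> a" "j \<le> b" for i j
    unfolding D_def using that by (intro Max_ge) auto
  define G where "G = peval (p a * r b) x"
  have G0: "G \<noteq> 0" using p r by (simp add: G_def)
  define B where "B e = vs.span (monomial_box x s u a b e)" for e
  have Gs: "G * s * f \<in> B (e + D)" and G1: "G * f \<in> B (e + D)" if "f \<in> B e" for f e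
    using monomial_box_mult[OF p(2) ab(1), of "r b" D f u b e] D that by (auto simp: G_def B_def)
  have Gu: "G * u * f \<in> B (e + D)" if "f \<in> B e" for f e
  proof -
    have "peval (r b * p a) x * u * f \<in> vs.span (monomial_box x u s b a (e + D))"
    proof (rule monomial_box_mult(1)[OF r(2) ab(2)])
      show "degree (r i * p a) \<le> D" if "i \<le> b" for i using D[of a i] that by (simp add: mult.commute)
      show "f \<in> vs.span (monomial_box x u s b a e)"
        using \<open>f \<in> B e\<close> unfolding B_def monomial_box_swap[of x s] .
    qed
    moreover have "peval (r b * p a) x = G" by (simp add: G_def)
    ultimately show ?thesis unfolding B_def monomial_box_swap[of x s] by simp
  qed
  have mem: "G ^ n * (s ^ i * u ^ j) \<in> B (n * D)" if "i + j \<le> n" for n i j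
    using that
  proof (induction n arbitrary: i j)
    case 0
    have "(0, 0, 0) \<in> {..0::nat} \<times> {..<a} \<times> {..<b}" using ab by simp
    then have "1 \<in> monomial_box x s u a b 0" unfolding monomial_box_def by (rule rev_image_eqI) simp
    then show ?case using 0 by (simp add: B_def vs.span_base)
  next
    case (Suc n)
    show ?case
    proof (cases "i + j \<le> n")
      case True
      have "G * (G ^ n * (s ^ i * u ^ j)) \<in> B (n * D + D)" by (rule G1[OF Suc.IH[OF True]])
      then show ?thesis by (simp add: ac_simps)
    next
      case False
      show ?thesis
      proof (cases i)
        case 0
        then obtain j' where j: "j = Suc j'" using False by (cases j) auto
        then have "i + j' \<le> n" using Suc.prems by simp
        then have "G * u * (G ^ n * (s ^ i * u ^ j')) \<in> B (n * D + D)" by (intro Gu Suc.IH)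
        then show ?thesis by (simp add: j ac_simps)
      next
        case i: (Suc i')
        then have "i' + j \<le> n" using Suc.prems by simp
        then have "G * s * (G ^ n * (s ^ i' * u ^ j)) \<in> B (n * D + D)" by (intro Gs Suc.IH)
        then show ?thesis by (simp add: i ac_simps)
      qed
    qed
  qed
  define m where "m = (2 * D + 1) * (a * b)"
  have m0: "m > 0" using ab by (simp add: m_def)
  define n where "n = 2 * m"
  let ?T = "{..m} \<times> {..m}"
  have "\<not> card ?T \<le> card (monomial_box x s u a b (n * D))"
  proof -
    have "card (monomial_box x s u a b (n * D)) \<le> (n * D + 1) * (a * b)" by (rule monomial_box_card)
    also have "\<dots> \<le> ((2 * D + 1) * (m + 1)) * (a * b)"
      by (intro mult_right_mono) (simp_all add: n_def algebra_simps)
    also have "\<dots> = m * (m + 1)" by (simp only: m_def ac_simps)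
    also have "\<dots> < (m + 1) * (m + 1)" by simp
    also have "\<dots> = card ?T" by (simp add: card_cartesian_product)
    finally show ?thesis by simp
  qed
  moreover have "card ?T \<le> card (monomial_box x s u a b (n * D))"
    if indep: "\<And>c i. (\<Sum>i\<in>?T. \<iota> (c i) * (case i of (i, j) \<Rightarrow> G ^ n * (s ^ i * u ^ j))) = 0 \<Longrightarrow> i \<in> ?T \<Longrightarrow> c i = 0"
  proof (rule independent_family_card_le[where b = "\<lambda>t. case t of (i, j) \<Rightarrow> G ^ n * (s ^ i * u ^ j)"])
    show "finite (monomial_box x s u a b (n * D))" by (rule monomial_box_card)
    show "c i = 0" if "(\<Sum>i\<in>?T. \<iota> (c i) * (case i of (i, j) \<Rightarrow> G ^ n * (s ^ i * u ^ j))) = 0" "i \<in> ?T" for c i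
      using that by (rule indep)
    fix t assume "t \<in> ?T"
    then show "(case t of (i, j) \<Rightarrow> G ^ n * (s ^ i * u ^ j)) \<in> vs.span (monomial_box x s u a b (n * D))"
      using mem[of _ _ n] by (auto simp: B_def n_def)
  qed simp
  ultimately obtain c t where c: "(\<Sum>i\<in>?T. \<iota> (c i) * (case i of (i, j) \<Rightarrow> G ^ n * (s ^ i * u ^ j))) = 0"
    "t \<in> ?T" "c t \<noteq> 0" by blast
  have "G ^ n * (\<Sum>(i, j)\<in>?T. \<iota> (c (i, j)) * (s ^ i * u ^ j)) = 0"
    using c(1) unfolding sum_distrib_left by (simp add: case_prod_unfold mult.left_commute)
  then have "(\<Sum>(i, j)\<in>?T. \<iota> (c (i, j)) * (s ^ i * u ^ j)) = 0" using G0 by simp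
  then show ?thesis using c(2,3) by (intro exI[of _ m] exI[of _ c] exI[of _ "fst t"] exI[of _ "snd t"]) auto
qed

text \<open>Sort a relation between products of powers by powers of \<open>s\<close>, and cancel the least that occurs.\<close>

theorem algebraic_over_related:
  assumes alg: "algebraic_over x s" "algebraic_over x u" and s: "s \<noteq> 0"
  shows "alg_related s u"
proof -
  obtain m c i0 j0 where c: "i0 \<le> m" "j0 \<le> m" "c (i0, j0) \<noteq> 0"
    "(\<Sum>(i, j)\<in>{..m} \<times> {..m}. \<iota> (c (i, j)) * (s ^ i * u ^ j)) = 0"
    using dependent_products[OF alg] by blast
  define q where "q i = (if i \<le> m then \<Sum>j\<le>m. monom (c (i, j)) j else 0)" for i
  have peval_monom: "peval (monom e j) u = \<iota> e * u ^ j" for e j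
    by (simp add: peval_def map_poly_monom poly_monom)
  have peval_sum: "peval (sum g J) u = (\<Sum>j\<in>J. peval (g j) u)" for g and J :: "nat set"
    by (induction J rule: infinite_finite_induct) simp_all
  have qu: "peval (q i) u = (\<Sum>j\<le>m. \<iota> (c (i, j)) * u ^ j)" if "i \<le> m" for i
    using that by (simp add: q_def peval_sum peval_monom)
  have rel: "(\<Sum>i\<le>m. s ^ i * peval (q i) u) = 0"
  proof -
    have "(\<Sum>i\<le>m. s ^ i * peval (q i) u) = (\<Sum>i\<le>m. \<Sum>j\<le>m. \<iota> (c (i, j)) * (s ^ i * u ^ j))"
      by (intro sum.cong) (simp_all add: qu sum_distrib_left mult.left_commute)
    then show ?thesis using c(4) by (simp add: sum.cartesian_product)
  qed
  have "coeff (q i0) j0 = c (i0, j0)"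
    using c(1,2) by (simp add: q_def coeff_sum)
  then have ex: "q i0 \<noteq> 0" using c(3) by auto
  define l where "l = (LEAST i. q i \<noteq> 0)"
  have l: "q l \<noteq> 0" unfolding l_def using ex by (rule LeastI)
  have below: "q i = 0" if "i < l" for i using not_less_Least[OF that[unfolded l_def]] by simp
  have lm: "l \<le> m" using l by (auto simp: q_def split: if_splits)
  have "(\<Sum>i\<le>m. s ^ i * peval (q i) u) = (\<Sum>i=l..m. s ^ i * peval (q i) u)"
    by (rule sum.mono_neutral_right) (use below in auto)
  also have "\<dots> = (\<Sum>i=0 + l..m - l + l. s ^ i * peval (q i) u)" using lm by simp
  also have "\<dots> = (\<Sum>i=0..m - l. s ^ (i + l) * peval (q (i + l)) u)" by (rule sum.shift_bounds_cl_nat_ivl)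
  also have "\<dots> = s ^ l * (\<Sum>i\<le>m - l. s ^ i * peval (q (i + l)) u)"
    by (simp add: sum_distrib_left power_add ac_simps atMost_atLeast0)
  finally have "(\<Sum>i\<le>m - l. s ^ i * peval (q (i + l)) u) = 0" using rel s by simp
  then show ?thesis unfolding alg_related_def
    using l by (intro exI[of _ "m - l"] exI[of _ "\<lambda>i. q (i + l)"]) simp
qed

end

section \<open>The function field is a field\<close>

lemma UN_pair_const:
  assumes "f \<noteq> {}" "\<And>F G. (F, G) \<in> f \<Longrightarrow> h F G = c"
  shows "(\<Union>(F, G)\<in>f. h F G) = c"
  using assms by force

locale irreducible_variety =
  fixes V :: "('a::field, 'n::finite) ppoint set"
  assumes closed: "zariski_closed V" and irreducible: "zariski_irreducible V"
begin

abbreviation K :: "('n, 'a) ratfun ring" where "K \<equiv> function_field V"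

lemma V_proj: "P \<in> V \<Longrightarrow> P \<in> proj_space"
  using closed by (auto simp: zariski_closed_def zero_locus_def)

lemma representative: "P \<in> V \<Longrightarrow> \<exists>v. v \<in> P"
  using V_proj proj_point_mem by (fastforce simp: proj_space_def)

text \<open>The zeros of \<open>F\<close> and those of \<open>G\<close> cover the irreducible set \<open>V\<close>.\<close>

lemma vanishes_mult:
  assumes F: "homogeneous d F" and G: "homogeneous e G" and FG: "vanishes_on V (F * G)"
  shows "vanishes_on V F \<or> vanishes_on V G"
proof (rule ccontr)
  assume neg: "\<not> ?thesis"
  obtain S where S: "\<forall>F\<in>S. \<exists>d. homogeneous d F" "V = zero_locus S"
    using closed unfolding zariski_closed_def by blast
  define A where "A = zero_locus (insert F S)"
  define B where "B = zero_locus (insert G S)"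
  have "zariski_closed A" "zariski_closed B" unfolding A_def B_def zariski_closed_def using S F G by blast+
  moreover have "A \<subset> V" "B \<subset> V"
    using neg unfolding A_def B_def S(2) vanishes_on_def zero_locus_def by blast+
  moreover have "V \<subseteq> A \<union> B"
  proof
    fix P assume P: "P \<in> V"
    obtain v where v: "v \<in> P" using representative P by blast
    have "mpol_eval (F * G) v = 0" using FG P v unfolding vanishes_on_def by blast
    then have "mpol_eval F v = 0 \<or> mpol_eval G v = 0" by simp
    then have "(\<forall>w\<in>P. mpol_eval F w = 0) \<or> (\<forall>w\<in>P. mpol_eval G w = 0)"
      using homogeneous_zero_iff[OF F V_proj[OF P] v] homogeneous_zero_iff[OF G V_proj[OF P] v] by blast
    then show "P \<in> A \<union> B" using P unfolding A_def B_def S(2) zero_locus_def by blast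
  qed
  ultimately show False using irreducible unfolding zariski_irreducible_def by blast
qed

lemma fractionsE:
  assumes "(F, G) \<in> fractions V"
  obtains d where "homogeneous d F" "homogeneous d G" "\<not> vanishes_on V G"
  using assms unfolding fractions_def by blast

lemma fractionsI: "homogeneous d F \<Longrightarrow> homogeneous d G \<Longrightarrow> \<not> vanishes_on V G \<Longrightarrow> (F, G) \<in> fractions V"
  unfolding fractions_def by blast

lemma not_vanishes_1 [simp]: "\<not> vanishes_on V 1"
  using irreducible representative unfolding vanishes_on_def zariski_irreducible_def by fastforce

lemma fractions_const [simp]: "(mpol_const c, 1) \<in> fractions V"
  by (rule fractionsI[of 0]) simp_all

lemma fractions_0 [simp]: "(0, 1) \<in> fractions V"
  by (rule fractionsI[of 0]) simp_all

lemma fractions_1 [simp]: "(1, 1) \<in> fractions V"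
  by (rule fractionsI[of 0]) simp_all

lemma fractions_mult:
  assumes "(F, G) \<in> fractions V" "(F', G') \<in> fractions V"
  shows "(F * F', G * G') \<in> fractions V"
  using assms vanishes_mult by (elim fractionsE) (blast intro: fractionsI homogeneous_mult)

lemma fractions_add:
  assumes "(F, G) \<in> fractions V" "(F', G') \<in> fractions V"
  shows "(F * G' + F' * G, G * G') \<in> fractions V"
proof -
  obtain d where d: "homogeneous d F" "homogeneous d G" "\<not> vanishes_on V G" using assms(1) by (rule fractionsE)
  obtain e where e: "homogeneous e F'" "homogeneous e G'" "\<not> vanishes_on V G'" using assms(2) by (rule fractionsE)
  have "homogeneous (d + e) (F * G' + F' * G)"
    using homogeneous_mult[OF d(1) e(2)] homogeneous_mult[OF e(1) d(2)] by (simp add: add.commute homogeneous_add)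
  then show ?thesis using d e homogeneous_mult vanishes_mult by (blast intro: fractionsI)
qed

lemma fractions_uminus: "(F, G) \<in> fractions V \<Longrightarrow> (- F, G) \<in> fractions V"
  by (elim fractionsE) (blast intro: fractionsI homogeneous_uminus)

lemma fractions_inverse: "(F, G) \<in> fractions V \<Longrightarrow> \<not> vanishes_on V F \<Longrightarrow> (G, F) \<in> fractions V"
  by (elim fractionsE) (blast intro: fractionsI)

lemma ratfun_mem: "(F, G) \<in> fractions V \<Longrightarrow> (F, G) \<in> ratfun_of V F G"
  by (simp add: ratfun_of_def vanishes_on_def)

text \<open>Transitivity of the equality of fractions. The denominator \<open>G\<close> is cancelled by irreducibility.\<close>

lemma ratfun_cross:
  assumes F: "(F, G) \<in> fractions V" and F': "(F', G') \<in> fractions V" and F'': "(F'', G'') \<in> fractions V"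
    and "vanishes_on V (F * G' - F' * G)" "vanishes_on V (F * G'' - F'' * G)"
  shows "vanishes_on V (F' * G'' - F'' * G')"
proof -
  obtain d where d: "homogeneous d G" "\<not> vanishes_on V G" using F by (rule fractionsE)
  obtain d' where d': "homogeneous d' F'" "homogeneous d' G'" using F' by (rule fractionsE)
  obtain d'' where d'': "homogeneous d'' F''" "homogeneous d'' G''" using F'' by (rule fractionsE)
  have hom: "homogeneous (d' + d'') (F' * G'' - F'' * G')"
    using homogeneous_mult[OF d'(1) d''(2)] homogeneous_mult[OF d''(1) d'(2)] by (simp add: add.commute homogeneous_diff)
  have "vanishes_on V (G * (F' * G'' - F'' * G'))"
    unfolding vanishes_on_def
  proof (intro ballI)
    fix P v assume "P \<in> V" "v \<in> P"
    then have "mpol_eval (F * G' - F' * G) v = 0" "mpol_eval (F * G'' - F'' * G) v = 0"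
      using assms(4,5) unfolding vanishes_on_def by blast+
    then have 1: "mpol_eval F' v * mpol_eval G v = mpol_eval F v * mpol_eval G' v"
      and 2: "mpol_eval F'' v * mpol_eval G v = mpol_eval F v * mpol_eval G'' v" by simp_all
    have "mpol_eval (G * (F' * G'' - F'' * G')) v
      = (mpol_eval F' v * mpol_eval G v) * mpol_eval G'' v - (mpol_eval F'' v * mpol_eval G v) * mpol_eval G' v"
      by (simp add: algebra_simps)
    then show "mpol_eval (G * (F' * G'' - F'' * G')) v = 0" unfolding 1 2 by simp
  qed
  then show ?thesis using vanishes_mult[OF d(1) hom] d(2) by blast
qed

lemma vanishes_swap: "vanishes_on V (F * G' - F' * G) \<Longrightarrow> vanishes_on V (F' * G - F * G')"
  by (simp add: vanishes_on_def)

lemma ratfun_eq_iff: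
  assumes F: "(F, G) \<in> fractions V" and F': "(F', G') \<in> fractions V"
  shows "ratfun_of V F G = ratfun_of V F' G' \<longleftrightarrow> vanishes_on V (F * G' - F' * G)"
proof
  assume "ratfun_of V F G = ratfun_of V F' G'"
  then have "(F', G') \<in> ratfun_of V F G" using ratfun_mem[OF F'] by simp
  then show "vanishes_on V (F * G' - F' * G)" by (simp add: ratfun_of_def)
next
  assume v: "vanishes_on V (F * G' - F' * G)"
  show "ratfun_of V F G = ratfun_of V F' G'"
    unfolding ratfun_of_def using ratfun_cross[OF F F' _ v] ratfun_cross[OF F' F _ vanishes_swap[OF v]] by blast
qed

lemma ratfun_eqI:
  assumes "(F, G) \<in> fractions V" "(F', G') \<in> fractions V"
    and "\<And>v. mpol_eval F v * mpol_eval G' v = mpol_eval F' v * mpol_eval G v"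
  shows "ratfun_of V F G = ratfun_of V F' G'"
  using assms by (simp add: ratfun_eq_iff vanishes_on_def)

lemma ratfun_memD:
  assumes "(F, G) \<in> fractions V" "(F', G') \<in> ratfun_of V F G"
  shows "(F', G') \<in> fractions V" "ratfun_of V F' G' = ratfun_of V F G"
proof -
  show F': "(F', G') \<in> fractions V" using assms(2) by (simp add: ratfun_of_def)
  show "ratfun_of V F' G' = ratfun_of V F G"
    using assms(2) ratfun_eq_iff[OF assms(1) F'] by (simp add: ratfun_of_def)
qed

lemma carrierE:
  assumes "f \<in> carrier K"
  obtains F G where "(F, G) \<in> fractions V" "f = ratfun_of V F G"
  using assms by (auto simp: function_field_def)

lemma carrierI [simp]: "(F, G) \<in> fractions V \<Longrightarrow> ratfun_of V F G \<in> carrier K"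
  by (auto simp: function_field_def)

lemma one_ratfun: "\<one>\<^bsub>K\<^esub> = ratfun_of V 1 1"
  and zero_ratfun: "\<zero>\<^bsub>K\<^esub> = ratfun_of V 0 1"
  by (simp_all add: function_field_def)

lemma mult_ratfun:
  assumes F: "(F, G) \<in> fractions V" and F': "(F', G') \<in> fractions V"
  shows "ratfun_of V F G \<otimes>\<^bsub>K\<^esub> ratfun_of V F' G' = ratfun_of V (F * F') (G * G')"
proof -
  have "(\<Union>(A, B)\<in>ratfun_of V F G. \<Union>(A', B')\<in>ratfun_of V F' G'. ratfun_of V (A * A') (B * B'))
      = ratfun_of V (F * F') (G * G')"
  proof (intro UN_pair_const)
    fix A B A' B' assume A: "(A, B) \<in> ratfun_of V F G" and A': "(A', B') \<in> ratfun_of V F' G'"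
    note AB = ratfun_memD[OF F A] and AB' = ratfun_memD[OF F' A']
    show "ratfun_of V (A * A') (B * B') = ratfun_of V (F * F') (G * G')"
      unfolding ratfun_eq_iff[OF fractions_mult[OF AB(1) AB'(1)] fractions_mult[OF F F']] vanishes_on_def
    proof (intro ballI)
      fix P v assume Pv: "P \<in> V" "v \<in> P"
      have "mpol_eval (A * G - F * B) v = 0" "mpol_eval (A' * G' - F' * B') v = 0"
        using AB(2) AB'(2) Pv unfolding ratfun_eq_iff[OF AB(1) F] ratfun_eq_iff[OF AB'(1) F'] vanishes_on_def by blast+
      then have 1: "mpol_eval A v * mpol_eval G v = mpol_eval F v * mpol_eval B v"
        "mpol_eval A' v * mpol_eval G' v = mpol_eval F' v * mpol_eval B' v" by simp_all
      have "mpol_eval (A * A' * (G * G') - F * F' * (B * B')) v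
        = (mpol_eval A v * mpol_eval G v) * (mpol_eval A' v * mpol_eval G' v) - mpol_eval (F * F' * (B * B')) v"
        by (simp add: algebra_simps)
      then show "mpol_eval (A * A' * (G * G') - F * F' * (B * B')) v = 0" unfolding 1 by (simp add: algebra_simps)
    qed
  qed (use ratfun_mem[OF F] ratfun_mem[OF F'] in blast)+
  then show ?thesis by (simp add: function_field_def)
qed

lemma add_ratfun:
  assumes F: "(F, G) \<in> fractions V" and F': "(F', G') \<in> fractions V"
  shows "ratfun_of V F G \<oplus>\<^bsub>K\<^esub> ratfun_of V F' G' = ratfun_of V (F * G' + F' * G) (G * G')"
proof -
  have "(\<Union>(A, B)\<in>ratfun_of V F G. \<Union>(A', B')\<in>ratfun_of V F' G'. ratfun_of V (A * B' + A' * B) (B * B'))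
      = ratfun_of V (F * G' + F' * G) (G * G')"
  proof (intro UN_pair_const)
    fix A B A' B' assume A: "(A, B) \<in> ratfun_of V F G" and A': "(A', B') \<in> ratfun_of V F' G'"
    note AB = ratfun_memD[OF F A] and AB' = ratfun_memD[OF F' A']
    show "ratfun_of V (A * B' + A' * B) (B * B') = ratfun_of V (F * G' + F' * G) (G * G')"
      unfolding ratfun_eq_iff[OF fractions_add[OF AB(1) AB'(1)] fractions_add[OF F F']] vanishes_on_def
    proof (intro ballI)
      fix P v assume Pv: "P \<in> V" "v \<in> P"
      have "mpol_eval (A * G - F * B) v = 0" "mpol_eval (A' * G' - F' * B') v = 0"
        using AB(2) AB'(2) Pv unfolding ratfun_eq_iff[OF AB(1) F] ratfun_eq_iff[OF AB'(1) F'] vanishes_on_def by blast+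
      then have 1: "mpol_eval A v * mpol_eval G v = mpol_eval F v * mpol_eval B v"
        "mpol_eval A' v * mpol_eval G' v = mpol_eval F' v * mpol_eval B' v" by simp_all
      have "mpol_eval ((A * B' + A' * B) * (G * G') - (F * G' + F' * G) * (B * B')) v
        = (mpol_eval A v * mpol_eval G v) * (mpol_eval B' v * mpol_eval G' v)
          + (mpol_eval A' v * mpol_eval G' v) * (mpol_eval B v * mpol_eval G v)
          - mpol_eval ((F * G' + F' * G) * (B * B')) v"
        by (simp add: algebra_simps)
      then show "mpol_eval ((A * B' + A' * B) * (G * G') - (F * G' + F' * G) * (B * B')) v = 0"
        unfolding 1 by (simp add: algebra_simps)
    qed
  qed (use ratfun_mem[OF F] ratfun_mem[OF F'] in blast)+
  then show ?thesis by (simp add: function_field_def)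
qed

lemma ratfun_eq_0_iff:
  assumes "(F, G) \<in> fractions V" shows "ratfun_of V F G = \<zero>\<^bsub>K\<^esub> \<longleftrightarrow> vanishes_on V F"
  unfolding zero_ratfun by (simp add: ratfun_eq_iff[OF assms fractions_0] vanishes_on_def)

lemmas fractions_intros = fractions_mult fractions_add fractions_uminus

lemma cring_function_field: "cring K"
proof (rule cringI)
  show "abelian_group K"
  proof (rule abelian_groupI)
    show "\<zero>\<^bsub>K\<^esub> \<in> carrier K" by (simp add: zero_ratfun)
  next
    fix f g assume f: "f \<in> carrier K" and g: "g \<in> carrier K"
    obtain F G where F: "(F, G) \<in> fractions V" "f = ratfun_of V F G" using f by (rule carrierE)
    obtain F' G' where F': "(F', G') \<in> fractions V" "g = ratfun_of V F' G'" using g by (rule carrierE)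
    show "f \<oplus>\<^bsub>K\<^esub> g \<in> carrier K"
      using F F' by (simp add: add_ratfun fractions_intros)
    show "f \<oplus>\<^bsub>K\<^esub> g = g \<oplus>\<^bsub>K\<^esub> f"
      unfolding F(2) F'(2) add_ratfun[OF F(1) F'(1)] add_ratfun[OF F'(1) F(1)]
      by (intro ratfun_eqI fractions_intros F F') (simp add: algebra_simps)
    fix h assume h: "h \<in> carrier K"
    obtain F'' G'' where F'': "(F'', G'') \<in> fractions V" "h = ratfun_of V F'' G''" using h by (rule carrierE)
    show "f \<oplus>\<^bsub>K\<^esub> g \<oplus>\<^bsub>K\<^esub> h = f \<oplus>\<^bsub>K\<^esub> (g \<oplus>\<^bsub>K\<^esub> h)"
      unfolding F(2) F'(2) F''(2) add_ratfun[OF F(1) F'(1)] add_ratfun[OF F'(1) F''(1)]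
        add_ratfun[OF fractions_add[OF F(1) F'(1)] F''(1)] add_ratfun[OF F(1) fractions_add[OF F'(1) F''(1)]]
      by (intro ratfun_eqI fractions_intros F F' F'') (simp add: algebra_simps)
  next
    fix f assume f: "f \<in> carrier K"
    obtain F G where F: "(F, G) \<in> fractions V" "f = ratfun_of V F G" using f by (rule carrierE)
    show "\<zero>\<^bsub>K\<^esub> \<oplus>\<^bsub>K\<^esub> f = f"
      unfolding F(2) zero_ratfun add_ratfun[OF fractions_0 F(1)]
      by (intro ratfun_eqI fractions_intros F fractions_0) (simp add: algebra_simps)
    have "ratfun_of V (- F) G \<oplus>\<^bsub>K\<^esub> f = \<zero>\<^bsub>K\<^esub>"
      unfolding F(2) zero_ratfun add_ratfun[OF fractions_uminus[OF F(1)] F(1)]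
      by (intro ratfun_eqI fractions_intros F fractions_0) (simp add: algebra_simps)
    then show "\<exists>g\<in>carrier K. g \<oplus>\<^bsub>K\<^esub> f = \<zero>\<^bsub>K\<^esub>"
      using F by (intro bexI[of _ "ratfun_of V (- F) G"]) (simp_all add: fractions_uminus)
  qed
next
  show "Group.comm_monoid K"
  proof (rule comm_monoidI)
    show "\<one>\<^bsub>K\<^esub> \<in> carrier K" by (simp add: one_ratfun)
  next
    fix f g assume f: "f \<in> carrier K" and g: "g \<in> carrier K"
    obtain F G where F: "(F, G) \<in> fractions V" "f = ratfun_of V F G" using f by (rule carrierE)
    obtain F' G' where F': "(F', G') \<in> fractions V" "g = ratfun_of V F' G'" using g by (rule carrierE)
    show "f \<otimes>\<^bsub>K\<^esub> g \<in> carrier K"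
      using F F' by (simp add: mult_ratfun fractions_intros)
    show "f \<otimes>\<^bsub>K\<^esub> g = g \<otimes>\<^bsub>K\<^esub> f"
      unfolding F(2) F'(2) mult_ratfun[OF F(1) F'(1)] mult_ratfun[OF F'(1) F(1)]
      by (intro ratfun_eqI fractions_intros F F') (simp add: algebra_simps)
    fix h assume h: "h \<in> carrier K"
    obtain F'' G'' where F'': "(F'', G'') \<in> fractions V" "h = ratfun_of V F'' G''" using h by (rule carrierE)
    show "f \<otimes>\<^bsub>K\<^esub> g \<otimes>\<^bsub>K\<^esub> h = f \<otimes>\<^bsub>K\<^esub> (g \<otimes>\<^bsub>K\<^esub> h)"
      unfolding F(2) F'(2) F''(2) mult_ratfun[OF F(1) F'(1)] mult_ratfun[OF F'(1) F''(1)]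
        mult_ratfun[OF fractions_mult[OF F(1) F'(1)] F''(1)] mult_ratfun[OF F(1) fractions_mult[OF F'(1) F''(1)]]
      by (intro ratfun_eqI fractions_intros F F' F'') (simp add: algebra_simps)
  next
    fix f assume f: "f \<in> carrier K"
    obtain F G where F: "(F, G) \<in> fractions V" "f = ratfun_of V F G" using f by (rule carrierE)
    show "\<one>\<^bsub>K\<^esub> \<otimes>\<^bsub>K\<^esub> f = f"
      unfolding F(2) one_ratfun mult_ratfun[OF fractions_1 F(1)]
      by (intro ratfun_eqI fractions_intros F fractions_1) (simp add: algebra_simps)
  qed
next
  fix f g h assume f: "f \<in> carrier K" and g: "g \<in> carrier K"
    and h: "h \<in> carrier K"
  obtain F G where F: "(F, G) \<in> fractions V" "f = ratfun_of V F G" using f by (rule carrierE)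
  obtain F' G' where F': "(F', G') \<in> fractions V" "g = ratfun_of V F' G'" using g by (rule carrierE)
  obtain F'' G'' where F'': "(F'', G'') \<in> fractions V" "h = ratfun_of V F'' G''" using h by (rule carrierE)
  show "(f \<oplus>\<^bsub>K\<^esub> g) \<otimes>\<^bsub>K\<^esub> h =
      f \<otimes>\<^bsub>K\<^esub> h \<oplus>\<^bsub>K\<^esub> g \<otimes>\<^bsub>K\<^esub> h"
    unfolding F(2) F'(2) F''(2) add_ratfun[OF F(1) F'(1)] mult_ratfun[OF fractions_add[OF F(1) F'(1)] F''(1)]
      mult_ratfun[OF F(1) F''(1)] mult_ratfun[OF F'(1) F''(1)]
      add_ratfun[OF fractions_mult[OF F(1) F''(1)] fractions_mult[OF F'(1) F''(1)]]
    by (intro ratfun_eqI fractions_intros F F' F'') (simp add: algebra_simps)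
qed

lemma field_function_field: "field K"
proof -
  interpret cring K by (rule cring_function_field)
  have ne: "\<one>\<^bsub>K\<^esub> \<noteq> \<zero>\<^bsub>K\<^esub>"
    using ratfun_eq_0_iff[OF fractions_1] by (simp add: one_ratfun)
  show ?thesis
  proof (rule cring_fieldI2)
    show "\<zero>\<^bsub>K\<^esub> \<noteq> \<one>\<^bsub>K\<^esub>" using ne by simp
  next
    fix f assume f: "f \<in> carrier K" "f \<noteq> \<zero>\<^bsub>K\<^esub>"
    obtain F G where F: "(F, G) \<in> fractions V" "f = ratfun_of V F G" using f(1) by (rule carrierE)
    have GF: "(G, F) \<in> fractions V" using fractions_inverse[OF F(1)] f F ratfun_eq_0_iff[OF F(1)] by blast
    have "f \<otimes>\<^bsub>K\<^esub> ratfun_of V G F = \<one>\<^bsub>K\<^esub>"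
      unfolding F(2) one_ratfun mult_ratfun[OF F(1) GF]
      by (intro ratfun_eqI fractions_intros F fractions_1 GF) (simp add: algebra_simps)
    then show "\<exists>g\<in>carrier K. f \<otimes>\<^bsub>K\<^esub> g = \<one>\<^bsub>K\<^esub>"
      using GF by (intro bexI[of _ "ratfun_of V G F"]) simp_all
  qed
qed

end

section \<open>The function field as a type\<close>

lemmas mpol_eval_prod = coefficient_field.geval_prod[OF coefficient_field_id, unfolded geval_id]

text \<open>The map \<open>\<Phi>\<close> identifies the function field with a type \<open>'f\<close> of class \<open>field\<close>, for which the results on
  projective curves are available.\<close>

locale function_field_iso = irreducible_variety V
  for V :: "('a::alg_closed_field, 'n::finite) ppoint set" +
  fixes E :: "('n, 'a) mpol set" and \<Phi> :: "'f::field \<Rightarrow> ('n, 'a) ratfun"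
  assumes V_eq: "V = zero_locus E"
    and E_hom: "F \<in> E \<Longrightarrow> \<exists>d. homogeneous d F"
    and dimension: "has_dimension_one V"
    and jacobian: "P \<in> V \<Longrightarrow> v \<in> P \<Longrightarrow> vec.dim ((\<lambda>F. gradient F v) ` E) + 2 = CARD('n)"
    and Phi_bij: "bij_betw \<Phi> UNIV (carrier K)"
    and Phi_add: "\<Phi> (f + g) = \<Phi> f \<oplus>\<^bsub>K\<^esub> \<Phi> g"
    and Phi_mult: "\<Phi> (f * g) = \<Phi> f \<otimes>\<^bsub>K\<^esub> \<Phi> g"
    and Phi_1: "\<Phi> 1 = \<one>\<^bsub>K\<^esub>"
    and Phi_0: "\<Phi> 0 = \<zero>\<^bsub>K\<^esub>"
begin

sublocale K: field K
  by (rule field_function_field)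

lemma Phi_eq_iff: "\<Phi> f = \<Phi> g \<longleftrightarrow> f = g"
  using Phi_bij by (auto simp: bij_betw_def inj_def)

lemma Phi_carrier [simp]: "\<Phi> f \<in> carrier K"
  using Phi_bij by (auto simp: bij_betw_def)

lemma Phi_surj: "g \<in> carrier K \<Longrightarrow> \<exists>f. g = \<Phi> f"
  using Phi_bij by (auto simp: bij_betw_def)

lemma Phi_eq_0_iff: "\<Phi> f = \<zero>\<^bsub>K\<^esub> \<longleftrightarrow> f = 0"
  unfolding Phi_0[symmetric] by (rule Phi_eq_iff)

lemma Phi_uminus: "\<Phi> (- f) = \<ominus>\<^bsub>K\<^esub> \<Phi> f"
  using Phi_add[of "- f" f] by (intro K.minus_equality[symmetric]) (simp_all add: Phi_0)

lemma Phi_inverse: "f \<noteq> 0 \<Longrightarrow> \<Phi> (inverse f) = inv\<^bsub>K\<^esub> \<Phi> f"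
  using Phi_mult[of f "inverse f"] by (intro K.comm_inv_char[symmetric]) (simp_all add: Phi_1)

lemma Phi_power: "\<Phi> (f ^ n) = \<Phi> f [^]\<^bsub>K\<^esub> n"
  by (induction n) (simp_all add: Phi_1 Phi_mult K.m_comm)

lemma Phi_power_int:
  assumes "f \<noteq> 0" shows "\<Phi> (f powi n) = \<Phi> f [^]\<^bsub>K\<^esub> n"
proof (cases "n < 0")
  case False
  then have "f powi n = f ^ nat n" by (simp add: power_int_def)
  moreover have "\<Phi> f [^]\<^bsub>K\<^esub> n = \<Phi> f [^]\<^bsub>K\<^esub> nat n"
    using False unfolding int_pow_def2 by simp
  ultimately show ?thesis by (simp only: Phi_power)
next
  case True
  then have "f powi n = inverse (f ^ nat (- n))" by (simp add: power_int_def power_inverse)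
  moreover have "\<Phi> f [^]\<^bsub>K\<^esub> n = inv\<^bsub>K\<^esub> (\<Phi> f [^]\<^bsub>K\<^esub> nat (- n))"
    using True unfolding int_pow_def2 by simp
  moreover have "\<Phi> (inverse (f ^ nat (- n))) = inv\<^bsub>K\<^esub> \<Phi> (f ^ nat (- n))"
    using assms by (intro Phi_inverse) simp
  ultimately show ?thesis by (simp only: Phi_power)
qed

definition quot :: "('n, 'a) mpol \<Rightarrow> ('n, 'a) mpol \<Rightarrow> 'f" where
  "quot F G = inv_into UNIV \<Phi> (ratfun_of V F G)"

lemma Phi_quot [simp]: "(F, G) \<in> fractions V \<Longrightarrow> \<Phi> (quot F G) = ratfun_of V F G"
  unfolding quot_def using Phi_surj by (metis carrierI f_inv_into_f rangeI)

lemma quot_eq_iff: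
  "(F, G) \<in> fractions V \<Longrightarrow> (F', G') \<in> fractions V \<Longrightarrow> quot F G = quot F' G' \<longleftrightarrow> vanishes_on V (F * G' - F' * G)"
  using Phi_eq_iff[of "quot F G" "quot F' G'"] by (simp add: ratfun_eq_iff)

lemma quot_eqI:
  assumes "(F, G) \<in> fractions V" "(F', G') \<in> fractions V"
    and "\<And>v. mpol_eval F v * mpol_eval G' v = mpol_eval F' v * mpol_eval G v"
  shows "quot F G = quot F' G'"
  using assms by (simp add: quot_eq_iff vanishes_on_def)

lemma quot_eq_0_iff: "(F, G) \<in> fractions V \<Longrightarrow> quot F G = 0 \<longleftrightarrow> vanishes_on V F"
  using Phi_eq_0_iff[of "quot F G"] by (simp add: ratfun_eq_0_iff)

lemma quot_mult:
  assumes "(F, G) \<in> fractions V" "(F', G') \<in> fractions V"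
  shows "quot F G * quot F' G' = quot (F * F') (G * G')"
proof -
  have "\<Phi> (quot F G * quot F' G') = \<Phi> (quot (F * F') (G * G'))"
    using assms by (simp add: Phi_mult mult_ratfun fractions_mult)
  then show ?thesis by (simp only: Phi_eq_iff)
qed

lemma quot_add:
  assumes "(F, G) \<in> fractions V" "(F', G') \<in> fractions V"
  shows "quot F G + quot F' G' = quot (F * G' + F' * G) (G * G')"
proof -
  have "\<Phi> (quot F G + quot F' G') = \<Phi> (quot (F * G' + F' * G) (G * G'))"
    using assms by (simp add: Phi_add add_ratfun fractions_add)
  then show ?thesis by (simp only: Phi_eq_iff)
qed

lemma quot_1 [simp]: "quot 1 1 = 1"
proof -
  have "\<Phi> (quot 1 1) = \<Phi> 1" by (simp add: Phi_1 one_ratfun)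
  then show ?thesis by (simp only: Phi_eq_iff)
qed

lemma quot_cases: obtains F G where "(F, G) \<in> fractions V" "f = quot F G"
proof -
  obtain F G where F: "(F, G) \<in> fractions V" "\<Phi> f = ratfun_of V F G" using carrierE[OF Phi_carrier[of f]] .
  then have "\<Phi> f = \<Phi> (quot F G)" by simp
  then have "f = quot F G" by (simp only: Phi_eq_iff)
  then show thesis using F that by blast
qed

definition \<iota> :: "'a \<Rightarrow> 'f" where "\<iota> c = quot (mpol_const c) 1"

sublocale alg_closed_coefficients \<iota>
proof unfold_locales
  fix a b
  show "\<iota> (a + b) = \<iota> a + \<iota> b"
    unfolding \<iota>_def quot_add[OF fractions_const fractions_const]
    by (intro quot_eqI fractions_add fractions_const) simp
  show "\<iota> (a * b) = \<iota> a * \<iota> b"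
    unfolding \<iota>_def quot_mult[OF fractions_const fractions_const]
    by (intro quot_eqI fractions_mult fractions_const) simp
  show "\<iota> 1 = 1" unfolding \<iota>_def quot_1[symmetric] by (intro quot_eqI fractions_const fractions_1) simp
qed

lemma Phi_iota: "\<Phi> (\<iota> c) = ratfun_of V (mpol_const c) 1"
  by (simp add: \<iota>_def)

lemma constant_functions_eq: "constant_functions V = range (\<lambda>c. \<Phi> (\<iota> c))"
  by (auto simp: constant_functions_def Phi_iota)

text \<open>The generic point is normalized to have this coordinate equal to \<open>1\<close>.\<close>

definition chart :: 'n where "chart = (SOME j. \<not> vanishes_on V (coordinate j))"

lemma chart: "\<not> vanishes_on V (coordinate chart)"
proof -
  obtain P where P: "P \<in> V" using irreducible unfolding zariski_irreducible_def by blast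
  then obtain v where v: "v \<in> P" using representative by blast
  then have "v \<noteq> 0" using proj_space_cases V_proj P by blast
  then obtain j where "v $ j \<noteq> 0" by (auto simp: vec_eq_iff)
  then have "\<not> vanishes_on V (coordinate j)" using P v by (auto simp: vanishes_on_def)
  then show ?thesis unfolding chart_def by (rule someI)
qed

lemma chart_power: "\<not> vanishes_on V (coordinate chart ^ n)"
proof (induction n)
  case (Suc n)
  then show ?case
    using vanishes_mult[OF homogeneous_coordinate homogeneous_power[OF homogeneous_coordinate]] chart by auto
qed simp

lemma chart_fraction: "homogeneous d F \<Longrightarrow> (F, coordinate chart ^ d) \<in> fractions V"
  using homogeneous_power[OF homogeneous_coordinate, of d chart] chart_power by (intro fractionsI[of d]) simp_all

definition y :: "'f ^ 'n" where "y = (\<chi> i. quot (coordinate i) (coordinate chart))"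

lemma coordinate_fraction: "(coordinate i, coordinate chart) \<in> fractions V"
  using chart by (intro fractionsI[of 1]) (rule homogeneous_coordinate)+

lemma quot_power: "(F, G) \<in> fractions V \<Longrightarrow> (F ^ n, G ^ n) \<in> fractions V \<and> quot F G ^ n = quot (F ^ n) (G ^ n)"
  by (induction n) (auto simp: quot_mult fractions_mult)

lemma quot_prod:
  assumes "finite I" "\<And>i. i \<in> I \<Longrightarrow> (F i, G i) \<in> fractions V"
  shows "(prod F I, prod G I) \<in> fractions V \<and> (\<Prod>i\<in>I. quot (F i) (G i)) = quot (prod F I) (prod G I)"
  using assms by (induction I rule: finite_induct) (auto simp: quot_mult fractions_mult)

lemma quot_sum:
  assumes "finite I" "\<And>i. i \<in> I \<Longrightarrow> homogeneous d (F i)" "homogeneous d G" "\<not> vanishes_on V G"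
  shows "(\<Sum>i\<in>I. quot (F i) G) = quot (sum F I) G"
  using assms(1,2)
proof (induction I rule: finite_induct)
  case empty
  have "(0, G) \<in> fractions V" using assms by (intro fractionsI[of d]) simp_all
  then show ?case using quot_eq_0_iff[of 0 G] by (simp add: vanishes_on_def)
next
  case (insert k I)
  have fr: "(F k, G) \<in> fractions V" "(sum F I, G) \<in> fractions V" "(F k + sum F I, G) \<in> fractions V"
    using assms insert.prems by (auto intro!: fractionsI[of d] homogeneous_add homogeneous_sum)
  have "(\<Sum>i\<in>insert k I. quot (F i) G) = quot (F k) G + quot (sum F I) G" using insert by simp
  also have "\<dots> = quot (F k + sum F I) G"
    unfolding quot_add[OF fr(1,2)] by (intro quot_eqI fractions_add fr) (simp add: algebra_simps)
  finally show ?case using insert.hyps by simp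
qed

lemma geval_y:
  assumes F: "homogeneous d F" shows "geval F y = quot F (coordinate chart ^ d)"
proof -
  have mono: "\<iota> c * monomial_value m y = quot (Poly_Mapping.single m c) (coordinate chart ^ d)"
    if m: "(\<Sum>i\<in>UNIV. Poly_Mapping.lookup m i) = d" for m c
  proof -
    let ?k = "Poly_Mapping.lookup m"
    have "monomial_value m y = (\<Prod>i\<in>UNIV. quot (coordinate i ^ ?k i) (coordinate chart ^ ?k i))"
      unfolding monomial_value_def y_def by (intro prod.cong) (simp_all add: quot_power[OF coordinate_fraction])
    also have "\<dots> = quot (\<Prod>i\<in>UNIV. coordinate i ^ ?k i) (\<Prod>i\<in>UNIV. coordinate chart ^ ?k i)"
      using quot_prod[of UNIV "\<lambda>i. coordinate i ^ ?k i"] quot_power[OF coordinate_fraction] by simp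
    finally have mv: "monomial_value m y = quot (\<Prod>i\<in>UNIV. coordinate i ^ ?k i) (coordinate chart ^ d)"
      by (simp add: power_sum[symmetric] m)
    have fr: "((\<Prod>i\<in>UNIV. coordinate i ^ ?k i), coordinate chart ^ d) \<in> fractions V"
      using quot_prod[of UNIV "\<lambda>i. coordinate i ^ ?k i" "\<lambda>i. coordinate chart ^ ?k i"]
        quot_power[OF coordinate_fraction] by (simp add: power_sum[symmetric] m)
    show ?thesis
      unfolding mv \<iota>_def quot_mult[OF fractions_const fr]
      by (intro quot_eqI fractions_mult fractions_const fr chart_fraction homogeneous_single m)
        (simp add: mpol_eval_prod monomial_value_def)
  qed
  have "geval F y = (\<Sum>m\<in>Poly_Mapping.keys F. quot (Poly_Mapping.single m (Poly_Mapping.lookup F m)) (coordinate chart ^ d))"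
    unfolding geval_def using F by (intro sum.cong mono) (auto simp: homogeneous_def)
  also have "\<dots> = quot (\<Sum>m\<in>Poly_Mapping.keys F. Poly_Mapping.single m (Poly_Mapping.lookup F m)) (coordinate chart ^ d)"
    using F homogeneous_power[OF homogeneous_coordinate, of d chart] chart_power
    by (intro quot_sum[of _ d]) (auto simp: homogeneous_def intro!: homogeneous_single[unfolded homogeneous_def])
  finally show ?thesis using mpol_sum_monomials[of F] by simp
qed

lemma geval_y_eq_0_iff: "homogeneous d F \<Longrightarrow> geval F y = 0 \<longleftrightarrow> vanishes_on V F"
  using geval_y quot_eq_0_iff[OF chart_fraction] by simp

lemma quot_eq:
  assumes "(F, G) \<in> fractions V" shows "quot F G = geval F y / geval G y" "geval G y \<noteq> 0"
proof -
  obtain d where d: "homogeneous d F" "homogeneous d G" "\<not> vanishes_on V G" using assms by (rule fractionsE)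
  show G: "geval G y \<noteq> 0" using d geval_y_eq_0_iff by blast
  have "quot F G * geval G y = geval F y"
    unfolding geval_y[OF d(1)] geval_y[OF d(2)] quot_mult[OF assms chart_fraction[OF d(2)]]
    by (intro quot_eqI fractions_mult assms chart_fraction d) simp
  then show "quot F G = geval F y / geval G y" using G by (simp add: field_simps)
qed

lemma generate_field_fraction:
  assumes "g \<in> generate_field K (insert (\<Phi> x) (constant_functions V))"
  shows "\<exists>p q. peval q x \<noteq> 0 \<and> g = \<Phi> (peval p x / peval q x)"
  using assms
proof (induction rule: generate_field.induct)
  case one
  show ?case by (intro exI[of _ 1]) (simp add: Phi_1)
next
  case (incl h)
  show ?case
  proof (cases "h = \<Phi> x")
    case True
    then show ?thesis by (intro exI[of _ "[:0, 1:]"] exI[of _ 1]) simp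
  next
    case False
    then obtain c where "h = \<Phi> (\<iota> c)" using incl by (auto simp: constant_functions_eq)
    then show ?thesis by (intro exI[of _ "[:c:]"] exI[of _ 1]) simp
  qed
next
  case (a_inv h)
  then obtain p q where pq: "peval q x \<noteq> 0" "h = \<Phi> (peval p x / peval q x)" by blast
  have "\<ominus>\<^bsub>K\<^esub> h = \<Phi> (peval (- p) x / peval q x)"
    unfolding pq(2) Phi_uminus[symmetric] by simp
  then show ?case using pq(1) by blast
next
  case (m_inv h)
  then obtain p q where pq: "peval q x \<noteq> 0" "h = \<Phi> (peval p x / peval q x)" by blast
  have nz: "peval p x / peval q x \<noteq> 0" using m_inv(2) pq(2) by (auto simp: Phi_0)
  have "inv\<^bsub>K\<^esub> h = \<Phi> (peval q x / peval p x)"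
    unfolding pq(2) Phi_inverse[OF nz, symmetric] by simp
  then show ?case using nz by (metis div_0)
next
  case (eng_add h1 h2)
  then obtain p q p' q' where pq: "peval q x \<noteq> 0" "h1 = \<Phi> (peval p x / peval q x)"
    "peval q' x \<noteq> 0" "h2 = \<Phi> (peval p' x / peval q' x)" by blast
  have "h1 \<oplus>\<^bsub>K\<^esub> h2 = \<Phi> (peval (p * q' + p' * q) x / peval (q * q') x)"
    unfolding pq(2,4) Phi_add[symmetric] using pq(1,3) by (simp add: add_frac_eq)
  moreover have "peval (q * q') x \<noteq> 0" using pq by simp
  ultimately show ?case by blast
next
  case (eng_mult h1 h2)
  then obtain p q p' q' where pq: "peval q x \<noteq> 0" "h1 = \<Phi> (peval p x / peval q x)"
    "peval q' x \<noteq> 0" "h2 = \<Phi> (peval p' x / peval q' x)" by blast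
  have "h1 \<otimes>\<^bsub>K\<^esub> h2 = \<Phi> (peval (p * p') x / peval (q * q') x)"
    unfolding pq(2,4) Phi_mult[symmetric] using pq(1,3) by simp
  moreover have "peval (q * q') x \<noteq> 0" using pq by simp
  ultimately show ?case by blast
qed

fun list_eval :: "'f list \<Rightarrow> 'f \<Rightarrow> 'f" where
  "list_eval [] u = 0"
| "list_eval (a # as) u = a * u ^ length as + list_eval as u"

lemma Phi_list_eval: "K.eval (map \<Phi> as) (\<Phi> u) = \<Phi> (list_eval as u)"
  by (induction as) (simp_all add: Phi_0 Phi_add Phi_mult Phi_power)

lemma common_denominator:
  assumes "\<And>a. a \<in> set as \<Longrightarrow> \<exists>p q. peval q x \<noteq> 0 \<and> a = peval p x / peval q x"
  shows "\<exists>Q. peval Q x \<noteq> 0 \<and> (\<forall>a\<in>set as. \<exists>p. a * peval Q x = peval p x)"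
  using assms
proof (induction as)
  case Nil
  show ?case by (intro exI[of _ 1]) simp
next
  case (Cons b as)
  then obtain Q where Q: "peval Q x \<noteq> 0" "\<forall>a\<in>set as. \<exists>p. a * peval Q x = peval p x" by auto
  obtain p q where pq: "peval q x \<noteq> 0" "b = peval p x / peval q x" using Cons.prems[of b] by auto
  have "\<exists>p'. a * peval (Q * q) x = peval p' x" if a: "a \<in> set (b # as)" for a
  proof (cases "a = b")
    case True
    then have "a * peval (Q * q) x = peval (Q * p) x" using pq by simp
    then show ?thesis by blast
  next
    case False
    then obtain p' where "a * peval Q x = peval p' x" using Q a by auto
    then have "a * peval (Q * q) x = peval (p' * q) x" by (simp add: mult.assoc[symmetric])
    then show ?thesis by blast
  qed
  then show ?case using Q pq by (intro exI[of _ "Q * q"]) simp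
qed

lemma list_eval_polynomial:
  assumes "\<And>b. b \<in> set (a # as) \<Longrightarrow> \<exists>p. b * w = peval p x"
  shows "\<exists>p. peval (p (length as)) x = a * w \<and> (\<Sum>i\<le>length as. peval (p i) x * u ^ i) = list_eval (a # as) u * w"
  using assms
proof (induction as arbitrary: a)
  case Nil
  then obtain p where "a * w = peval p x" by auto
  then show ?case by (intro exI[of _ "\<lambda>_. p"]) simp
next
  case (Cons b as)
  then obtain p where p: "(\<Sum>i\<le>length as. peval (p i) x * u ^ i) = list_eval (b # as) u * w"
    using Cons.IH[of b] by auto
  obtain p0 where p0: "a * w = peval p0 x" using Cons.prems by auto
  let ?n = "Suc (length as)"
  define p' where "p' = p(?n := p0)"
  have "(\<Sum>i\<le>?n. peval (p' i) x * u ^ i) = (\<Sum>i\<le>length as. peval (p' i) x * u ^ i) + peval p0 x * u ^ ?n"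
    by (simp add: p'_def)
  also have "(\<Sum>i\<le>length as. peval (p' i) x * u ^ i) = (\<Sum>i\<le>length as. peval (p i) x * u ^ i)"
    by (intro sum.cong) (auto simp: p'_def)
  also have "\<dots> + peval p0 x * u ^ ?n = list_eval (a # b # as) u * w"
    unfolding p p0[symmetric] by (simp add: algebra_simps)
  finally show ?case using p0 by (intro exI[of _ p']) (simp add: p'_def)
qed

text \<open>An algebraic equation over the field generated by \<open>x\<close> has fractions of polynomials in \<open>x\<close> as
  coefficients; they are multiplied by a common denominator. And \<open>x\<close> is not constant since constants
  are algebraic.\<close>

lemma transcendence_basis:
  obtains x where "x \<notin> range \<iota>" "\<And>u. algebraic_over x u"
proof -
  obtain x where x: "K.transcendental (constant_functions V) (\<Phi> x)"
    "\<And>g. g \<in> carrier K \<Longrightarrow> K.algebraic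
       (generate_field K (insert (\<Phi> x) (constant_functions V))) g"
    using dimension Phi_surj unfolding has_dimension_one_def by metis
  define L where "L = generate_field K (insert (\<Phi> x) (constant_functions V))"
  have "insert (\<Phi> x) (constant_functions V) \<subseteq> carrier K"
    by (auto simp: constant_functions_eq)
  then have L: "subring L K"
    unfolding L_def by (intro subfieldE(1) K.generate_field_is_subfield)
  show thesis
  proof (rule that)
    show "x \<notin> range \<iota>"
    proof
      assume "x \<in> range \<iota>"
      then obtain c where c: "x = \<iota> c" by blast
      have "K.eval (map \<Phi> [1, \<iota> (- c)]) (\<Phi> x) = \<zero>\<^bsub>K\<^esub>"
        unfolding Phi_list_eval by (simp add: c Phi_0)
      moreover have "map \<Phi> [1, \<iota> (- c)] \<in> carrier (constant_functions V [X]\<^bsub>K\<^esub>)"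
        unfolding univ_poly_carrier[symmetric] polynomial_def constant_functions_eq
        by (auto simp: Phi_eq_0_iff simp flip: iota_uminus iota_one)
      ultimately have "K.algebraic (constant_functions V) (\<Phi> x)"
        using K.algebraicI by (simp add: over_def)
      then show False using x(1) by simp
    qed
    fix u
    have "(K.algebraic over L) (\<Phi> u)" using x(2)[OF Phi_carrier] by (simp add: over_def L_def)
    from K.algebraicE[OF L Phi_carrier this]
    obtain p where p: "p \<in> carrier (L [X]\<^bsub>K\<^esub>)" "p \<noteq> []" "K.eval p (\<Phi> u) = \<zero>\<^bsub>K\<^esub>" .
    have pL: "set p \<subseteq> L" "hd p \<noteq> \<zero>\<^bsub>K\<^esub>"
      using p(1,2) unfolding univ_poly_carrier[symmetric] polynomial_def by auto
    have "\<exists>as. p = map \<Phi> as \<and> (\<forall>a\<in>set as. \<exists>p q. peval q x \<noteq> 0 \<and> a = peval p x / peval q x)"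
      using pL(1)
    proof (induction p)
      case (Cons g p)
      then obtain as where as: "p = map \<Phi> as" "\<forall>a\<in>set as. \<exists>p q. peval q x \<noteq> 0 \<and> a = peval p x / peval q x" by auto
      obtain p1 q1 where "peval q1 x \<noteq> 0" "g = \<Phi> (peval p1 x / peval q1 x)"
        using generate_field_fraction[of g x] Cons.prems by (auto simp: L_def)
      then show ?case using as by (intro exI[of _ "peval p1 x / peval q1 x # as"]) auto
    qed simp
    then obtain bs where bs: "p = map \<Phi> bs" "\<forall>a\<in>set bs. \<exists>p q. peval q x \<noteq> 0 \<and> a = peval p x / peval q x" by blast
    then obtain a as where as: "bs = a # as" using p(2) by (cases bs) auto
    have a0: "a \<noteq> 0" using pL(2) by (auto simp: bs(1) as Phi_0)
    have ev: "list_eval (a # as) u = 0" using p(3) by (simp only: bs(1) as Phi_list_eval Phi_eq_0_iff)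
    obtain Q where Q: "peval Q x \<noteq> 0" "\<forall>b\<in>set bs. \<exists>p. b * peval Q x = peval p x"
      using common_denominator[of bs x] bs(2) by blast
    obtain r where r: "peval (r (length as)) x = a * peval Q x"
      "(\<Sum>i\<le>length as. peval (r i) x * u ^ i) = list_eval (a # as) u * peval Q x"
      using list_eval_polynomial[of a as "peval Q x" x u] Q(2) unfolding as by blast
    show "algebraic_over x u"
      unfolding algebraic_over_def using r a0 Q(1) ev by (intro exI[of _ "length as"] exI[of _ r]) simp
  qed
qed

sublocale projective_curve \<iota> E y
proof unfold_locales
  show "\<exists>d. homogeneous d F" if "F \<in> E" for F using E_hom that .
  show "geval F y = 0 \<longleftrightarrow> vanishes_on (zero_locus E) F" if "homogeneous d F" for d F
    using geval_y_eq_0_iff[OF that] by (simp add: V_eq)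
  show "\<exists>d F G. homogeneous d F \<and> homogeneous d G \<and> geval G y \<noteq> 0 \<and> f = geval F y / geval G y" for f
  proof -
    obtain F G where F: "(F, G) \<in> fractions V" "f = quot F G" by (rule quot_cases)
    then show ?thesis using quot_eq[OF F(1)] by (elim fractionsE) auto
  qed
  show "alg_related s u" if "s \<noteq> 0" for s u
    using transcendence_basis algebraic_over_related[OF _ _ that] by metis
  show "\<exists>x. x \<notin> range \<iota>" using transcendence_basis by metis
  show "zero_locus E \<noteq> {}" using irreducible unfolding zariski_irreducible_def V_eq by blast
  show "vec.dim ((\<lambda>F. gradient F v) ` E) + 2 = CARD('n)" if "P \<in> zero_locus E" "v \<in> P" for P v
    using jacobian that by (simp add: V_eq)
qed

lemma Phi_mem_iff: "(F, G) \<in> \<Phi> f \<longleftrightarrow> (F, G) \<in> fractions V \<and> f = geval F y / geval G y"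
proof -
  obtain F0 G0 where F0: "(F0, G0) \<in> fractions V" "f = quot F0 G0" by (rule quot_cases)
  have "(F, G) \<in> ratfun_of V F0 G0 \<longleftrightarrow> (F, G) \<in> fractions V \<and> ratfun_of V F0 G0 = ratfun_of V F G"
  proof (cases "(F, G) \<in> fractions V")
    case True
    then show ?thesis unfolding ratfun_eq_iff[OF F0(1) True] by (simp add: ratfun_of_def)
  qed (simp add: ratfun_of_def)
  also have "\<dots> \<longleftrightarrow> (F, G) \<in> fractions V \<and> f = quot F G"
  proof (rule conj_cong[OF refl])
    assume FG: "(F, G) \<in> fractions V"
    show "ratfun_of V F0 G0 = ratfun_of V F G \<longleftrightarrow> f = quot F G"
      unfolding Phi_quot[OF F0(1), symmetric] Phi_quot[OF FG, symmetric] Phi_eq_iff F0(2)[symmetric] ..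
  qed
  also have "\<dots> \<longleftrightarrow> (F, G) \<in> fractions V \<and> f = geval F y / geval G y"
    by (rule conj_cong[OF refl]) (simp only: quot_eq(1))
  also have "ratfun_of V F0 G0 = \<Phi> f" unfolding F0(2) Phi_quot[OF F0(1)] ..
  finally show ?thesis .
qed

lemma regular_at_Phi:
  assumes P: "P \<in> V" shows "regular_at P (\<Phi> f) \<longleftrightarrow> f \<in> stalk P"
proof
  assume "regular_at P (\<Phi> f)"
  then obtain F G v where "(F, G) \<in> \<Phi> f" "v \<in> P" "mpol_eval G v \<noteq> 0" unfolding regular_at_def by blast
  then show "f \<in> stalk P" unfolding Phi_mem_iff by (auto elim!: fractionsE intro: stalkI)
next
  assume f: "f \<in> stalk P"
  obtain v where v: "v \<in> P" using representative P by blast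
  obtain d F G where F: "homogeneous d F" "homogeneous d G" "mpol_eval G v \<noteq> 0" "f = geval F y / geval G y"
    using stalk_cases[OF _ v f] P V_eq by metis
  then have "(F, G) \<in> \<Phi> f" unfolding Phi_mem_iff using P v by (auto simp: fractions_def vanishes_on_def)
  then show "regular_at P (\<Phi> f)" unfolding regular_at_def using v F by blast
qed

lemma value_at_Phi:
  assumes P: "P \<in> V" shows "value_at P (\<Phi> f) = stalk_value P f"
proof -
  have "(\<exists>(F, G)\<in>\<Phi> f. \<exists>v\<in>P. mpol_eval G v \<noteq> 0 \<and> c = mpol_eval F v / mpol_eval G v) \<longleftrightarrow>
     (\<exists>F G. (\<exists>d. homogeneous d F \<and> homogeneous d G) \<and> f = geval F y / geval G y \<and>
     (\<exists>w\<in>P. mpol_eval G w \<noteq> 0 \<and> c = mpol_eval F w / mpol_eval G w))" (is "?L \<longleftrightarrow> ?R") for c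
  proof
    assume ?L
    then obtain F G v where "(F, G) \<in> \<Phi> f" "v \<in> P" "mpol_eval G v \<noteq> 0" "c = mpol_eval F v / mpol_eval G v" by blast
    then show ?R unfolding Phi_mem_iff fractions_def by blast
  next
    assume ?R
    then obtain F G d w where *: "homogeneous d F" "homogeneous d G" "f = geval F y / geval G y" "w \<in> P"
      "mpol_eval G w \<noteq> 0" "c = mpol_eval F w / mpol_eval G w" by blast
    then have "(F, G) \<in> \<Phi> f" unfolding Phi_mem_iff using P by (auto simp: fractions_def vanishes_on_def)
    then show ?L using * by blast
  qed
  then show ?thesis unfolding value_at_def stalk_value_def by simp
qed

lemma local_ring_Phi: "P \<in> V \<Longrightarrow> \<Phi> f \<in> local_ring V P \<longleftrightarrow> f \<in> stalk P"
  by (simp add: local_ring_def regular_at_Phi)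

lemma max_ideal_Phi: "P \<in> V \<Longrightarrow> \<Phi> f \<in> max_ideal V P \<longleftrightarrow> f \<in> stalk P \<and> stalk_value P f = 0"
  by (simp add: max_ideal_def local_ring_Phi value_at_Phi)

lemma uniformizer_Phi:
  assumes P: "P \<in> V"
  shows "uniformizer V P (\<Phi> t) \<longleftrightarrow> residue_map.is_uniformizer (stalk P) (stalk_value P) t"
proof -
  interpret residue_map \<iota> "stalk P" "stalk_value P" by (rule stalk_residue_map) (use P V_eq in simp)
  have lr: "\<exists>f. g = \<Phi> f" if "g \<in> local_ring V P" for g using that Phi_surj by (auto simp: local_ring_def)
  have mi: "max_ideal V P = \<Phi> ` {f \<in> stalk P. stalk_value P f = 0}"
    using max_ideal_Phi[OF P] lr by (force simp: max_ideal_def[of V P])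
  have "{\<Phi> t \<otimes>\<^bsub>K\<^esub> g | g. g \<in> local_ring V P} = \<Phi> ` {t * a | a. a \<in> stalk P}"
  proof (intro equalityI subsetI)
    fix h assume "h \<in> {\<Phi> t \<otimes>\<^bsub>K\<^esub> g | g. g \<in> local_ring V P}"
    then obtain g where g: "g \<in> local_ring V P" "h = \<Phi> t \<otimes>\<^bsub>K\<^esub> g" by blast
    obtain a where a: "g = \<Phi> a" using lr g by blast
    then have "a \<in> stalk P" "h = \<Phi> (t * a)" using g local_ring_Phi[OF P] by (simp_all add: Phi_mult)
    then show "h \<in> \<Phi> ` {t * a | a. a \<in> stalk P}" by blast
  next
    fix h assume "h \<in> \<Phi> ` {t * a | a. a \<in> stalk P}"
    then obtain a where a: "a \<in> stalk P" "h = \<Phi> (t * a)" by blast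
    then have "\<Phi> a \<in> local_ring V P" "h = \<Phi> t \<otimes>\<^bsub>K\<^esub> \<Phi> a"
      using local_ring_Phi[OF P] by (simp_all add: Phi_mult)
    then show "h \<in> {\<Phi> t \<otimes>\<^bsub>K\<^esub> g | g. g \<in> local_ring V P}" by blast
  qed
  moreover have "inj \<Phi>" by (simp add: inj_def Phi_eq_iff)
  ultimately show ?thesis
    unfolding uniformizer_def is_uniformizer_def mi by (simp add: inj_image_eq_iff)
qed

lemma ord_at_Phi:
  assumes P: "P \<in> V" shows "ord_at V P (\<Phi> f) = val P f"
proof -
  have P': "P \<in> zero_locus E" using P V_eq by simp
  obtain w j where w: "w \<in> P" "w $ j = 1" using normalized_representative[OF P'] .
  interpret smooth_local_ring \<iota> "stalk P" "stalk_value P" "\<lambda>i. y $ i / y $ j - \<iota> (w $ i)"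
    by (rule stalk_smooth_local_ring[OF P' w])
  have "(\<exists>t u. uniformizer V P t \<and> u \<in> local_ring V P - max_ideal V P \<and>
       \<Phi> f = u \<otimes>\<^bsub>K\<^esub> (t [^]\<^bsub>K\<^esub> n)) \<longleftrightarrow>
     (\<exists>t u. is_uniformizer t \<and> u \<in> stalk P \<and> stalk_value P u \<noteq> 0 \<and> f = u * t powi n)" (is "?L \<longleftrightarrow> ?R") for n :: int
  proof
    assume ?L
    then obtain t' u' where tu: "uniformizer V P t'" "u' \<in> local_ring V P - max_ideal V P"
      "\<Phi> f = u' \<otimes>\<^bsub>K\<^esub> (t' [^]\<^bsub>K\<^esub> n)" by blast
    have "t' \<in> carrier K" using tu(1) by (simp add: uniformizer_def)
    then obtain t where t: "t' = \<Phi> t" using Phi_surj by metis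
    have "u' \<in> carrier K" using tu(2) by (simp add: local_ring_def)
    then obtain u where u: "u' = \<Phi> u" using Phi_surj by metis
    have tt: "is_uniformizer t" using tu(1) uniformizer_Phi[OF P] t by simp
    then have t0: "t \<noteq> 0" by (rule uniformizer_in(3))
    have "\<Phi> f = \<Phi> (u * t powi n)" using tu(3) unfolding t u Phi_mult Phi_power_int[OF t0] .
    then have "f = u * t powi n" by (simp only: Phi_eq_iff)
    moreover have "u \<in> stalk P" "stalk_value P u \<noteq> 0"
      using tu(2) unfolding u by (auto simp: local_ring_Phi[OF P] max_ideal_Phi[OF P])
    ultimately show ?R using tt by blast
  next
    assume ?R
    then obtain t u where tu: "is_uniformizer t" "u \<in> stalk P" "stalk_value P u \<noteq> 0" "f = u * t powi n" by blast
    have "\<Phi> f = \<Phi> u \<otimes>\<^bsub>K\<^esub> (\<Phi> t [^]\<^bsub>K\<^esub> n)"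
      unfolding tu(4) Phi_mult Phi_power_int[OF uniformizer_in(3)[OF tu(1)]] ..
    moreover have "\<Phi> u \<in> local_ring V P - max_ideal V P"
      using tu by (simp add: local_ring_Phi[OF P] max_ideal_Phi[OF P])
    ultimately show ?L using tu(1) uniformizer_Phi[OF P] by blast
  qed
  then show ?thesis unfolding ord_at_def val_def ord_def by simp
qed

lemma value_P1_Phi:
  assumes P: "P \<in> V"
  shows "value_P1 V P (\<Phi> f) = (if f \<noteq> 0 \<and> val P f < 0 then None else Some (stalk_value P f))"
  by (simp add: value_P1_def Phi_eq_0_iff ord_at_Phi[OF P] value_at_Phi[OF P])

lemma section_degree_Phi:
  assumes T: "finite T" "T \<subseteq> V" "{P. D P \<noteq> 0} \<subseteq> T" "f \<noteq> 0 \<Longrightarrow> {P \<in> V. val P f \<noteq> 0} \<subseteq> T"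
  shows "section_degree V D (\<Phi> f) = (\<Sum>P\<in>T. zero_degree D f P)"
proof (cases "f = 0")
  case True
  then show ?thesis by (simp add: section_degree_def Phi_0 zero_degree_def)
next
  case False
  let ?g = "\<lambda>P. max 0 (principal_divisor V (\<Phi> f) P + D P)"
  have sub: "{P. ?g P \<noteq> 0} \<subseteq> T"
  proof
    fix P assume P: "P \<in> {P. ?g P \<noteq> 0}"
    show "P \<in> T"
    proof (rule ccontr)
      assume "P \<notin> T"
      then have "D P = 0" "principal_divisor V (\<Phi> f) P = 0"
        using T(3) T(4)[OF False] by (auto simp: principal_divisor_def ord_at_Phi)
      then show False using P by simp
    qed
  qed
  have "section_degree V D (\<Phi> f) = (\<Sum>P | ?g P \<noteq> 0. ?g P)"
    using False by (simp add: section_degree_def div_degree_def Phi_eq_0_iff)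
  also have "\<dots> = (\<Sum>P\<in>T. ?g P)" using sub T(1) by (intro sum.mono_neutral_left) auto
  also have "\<dots> = (\<Sum>P\<in>T. zero_degree D f P)"
    using T(2) False by (intro sum.cong) (auto simp: zero_degree_def principal_divisor_def ord_at_Phi)
  finally show ?thesis .
qed

text \<open>Multiplication by \<open>h\<close> turns the order of a section \<open>f\<close> at \<open>P\<close>, which is \<open>val P f + D P\<close>, into the
  order of a function. Equal words mean a common pole or a common value.\<close>

lemma agreement_at_least:
  assumes P: "P \<in> V" and h: "h \<noteq> 0" "val P h = D P"
    and eq: "value_P1 V P (\<Phi> (h * f1)) = value_P1 V P (\<Phi> (h * f2))"
  shows "0 < pole_degree D f1 P \<and> 0 < pole_degree D f2 P \<or> at_least P (1 - D P) (f1 - f2)"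
proof -
  have P': "P \<in> zero_locus E" using P V_eq by simp
  interpret residue_map \<iota> "stalk P" "stalk_value P" by (rule stalk_residue_map[OF P'])
  have val: "val P (h * f) = D P + val P f" if "f \<noteq> 0" for f
    using val_mult[OF P' h(1) that] h(2) by simp
  let ?pole = "\<lambda>f. f \<noteq> 0 \<and> val P (h * f) < 0"
  have pole: "?pole f \<longleftrightarrow> 0 < pole_degree D f P" for f
    using val[of f] by (auto simp: pole_degree_def)
  have st: "h * f \<in> stalk P" if "\<not> ?pole f" for f
    using that h(1) val_nonneg_iff[OF P', of "h * f"] by (cases "f = 0") auto
  have iff: "?pole f1 \<longleftrightarrow> ?pole f2"
    using eq h(1) by (auto simp: value_P1_Phi[OF P] split: if_splits)
  show ?thesis
  proof (cases "?pole f1")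
    case True
    then show ?thesis using iff pole by blast
  next
    case False
    then have "h * f1 \<in> stalk P" "h * f2 \<in> stalk P" using st iff by blast+
    moreover have "stalk_value P (h * f1) = stalk_value P (h * f2)"
      using eq False iff h(1) by (auto simp: value_P1_Phi[OF P] split: if_splits)
    ultimately have *: "h * (f1 - f2) \<in> stalk P" "stalk_value P (h * (f1 - f2)) = 0"
      unfolding right_diff_distrib by simp_all
    show ?thesis
    proof (cases "f1 = f2")
      case neq: False
      then have "1 \<le> val P (h * (f1 - f2))" using val_pos_iff[OF P', of "h * (f1 - f2)"] * h(1) by simp
      then show ?thesis using val[of "f1 - f2"] neq by (simp add: at_least_def)
    qed simp
  qed
qed

theorem Phi_agreement_bound:
  assumes D: "finite {P. D P \<noteq> 0}" "{P. D P \<noteq> 0} \<subseteq> V" "div_degree D = 0"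
    and A: "finite A" "A \<subseteq> V"
    and h: "\<And>P. P \<in> A \<Longrightarrow> h P \<noteq> 0 \<and> val P (h P) = D P"
    and neq: "f1 \<noteq> f2"
    and eq: "\<And>P. P \<in> A \<Longrightarrow> value_P1 V P (\<Phi> (h P * f1)) = value_P1 V P (\<Phi> (h P * f2))"
  shows "int (card A) \<le> section_degree V D (\<Phi> f1) + section_degree V D (\<Phi> f2)"
proof -
  define supp where "supp f = (if f = 0 then {} else {P \<in> V. val P f \<noteq> 0})" for f
  have fin: "finite (supp f)" for f using v_finite[of f] by (simp add: supp_def V_eq)
  define T where "T = A \<union> {P. D P \<noteq> 0} \<union> supp f1 \<union> supp f2"
  have T: "finite T" "T \<subseteq> V" "{P. D P \<noteq> 0} \<subseteq> T" "A \<subseteq> T"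
    "f1 \<noteq> 0 \<Longrightarrow> {P \<in> V. val P f1 \<noteq> 0} \<subseteq> T" "f2 \<noteq> 0 \<Longrightarrow> {P \<in> V. val P f2 \<noteq> 0} \<subseteq> T"
    using D A fin by (auto simp: T_def supp_def)
  have "(\<Sum>P\<in>T. D P) = div_degree D"
    unfolding div_degree_def using T by (intro sum.mono_neutral_right) auto
  then have "(\<Sum>P\<in>T. D P) = 0" using D(3) by simp
  have "int (card A) \<le> (\<Sum>P\<in>T. zero_degree D f1 P) + (\<Sum>P\<in>T. zero_degree D f2 P)"
  proof (rule agreement_bound)
    show "0 < pole_degree D f1 P \<and> 0 < pole_degree D f2 P \<or> at_least P (1 - D P) (f1 - f2)" if "P \<in> A" for P
    proof (rule agreement_at_least)
      show "P \<in> V" using that A(2) by blast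
      show "h P \<noteq> 0" "val P (h P) = D P" using h[OF that] by blast+
      show "value_P1 V P (\<Phi> (h P * f1)) = value_P1 V P (\<Phi> (h P * f2))" by (rule eq[OF that])
    qed
  qed (use T neq \<open>(\<Sum>P\<in>T. D P) = 0\<close> in \<open>auto simp: V_eq[symmetric]\<close>)
  then show ?thesis using section_degree_Phi[OF T(1-3)] T(5,6) by simp
qed

end

section \<open>The agreement bound for all curves\<close>

definition smooth_projective_curve :: "('a::alg_closed_field, 'n::finite) ppoint set \<Rightarrow> bool" where
  "smooth_projective_curve V \<longleftrightarrow> zariski_irreducible V \<and> has_dimension_one V \<and>
     (\<exists>E. (\<forall>F\<in>E. \<exists>d. homogeneous d F) \<and> V = zero_locus E \<and>
        (\<forall>P\<in>V. \<forall>v\<in>P. vec.dim ((\<lambda>F. gradient F v) ` E) + 2 = CARD('n)))"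

text \<open>What is needed of a curve, stated with the record \<open>function_field V\<close> alone and thus for all
  curves in the same type.\<close>

definition agreement_principle :: "('a::alg_closed_field, 'n::finite) ppoint set \<Rightarrow> bool" where
  "agreement_principle V \<longleftrightarrow>
     (\<forall>P\<in>V. \<forall>f\<in>carrier (function_field V). f \<noteq> \<zero>\<^bsub>function_field V\<^esub> \<longrightarrow> 0 \<le> ord_at V P f \<longrightarrow> regular_at P f) \<and>
     (\<forall>D A h f1 f2. finite {P. D P \<noteq> 0} \<longrightarrow> {P. D P \<noteq> 0} \<subseteq> V \<longrightarrow> div_degree D = 0 \<longrightarrow>
        finite A \<longrightarrow> A \<subseteq> V \<longrightarrow>
        (\<forall>P\<in>A. h P \<in> carrier (function_field V) \<and> h P \<noteq> \<zero>\<^bsub>function_field V\<^esub> \<and> ord_at V P (h P) = D P) \<longrightarrow>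
        f1 \<in> carrier (function_field V) \<longrightarrow> f2 \<in> carrier (function_field V) \<longrightarrow> f1 \<noteq> f2 \<longrightarrow>
        (\<forall>P\<in>A. value_P1 V P (h P \<otimes>\<^bsub>function_field V\<^esub> f1) = value_P1 V P (h P \<otimes>\<^bsub>function_field V\<^esub> f2)) \<longrightarrow>
        int (card A) \<le> section_degree V D f1 + section_degree V D f2)"

lemma (in function_field_iso) agreement_principle: "agreement_principle V"
  unfolding agreement_principle_def
proof (intro conjI allI impI ballI)
  fix P f assume P: "P \<in> V" and f: "f \<in> carrier (function_field V)" "f \<noteq> \<zero>\<^bsub>function_field V\<^esub>" "0 \<le> ord_at V P f"
  obtain g where g: "f = \<Phi> g" using Phi_surj[OF f(1)] by blast
  have "g \<noteq> 0" using f(2) by (simp add: g Phi_eq_0_iff)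
  then show "regular_at P f"
    using f(3) val_nonneg_iff[of P g] P unfolding g ord_at_Phi[OF P] regular_at_Phi[OF P] by (simp add: V_eq)
next
  fix D :: "('a, 'n) ppoint \<Rightarrow> int" and A h f1 f2
  assume D: "finite {P. D P \<noteq> 0}" "{P. D P \<noteq> 0} \<subseteq> V" "div_degree D = 0" and A: "finite A" "A \<subseteq> V"
    and h: "\<forall>P\<in>A. h P \<in> carrier (function_field V) \<and> h P \<noteq> \<zero>\<^bsub>function_field V\<^esub> \<and> ord_at V P (h P) = D P"
    and f1: "f1 \<in> carrier (function_field V)" and f2: "f2 \<in> carrier (function_field V)" and neq: "f1 \<noteq> f2"
    and eq: "\<forall>P\<in>A. value_P1 V P (h P \<otimes>\<^bsub>function_field V\<^esub> f1) = value_P1 V P (h P \<otimes>\<^bsub>function_field V\<^esub> f2)"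
  obtain g1 g2 where g: "f1 = \<Phi> g1" "f2 = \<Phi> g2" using Phi_surj f1 f2 by metis
  have "\<forall>P\<in>A. \<exists>k. h P = \<Phi> k" using h Phi_surj by blast
  then obtain k where k: "\<And>P. P \<in> A \<Longrightarrow> h P = \<Phi> (k P)" by metis
  show "int (card A) \<le> section_degree V D f1 + section_degree V D f2"
    unfolding g
  proof (rule Phi_agreement_bound[OF D A])
    show "k P \<noteq> 0 \<and> val P (k P) = D P" if "P \<in> A" for P
    proof -
      have "P \<in> V" using that A(2) by blast
      then show ?thesis using bspec[OF h that] by (simp add: k[OF that] Phi_eq_0_iff ord_at_Phi)
    qed
    show "g1 \<noteq> g2" using neq g by blast
    show "value_P1 V P (\<Phi> (k P * g1)) = value_P1 V P (\<Phi> (k P * g2))" if "P \<in> A" for P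
      using bspec[OF eq that] by (simp add: k[OF that] g Phi_mult)
  qed
qed

text \<open>This provides a value for the choice below in the case that there is no counterexample.\<close>

lemma point_irreducible:
  fixes i :: "'n::finite"
  defines "P \<equiv> proj_point (axis i (1 :: 'a::field))"
  shows "zariski_closed {P}" "zariski_irreducible {P}"
proof -
  have mem: "(axis i 1 :: 'a ^ 'n) \<in> P" unfolding P_def by (rule proj_point_mem)
  have P: "P \<in> proj_space" unfolding P_def proj_space_def by (auto simp: axis_eq_0_iff)
  have "{P} = zero_locus (coordinate ` (UNIV - {i}))"
  proof (intro equalityI subsetI)
    fix Q assume "Q \<in> {P}"
    then show "Q \<in> zero_locus (coordinate ` (UNIV - {i}))"
      using P by (auto simp: zero_locus_def P_def proj_point_def axis_def)
  next
    fix Q :: "('a, 'n) ppoint" assume Q: "Q \<in> zero_locus (coordinate ` (UNIV - {i}))"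
    then obtain v where v: "v \<noteq> 0" "Q = proj_point v" by (auto simp: zero_locus_def proj_space_def)
    have z: "v $ k = 0" if "k \<noteq> i" for k
    proof -
      have "coordinate k \<in> coordinate ` (UNIV - {i})" using that by blast
      then have "mpol_eval (coordinate k) v = 0" using Q proj_point_mem[of v] v(2) unfolding zero_locus_def by blast
      then show ?thesis by simp
    qed
    then have "v = (v $ i) *s axis i 1" by (simp add: vec_eq_iff axis_def)
    moreover from this have "v $ i \<noteq> 0" using v(1) by (metis vector_smult_lzero)
    ultimately have "v \<in> P" unfolding P_def proj_point_def by blast
    then show "Q \<in> {P}" using proj_point_eq v(2) unfolding P_def by blast
  qed
  moreover have "\<forall>F\<in>coordinate ` (UNIV - {i}). \<exists>d. homogeneous d (F :: ('n, 'a) mpol)"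
    by (intro ballI) (metis homogeneous_coordinate imageE)
  ultimately show "zariski_closed {P}"
    unfolding zariski_closed_def by (intro exI[of _ "coordinate ` (UNIV - {i})"] conjI)
  show "zariski_irreducible {P}" unfolding zariski_irreducible_def by auto
qed

text \<open>A type cannot depend on a variable curve. So the function field is turned into a type for a single
  curve, which is chosen as a counterexample to the agreement principle if there is any. As the
  principle can be proved for the curve with this type, there is none.\<close>

definition critical_curve :: "('a::alg_closed_field, 'n::finite) ppoint set" where
  "critical_curve = (SOME V. zariski_closed V \<and> zariski_irreducible V \<and>
     ((\<exists>W :: ('a, 'n) ppoint set. smooth_projective_curve W \<and> \<not> agreement_principle W) \<longrightarrow>
       smooth_projective_curve V \<and> \<not> agreement_principle V))"

lemma smooth_projective_curve_irreducible:
  "smooth_projective_curve V \<Longrightarrow> zariski_closed V \<and> zariski_irreducible V"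
  unfolding smooth_projective_curve_def zariski_closed_def by blast

lemma critical_curve:
  "zariski_closed (critical_curve :: ('a::alg_closed_field, 'n::finite) ppoint set)"
  "zariski_irreducible (critical_curve :: ('a, 'n) ppoint set)"
  "(\<exists>W :: ('a, 'n) ppoint set. smooth_projective_curve W \<and> \<not> agreement_principle W) \<Longrightarrow>
    smooth_projective_curve (critical_curve :: ('a, 'n) ppoint set) \<and>
    \<not> agreement_principle (critical_curve :: ('a, 'n) ppoint set)"
proof -
  let ?Q = "\<lambda>V :: ('a, 'n) ppoint set. zariski_closed V \<and> zariski_irreducible V \<and>
     ((\<exists>W :: ('a, 'n) ppoint set. smooth_projective_curve W \<and> \<not> agreement_principle W) \<longrightarrow>
       smooth_projective_curve V \<and> \<not> agreement_principle V)"
  have "\<exists>V. ?Q V"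
  proof (cases "\<exists>W :: ('a, 'n) ppoint set. smooth_projective_curve W \<and> \<not> agreement_principle W")
    case True
    then show ?thesis using smooth_projective_curve_irreducible by blast
  next
    case False
    then show ?thesis using point_irreducible[of undefined] by blast
  qed
  then have "?Q critical_curve" unfolding critical_curve_def by (rule someI_ex)
  then show "zariski_closed (critical_curve :: ('a, 'n) ppoint set)"
    "zariski_irreducible (critical_curve :: ('a, 'n) ppoint set)"
    "(\<exists>W :: ('a, 'n) ppoint set. smooth_projective_curve W \<and> \<not> agreement_principle W) \<Longrightarrow>
      smooth_projective_curve (critical_curve :: ('a, 'n) ppoint set) \<and>
      \<not> agreement_principle (critical_curve :: ('a, 'n) ppoint set)"
    by blast+
qed

interpretation critical: irreducible_variety critical_curve
  by unfold_locales (rule critical_curve)+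

interpretation critical_ring: cring "function_field critical_curve"
  by (rule critical.cring_function_field)

typedef (overloaded) ('a, 'n) critical_field =
    "carrier (function_field (critical_curve :: ('a::alg_closed_field, 'n::finite) ppoint set))"
  by (rule exI[of _ "\<zero>\<^bsub>function_field critical_curve\<^esub>"]) simp

lemma Rep_carrier [simp]: "Rep_critical_field f \<in> carrier (function_field critical_curve)"
  by (rule Rep_critical_field)

lemma Rep_Abs [simp]:
  "f \<in> carrier (function_field critical_curve) \<Longrightarrow> Rep_critical_field (Abs_critical_field f) = f"
  by (rule Abs_critical_field_inverse)

instantiation critical_field :: (alg_closed_field, finite) field
begin

definition zero_critical_field :: "('a, 'b) critical_field" where
  "0 = Abs_critical_field \<zero>\<^bsub>function_field critical_curve\<^esub>"

definition one_critical_field :: "('a, 'b) critical_field" where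
  "1 = Abs_critical_field \<one>\<^bsub>function_field critical_curve\<^esub>"

definition plus_critical_field :: "('a, 'b) critical_field \<Rightarrow> ('a, 'b) critical_field \<Rightarrow> ('a, 'b) critical_field" where
  "f + g = Abs_critical_field (Rep_critical_field f \<oplus>\<^bsub>function_field critical_curve\<^esub> Rep_critical_field g)"

definition times_critical_field :: "('a, 'b) critical_field \<Rightarrow> ('a, 'b) critical_field \<Rightarrow> ('a, 'b) critical_field" where
  "f * g = Abs_critical_field (Rep_critical_field f \<otimes>\<^bsub>function_field critical_curve\<^esub> Rep_critical_field g)"

definition uminus_critical_field :: "('a, 'b) critical_field \<Rightarrow> ('a, 'b) critical_field" where
  "- f = Abs_critical_field (\<ominus>\<^bsub>function_field critical_curve\<^esub> Rep_critical_field f)"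

definition minus_critical_field :: "('a, 'b) critical_field \<Rightarrow> ('a, 'b) critical_field \<Rightarrow> ('a, 'b) critical_field" where
  "f - g = f + (- g :: ('a, 'b) critical_field)"

definition inverse_critical_field :: "('a, 'b) critical_field \<Rightarrow> ('a, 'b) critical_field" where
  "inverse f = (if f = 0 then 0 else Abs_critical_field (inv\<^bsub>function_field critical_curve\<^esub> Rep_critical_field f))"

definition divide_critical_field :: "('a, 'b) critical_field \<Rightarrow> ('a, 'b) critical_field \<Rightarrow> ('a, 'b) critical_field" where
  "f div g = f * (inverse g :: ('a, 'b) critical_field)"

lemma Rep_zero: "Rep_critical_field (0 :: ('a, 'b) critical_field) = \<zero>\<^bsub>function_field critical_curve\<^esub>"
  by (simp add: zero_critical_field_def)

lemma Rep_one: "Rep_critical_field (1 :: ('a, 'b) critical_field) = \<one>\<^bsub>function_field critical_curve\<^esub>"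
  by (simp add: one_critical_field_def)

lemma Rep_plus: "Rep_critical_field (f + g) =
    Rep_critical_field f \<oplus>\<^bsub>function_field critical_curve\<^esub> Rep_critical_field (g :: ('a, 'b) critical_field)"
  by (simp add: plus_critical_field_def)

lemma Rep_times: "Rep_critical_field (f * g) =
    Rep_critical_field f \<otimes>\<^bsub>function_field critical_curve\<^esub> Rep_critical_field (g :: ('a, 'b) critical_field)"
  by (simp add: times_critical_field_def)

lemma Rep_uminus: "Rep_critical_field (- f :: ('a, 'b) critical_field) = \<ominus>\<^bsub>function_field critical_curve\<^esub> Rep_critical_field f"
  by (simp add: uminus_critical_field_def)

instance
proof
  fix f g h :: "('a, 'b) critical_field"
  let ?R = "Rep_critical_field :: ('a, 'b) critical_field \<Rightarrow> _"
  show "f * g * h = f * (g * h)"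
    by (rule Rep_critical_field_inject[THEN iffD1]) (simp add: Rep_times critical_ring.m_assoc)
  show "f * g = g * f"
    by (rule Rep_critical_field_inject[THEN iffD1]) (simp add: Rep_times critical_ring.m_comm)
  show "1 * f = f"
    by (rule Rep_critical_field_inject[THEN iffD1]) (simp add: Rep_times Rep_one)
  show "f + g + h = f + (g + h)"
    by (rule Rep_critical_field_inject[THEN iffD1]) (simp add: Rep_plus critical_ring.a_assoc)
  show "f + g = g + f"
    by (rule Rep_critical_field_inject[THEN iffD1]) (simp add: Rep_plus critical_ring.a_comm)
  show "0 + f = f"
    by (rule Rep_critical_field_inject[THEN iffD1]) (simp add: Rep_plus Rep_zero)
  show "- f + f = 0"
    by (rule Rep_critical_field_inject[THEN iffD1]) (simp add: Rep_plus Rep_zero Rep_uminus critical_ring.l_neg)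
  show "f - g = f + - g" by (rule minus_critical_field_def)
  show "(f + g) * h = f * h + g * h"
    by (rule Rep_critical_field_inject[THEN iffD1]) (simp add: Rep_plus Rep_times critical_ring.l_distr)
  show "(0 :: ('a, 'b) critical_field) \<noteq> 1"
  proof
    assume "(0 :: ('a, 'b) critical_field) = 1"
    then have "?R 0 = ?R 1" by (rule arg_cong)
    then show False
      unfolding Rep_zero Rep_one using domain.one_not_zero[OF field.axioms(1)[OF critical.field_function_field]] by metis
  qed
  show "inverse (0 :: ('a, 'b) critical_field) = 0" by (simp add: inverse_critical_field_def)
  show "f div g = f * inverse g" by (rule divide_critical_field_def)
  show "inverse f * f = 1" if "f \<noteq> 0"
  proof -
    have "?R f \<noteq> ?R 0" using that by (simp add: Rep_critical_field_inject)
    then have U: "?R f \<in> Units (function_field critical_curve)"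
      by (simp add: field.field_Units[OF critical.field_function_field] Rep_zero)
    have "?R (inverse f) = inv\<^bsub>function_field critical_curve\<^esub> ?R f"
      using that U by (simp add: inverse_critical_field_def)
    then have "?R (inverse f * f) = ?R 1" using U by (simp add: Rep_times Rep_one)
    then show ?thesis by (simp only: Rep_critical_field_inject)
  qed
qed

end

theorem curve_agreement_principle:
  fixes V :: "('a::alg_closed_field, 'n::finite) ppoint set"
  assumes "smooth_projective_curve V"
  shows "agreement_principle V"
proof (rule ccontr)
  let ?C = "critical_curve :: ('a, 'n) ppoint set"
  assume "\<not> agreement_principle V"
  then have C: "smooth_projective_curve ?C" "\<not> agreement_principle ?C" using critical_curve(3) assms by blast+
  obtain E where E: "\<forall>F\<in>E. \<exists>d. homogeneous d F" "?C = zero_locus E"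
    "\<forall>P\<in>?C. \<forall>v\<in>P. vec.dim ((\<lambda>F. gradient F v) ` E) + 2 = CARD('n)" "has_dimension_one ?C"
    using C(1) unfolding smooth_projective_curve_def by blast
  interpret function_field_iso ?C E Rep_critical_field
  proof unfold_locales
    show "bij_betw (Rep_critical_field :: ('a, 'n) critical_field \<Rightarrow> _) UNIV (carrier (function_field ?C))"
      by (rule bij_betwI[where g = Abs_critical_field]) (simp_all add: Rep_critical_field_inverse)
  qed (use E in \<open>simp_all add: Rep_plus Rep_times Rep_one Rep_zero\<close>)
  show False using agreement_principle C(2) by blast
qed

section \<open>Values at rational points\<close>

lemma coefficient_field_to_ac: "coefficient_field to_ac"
  by unfold_locales simp_all

definition frobenius :: "'k::{field,finite} alg_closure \<Rightarrow> 'k alg_closure" where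
  "frobenius x = x ^ CARD('k)"

lemma finite_field_fermat: "(x :: 'k::{field,finite}) ^ CARD('k) = x"
proof (cases "x = 0")
  case False
  have "bij_betw ((*) x) (UNIV - {0}) (UNIV - {0})"
    by (rule bij_betwI[where g = "\<lambda>y. y / x"]) (use False in auto)
  then have "(\<Prod>y\<in>UNIV - {0}. y) = (\<Prod>y\<in>UNIV - {0}. x * y)" by (rule prod.reindex_bij_betw[symmetric])
  also have "\<dots> = x ^ card (UNIV - {0 :: 'k}) * (\<Prod>y\<in>UNIV - {0}. y)" by (simp add: prod.distrib)
  finally have "x ^ card (UNIV - {0 :: 'k}) = 1" by simp
  moreover have "CARD('k) = Suc (card (UNIV - {0 :: 'k}))"
    using card_Suc_Diff1[of UNIV "0 :: 'k"] by (simp only: finite_class.finite_UNIV UNIV_I)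
  ultimately show ?thesis by (simp only: power_Suc mult_1_right)
qed simp

text \<open>The polynomial \<open>(T + 1) ^ q - T ^ q - 1\<close> vanishes on the field with \<open>q\<close> elements and has degree less
  than \<open>q\<close>. So it is zero, and the identity holds in every extension.\<close>

lemma frobenius_add: "frobenius (x + y) = frobenius x + frobenius (y :: 'k::{field,finite} alg_closure)"
proof -
  interpret coefficient_field "to_ac :: 'k \<Rightarrow> _" by (rule coefficient_field_to_ac)
  let ?q = "CARD('k)"
  define p :: "'k poly" where "p = [:1, 1:] ^ ?q + (- ([:0, 1:] ^ ?q) + - 1)"
  have q0: "?q > 0" by simp
  have "degree p < ?q"
  proof (rule degree_lessI)
    show "\<forall>k\<ge>?q. coeff p k = 0"
    proof (intro allI impI)
      fix k assume k: "?q \<le> k"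
      have deg: "degree ([:1, 1:] ^ ?q :: 'k poly) = ?q" "degree ([:0, 1:] ^ ?q :: 'k poly) = ?q"
        by (simp_all add: degree_power_eq)
      show "coeff p k = 0"
      proof (cases "k = ?q")
        case True
        have "coeff ([:1, 1:] ^ ?q :: 'k poly) ?q = 1" "coeff ([:0, 1:] ^ ?q :: 'k poly) ?q = 1"
          using lead_coeff_power[of "[:1, 1:] :: 'k poly" ?q] lead_coeff_power[of "[:0, 1:] :: 'k poly" ?q] deg by simp_all
        then show ?thesis using True q0 by (simp add: p_def)
      next
        case False
        then show ?thesis using k deg by (simp add: p_def coeff_eq_0)
      qed
    qed
  qed simp
  moreover have "{x. poly p x = 0} = UNIV" by (auto simp: p_def finite_field_fermat)
  ultimately have "p = 0" using card_poly_roots_bound[of p] by fastforce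
  have one: "(z + 1) ^ ?q = z ^ ?q + 1" for z :: "'k alg_closure"
  proof -
    have "peval p z = (z + 1) ^ ?q + (- (z ^ ?q) + - 1)"
      unfolding p_def peval_add peval_uminus peval_power peval_one by (simp add: add.commute)
    then show ?thesis using \<open>p = 0\<close> by (simp add: eq_neg_iff_add_eq_0 algebra_simps)
  qed
  show ?thesis
  proof (cases "y = 0")
    case True
    then show ?thesis by (simp add: frobenius_def)
  next
    case False
    then have "(x + y) ^ ?q = (y * (x / y + 1)) ^ ?q" by (simp add: field_simps)
    also have "\<dots> = y ^ ?q * ((x / y) ^ ?q + 1)" by (simp only: power_mult_distrib one)
    also have "\<dots> = x ^ ?q + y ^ ?q" using False by (simp add: power_divide field_simps)
    finally show ?thesis by (simp add: frobenius_def)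
  qed
qed

lemma coefficient_field_frobenius: "coefficient_field (frobenius :: 'k::{field,finite} alg_closure \<Rightarrow> _)"
  by unfold_locales (simp_all add: frobenius_add, simp_all add: frobenius_def power_mult_distrib)

lemma frobenius_to_ac: "frobenius (to_ac a) = to_ac (a :: 'k::{field,finite})"
  by (simp add: frobenius_def finite_field_fermat flip: to_ac_power)

text \<open>The elements of the finite field are already \<open>q\<close> roots of \<open>T ^ q - T\<close>.\<close>

lemma frobenius_fixed:
  assumes "frobenius c = (c :: 'k::{field,finite} alg_closure)" shows "c \<in> range to_ac"
proof -
  let ?q = "CARD('k)"
  define p :: "'k alg_closure poly" where "p = monom 1 ?q - monom 1 1"
  have "card {0, 1 :: 'k} \<le> ?q" by (rule card_mono) auto
  then have q1: "?q > 1" by simp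
  have "coeff p ?q = 1" using q1 by (simp add: p_def)
  then have p0: "p \<noteq> 0" by auto
  have roots: "poly p x = 0 \<longleftrightarrow> frobenius x = x" for x by (simp add: p_def poly_monom frobenius_def)
  have "degree p \<le> ?q" unfolding p_def using q1 by (intro degree_diff_le) (auto simp: degree_monom_eq)
  then have "card {x. poly p x = 0} \<le> ?q" using card_poly_roots_bound[OF p0] by simp
  moreover have "card (range (to_ac :: 'k \<Rightarrow> _)) = ?q" by (simp add: card_image inj_to_ac)
  moreover have "range to_ac \<subseteq> {x. poly p x = 0}" using frobenius_to_ac by (auto simp: roots)
  ultimately have "range to_ac = {x. poly p x = 0}"
    using poly_roots_finite[OF p0] by (metis card_seteq)
  then show ?thesis using assms roots by blast
qed

lemma frobenius_surj: "\<exists>x. frobenius x = (y :: 'k::{field,finite} alg_closure)"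
  unfolding frobenius_def by (rule nth_root_exists) simp

lemma mpol_eval_map:
  assumes "coefficient_field h"
  shows "mpol_eval (Poly_Mapping.map h F) w = coefficient_field.geval h F w"
proof -
  interpret coefficient_field h by (rule assms)
  have l: "Poly_Mapping.lookup (Poly_Mapping.map h F) m = h (Poly_Mapping.lookup F m)" for m
    by (simp add: Poly_Mapping.map.rep_eq when_def)
  have k: "Poly_Mapping.keys (Poly_Mapping.map h F) \<subseteq> Poly_Mapping.keys F"
    using l iota_zero by (metis in_keys_iff subsetI)
  show ?thesis
    unfolding geval_def
    using coefficient_field.geval_superset[OF coefficient_field_id finite_keys k] by (simp add: geval_id l)
qed

lemma homogeneous_map:
  assumes "coefficient_field h" "homogeneous d F" shows "homogeneous d (Poly_Mapping.map h F)"
proof -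
  interpret coefficient_field h by (rule assms(1))
  have "Poly_Mapping.keys (Poly_Mapping.map h F) \<subseteq> Poly_Mapping.keys F"
    by (auto simp: in_keys_iff Poly_Mapping.map.rep_eq when_def)
  then show ?thesis using assms(2) by (auto simp: homogeneous_def)
qed

lemma (in coefficient_field) geval_image:
  "geval F (\<chi> i. \<iota> (w $ i)) = \<iota> (mpol_eval F w)"
  unfolding geval_def mpol_eval_monomials by (simp add: iota_sum monomial_value_def iota_prod)

definition frobenius_vec :: "'k::{field,finite} alg_closure ^ 'n \<Rightarrow> 'k alg_closure ^ 'n::finite" where
  "frobenius_vec w = (\<chi> i. frobenius (w $ i))"

lemma frobenius_vec_surj: "\<exists>w'. frobenius_vec w' = w"
proof -
  have "\<forall>i. \<exists>x. frobenius x = w $ i" using frobenius_surj by blast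
  then obtain g where "\<And>i. frobenius (g i) = w $ i" by metis
  then show ?thesis by (intro exI[of _ "vec_lambda g"]) (simp add: frobenius_vec_def vec_eq_iff)
qed

text \<open>This holds for polynomials with coefficients in the finite field and, unlike that condition on the
  coefficients, passes to products at once.\<close>

definition frobenius_stable :: "('n::finite, 'k::{field,finite} alg_closure) mpol \<Rightarrow> bool" where
  "frobenius_stable F \<longleftrightarrow> (\<forall>w. mpol_eval F (frobenius_vec w) = frobenius (mpol_eval F w))"

lemma mpol_eval_map_frobenius:
  "mpol_eval (Poly_Mapping.map frobenius F) (frobenius_vec w) = frobenius (mpol_eval F w)"
  unfolding mpol_eval_map[OF coefficient_field_frobenius] frobenius_vec_def
  by (rule coefficient_field.geval_image[OF coefficient_field_frobenius])

lemma frobenius_stable_base_change: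
  fixes F :: "('n::finite, 'k::{field,finite}) mpol"
  shows "frobenius_stable (base_change F)"
  unfolding frobenius_stable_def
proof
  fix w :: "'k alg_closure ^ 'n"
  interpret coefficient_field "frobenius :: 'k alg_closure \<Rightarrow> _" by (rule coefficient_field_frobenius)
  have mon: "monomial_value m (frobenius_vec w) = frobenius (monomial_value m w)" for m
    by (simp add: monomial_value_def frobenius_vec_def iota_prod)
  show "mpol_eval (base_change F) (frobenius_vec w) = frobenius (mpol_eval (base_change F) w)"
    unfolding base_change_def mpol_eval_map[OF coefficient_field_to_ac]
    by (simp add: coefficient_field.geval_def[OF coefficient_field_to_ac] iota_sum mon frobenius_to_ac)
qed

lemma frobenius_stable_mult: "frobenius_stable F \<Longrightarrow> frobenius_stable G \<Longrightarrow> frobenius_stable (F * G)"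
  by (simp add: frobenius_stable_def coefficient_field.iota_mult[OF coefficient_field_frobenius])

lemma (in irreducible_variety) value_at_eq:
  assumes P: "P \<in> V" "v \<in> P" and F: "(F, G) \<in> fractions V" "mpol_eval G v \<noteq> 0"
  shows "value_at P (ratfun_of V F G) = mpol_eval F v / mpol_eval G v"
  unfolding value_at_def
proof (rule the_equality)
  show "\<exists>(F', G')\<in>ratfun_of V F G. \<exists>w\<in>P. mpol_eval G' w \<noteq> 0 \<and> mpol_eval F v / mpol_eval G v = mpol_eval F' w / mpol_eval G' w"
    using ratfun_mem[OF F(1)] P F by blast
  fix c assume "\<exists>(F', G')\<in>ratfun_of V F G. \<exists>w\<in>P. mpol_eval G' w \<noteq> 0 \<and> c = mpol_eval F' w / mpol_eval G' w"
  then obtain F' G' w where F': "(F', G') \<in> ratfun_of V F G" "w \<in> P" "mpol_eval G' w \<noteq> 0"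
    "c = mpol_eval F' w / mpol_eval G' w" by blast
  obtain d where d: "homogeneous d F" "homogeneous d G" using F(1) by (rule fractionsE)
  have "mpol_eval G w \<noteq> 0" using homogeneous_zero_iff[OF d(2) V_proj[OF P(1)] P(2) F'(2)] F(2) by blast
  moreover have "mpol_eval (F * G' - F' * G) w = 0"
    using F'(1,2) P(1) unfolding ratfun_of_def vanishes_on_def by blast
  ultimately have "c = mpol_eval F w / mpol_eval G w" using F'(3,4) by (simp add: frac_eq_eq)
  then show "c = mpol_eval F v / mpol_eval G v"
    using homogeneous_ratio_eq[OF d V_proj[OF P(1)] F'(2) P(2)] by simp
qed

text \<open>A rational function over the finite field may be regular at a rational point only by a fraction
  with coefficients in the algebraic closure. But applying Frobenius to this fraction
  gives another one of the same function, and so the value is fixed by Frobenius.\<close>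

lemma value_at_rational:
  fixes E :: "('n::finite, 'k::{field,finite}) mpol set"
  assumes V: "irreducible_variety V" "V = zero_locus (base_change ` E)"
    and E: "\<And>F. F \<in> E \<Longrightarrow> \<exists>d. homogeneous d F"
    and FG: "(F, G) \<in> fractions V" "frobenius_stable F" "frobenius_stable G"
    and P: "P \<in> V" "v \<in> P" "\<And>i. v $ i \<in> range to_ac" and reg: "regular_at P (ratfun_of V F G)"
  shows "value_at P (ratfun_of V F G) \<in> range to_ac"
proof -
  interpret irreducible_variety V by (rule V(1))
  interpret fr: coefficient_field "frobenius :: 'k alg_closure \<Rightarrow> _" by (rule coefficient_field_frobenius)
  have fv: "frobenius_vec v = v"
  proof -
    have "frobenius (v $ i) = v $ i" for i using P(3)[of i] frobenius_to_ac by (metis imageE)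
    then show ?thesis by (simp add: frobenius_vec_def vec_eq_iff)
  qed
  obtain F' G' w where F': "(F', G') \<in> ratfun_of V F G" "w \<in> P" "mpol_eval G' w \<noteq> 0"
    using reg unfolding regular_at_def by blast
  note mem = ratfun_memD[OF FG(1) F'(1)]
  obtain d where d: "homogeneous d F'" "homogeneous d G'" using mem(1) by (rule fractionsE)
  have G'v: "mpol_eval G' v \<noteq> 0" using homogeneous_zero_iff[OF d(2) V_proj[OF P(1)] P(2) F'(2)] F'(3) by blast
  have val: "value_at P (ratfun_of V F G) = mpol_eval F' v / mpol_eval G' v"
    using value_at_eq[OF P(1,2) mem(1) G'v] mem(2) by simp
  let ?F = "Poly_Mapping.map frobenius F'" and ?G = "Poly_Mapping.map frobenius G'"
  have ev: "mpol_eval ?F v = frobenius (mpol_eval F' v)" "mpol_eval ?G v = frobenius (mpol_eval G' v)"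
    using mpol_eval_map_frobenius[of _ v] by (simp_all add: fv)
  then have Gv: "mpol_eval ?G v \<noteq> 0" using G'v by simp
  have fr': "(?F, ?G) \<in> fractions V"
    using homogeneous_map[OF coefficient_field_frobenius] d Gv P(1,2)
    by (intro fractionsI[of d]) (auto simp: vanishes_on_def)
  have "vanishes_on V (F * ?G - ?F * G)"
    unfolding vanishes_on_def
  proof (intro ballI)
    fix Q w assume Q: "Q \<in> V" "w \<in> Q"
    obtain w' where w': "frobenius_vec w' = w" using frobenius_vec_surj by blast
    have w0: "w \<noteq> 0" using proj_space_cases V_proj Q by blast
    have "w' \<noteq> 0"
    proof
      assume "w' = 0"
      then have "w = 0" unfolding w'[symmetric] by (simp add: frobenius_vec_def vec_eq_iff)
      then show False using w0 by simp
    qed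
    then have proj: "proj_point w' \<in> proj_space" unfolding proj_space_def by blast
    have "mpol_eval (base_change H) u = 0" if H: "H \<in> E" and u: "u \<in> proj_point w'" for H u
    proof -
      have "mpol_eval (base_change H) w = 0" using Q H by (auto simp: V(2) zero_locus_def)
      then have "frobenius (mpol_eval (base_change H) w') = 0"
        using frobenius_stable_base_change[of H] w' unfolding frobenius_stable_def by metis
      then have *: "mpol_eval (base_change H) w' = 0" by simp
      obtain e where "homogeneous e H" using E H by blast
      then have "homogeneous e (base_change H)"
        unfolding base_change_def by (rule homogeneous_map[OF coefficient_field_to_ac])
      then show ?thesis using homogeneous_zero_iff[OF _ proj proj_point_mem u] * by blast
    qed
    then have "proj_point w' \<in> V" using proj by (auto simp: V(2) zero_locus_def)
    then have "mpol_eval (F * G' - F' * G) w' = 0"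
      using F'(1) proj_point_mem unfolding ratfun_of_def vanishes_on_def by blast
    then have "frobenius (mpol_eval F w' * mpol_eval G' w') = frobenius (mpol_eval F' w' * mpol_eval G w')" by simp
    moreover have "mpol_eval F w = frobenius (mpol_eval F w')" "mpol_eval G w = frobenius (mpol_eval G w')"
      using FG(2,3) unfolding frobenius_stable_def w'[symmetric] by blast+
    moreover have "mpol_eval ?F w = frobenius (mpol_eval F' w')" "mpol_eval ?G w = frobenius (mpol_eval G' w')"
      unfolding w'[symmetric] by (rule mpol_eval_map_frobenius)+
    ultimately show "mpol_eval (F * ?G - ?F * G) w = 0" by simp
  qed
  then have "ratfun_of V ?F ?G = ratfun_of V F G" using ratfun_eq_iff[OF FG(1) fr'] by simp
  then have val': "value_at P (ratfun_of V F G) = mpol_eval ?F v / mpol_eval ?G v"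
    using value_at_eq[OF P(1,2) fr' Gv] by simp
  have "frobenius (value_at P (ratfun_of V F G)) = frobenius (mpol_eval F' v / mpol_eval G' v)"
    by (simp only: val)
  also have "\<dots> = value_at P (ratfun_of V F G)" unfolding val' ev by simp
  finally show ?thesis by (rule frobenius_fixed)
qed

section \<open>Words and minimal distance\<close>

lemma curve_geom_points:
  fixes E :: "('n::finite, 'k::field) mpol set"
  assumes "curve E"
  shows "smooth_projective_curve (geom_points E)"
  unfolding smooth_projective_curve_def
proof (intro conjI exI[of _ "base_change ` E"])
  show "\<forall>F\<in>base_change ` E. \<exists>d. homogeneous d F"
    using assms homogeneous_map[OF coefficient_field_to_ac] unfolding curve_def base_change_def by blast
qed (use assms in \<open>auto simp: curve_def smooth_dim_one_def image_image geom_points_def\<close>)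

theorem proposition1:
  fixes E :: "('n::finite, 'k::{field,finite}) mpol set"
    and V :: "('k alg_closure, 'n) ppoint set"
    and P :: "nat \<Rightarrow> ('k alg_closure, 'n) ppoint"
    and \<phi> :: "nat \<Rightarrow> ('n, 'k alg_closure) ratfun"
    and D :: "('k alg_closure, 'n) ppoint \<Rightarrow> int"
    and N :: nat
  assumes C: "curve E"
    and V: "V = geom_points E"
    and points: "bij_betw P {1..N} (rational_points E)"
    and D: "divisor E D" "div_degree D = 0"
    and \<phi>: "\<And>i. i \<in> {1..N} \<Longrightarrow> \<phi> i \<in> rational_functions E \<and> \<phi> i \<noteq> \<zero>\<^bsub>function_field V\<^esub> \<and>
              principal_divisor V (\<phi> i) (P i) = D (P i)"
  shows "(\<forall>f1 \<in> rational_functions E. \<forall>f2 \<in> rational_functions E. f1 \<noteq> f2 \<longrightarrow>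
            (\<forall>i\<in>{1..N}. word V P \<phi> f1 i \<in> P1_rational \<and> word V P \<phi> f2 i \<in> P1_rational) \<and>
            int (card {i \<in> {1..N}. word V P \<phi> f1 i = word V P \<phi> f2 i})
              \<le> section_degree V D f1 + section_degree V D f2) \<and>
         (\<forall>h::int. 0 \<le> h \<and> real_of_int h < real N / 2 \<longrightarrow>
            enat (nat (int N - 2 * h)) \<le> minimal_distance N (word V P \<phi>) (section_code E D h))"
proof -
  have smooth: "smooth_projective_curve V" using curve_geom_points[OF C] V by simp
  interpret irreducible_variety V
    using smooth_projective_curve_irreducible[OF smooth] by unfold_locales blast+
  have principle: "agreement_principle V" by (rule curve_agreement_principle[OF smooth])
  have E: "\<exists>d. homogeneous d F" if "F \<in> E" for F using C that by (auto simp: curve_def)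
  have PV: "P i \<in> V" "\<exists>v\<in>P i. \<forall>j. v $ j \<in> range to_ac" if "i \<in> {1..N}" for i
    using bij_betwE[OF points] that by (auto simp: rational_points_def V)
  have carr: "f \<in> carrier (function_field V)" if "f \<in> rational_functions E" for f
    using that by (auto simp: rational_functions_def V[symmetric])
  have rational: "word V P \<phi> f i \<in> P1_rational" if f: "f \<in> rational_functions E" and i: "i \<in> {1..N}" for f i
  proof -
    obtain F G where F: "f = ratfun_of V (base_change F) (base_change G)" "(base_change F, base_change G) \<in> fractions V"
      using f by (auto simp: rational_functions_def V[symmetric])
    obtain F' G' where F': "\<phi> i = ratfun_of V (base_change F') (base_change G')" "(base_change F', base_change G') \<in> fractions V"
      using \<phi>[OF i] by (auto simp: rational_functions_def V[symmetric])
    obtain v where v: "v \<in> P i" "\<And>j. v $ j \<in> range to_ac" using PV(2)[OF i] by blast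
    define g where "g = \<phi> i \<otimes>\<^bsub>function_field V\<^esub> f"
    have g: "g = ratfun_of V (base_change F' * base_change F) (base_change G' * base_change G)"
      unfolding g_def F F' by (rule mult_ratfun[OF F'(2) F(2)])
    have fr: "(base_change F' * base_change F, base_change G' * base_change G) \<in> fractions V"
      by (rule fractions_mult[OF F'(2) F(2)])
    have gc: "g \<in> carrier (function_field V)" unfolding g by (rule carrierI[OF fr])
    have "value_P1 V (P i) g \<in> P1_rational"
    proof (cases "g \<noteq> \<zero>\<^bsub>function_field V\<^esub> \<and> ord_at V (P i) g < 0")
      case True
      then show ?thesis by (simp add: value_P1_def P1_rational_def)
    next
      case False
      have "regular_at (P i) g"
      proof (cases "g = \<zero>\<^bsub>function_field V\<^esub>")
        case True
        then have "(0, 1) \<in> g" using ratfun_mem[OF fractions_0] by (simp add: zero_ratfun)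
        then show ?thesis unfolding regular_at_def using v(1) by (intro bexI[of _ "(0, 1)"]) auto
      next
        case g0: False
        then show ?thesis using False principle gc PV(1)[OF i] unfolding agreement_principle_def by simp
      qed
      then have "value_at (P i) g \<in> range to_ac"
        unfolding g
        by (intro value_at_rational[where E = E and v = v])
          (use E fr PV(1)[OF i] v in \<open>auto simp: V geom_points_def irreducible_variety_axioms[unfolded V geom_points_def]
            intro!: frobenius_stable_mult frobenius_stable_base_change\<close>)
      then show ?thesis using False by (auto simp: value_P1_def P1_rational_def)
    qed
    then show ?thesis by (simp add: word_def g_def)
  qed
  have bound: "int (card {i \<in> {1..N}. word V P \<phi> f1 i = word V P \<phi> f2 i})
      \<le> section_degree V D f1 + section_degree V D f2"
    if f: "f1 \<in> rational_functions E" "f2 \<in> rational_functions E" "f1 \<noteq> f2" for f1 f2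
  proof -
    define I where "I = {i \<in> {1..N}. word V P \<phi> f1 i = word V P \<phi> f2 i}"
    \<comment> \<open>the principle expects the trivializations to be indexed by points\<close>
    define h where "h Q = \<phi> (the_inv_into {1..N} P Q)" for Q
    have inj: "inj_on P {1..N}" using points by (rule bij_betw_imp_inj_on)
    have hP: "h (P i) = \<phi> i" if "i \<in> {1..N}" for i
      unfolding h_def using inj that by (simp only: the_inv_into_f_f)
    have I: "I \<subseteq> {1..N}" by (auto simp: I_def)
    have "int (card (P ` I)) \<le> section_degree V D f1 + section_degree V D f2"
    proof (rule principle[unfolded agreement_principle_def, THEN conjunct2, rule_format])
      show "finite {P. D P \<noteq> 0}" "{P. D P \<noteq> 0} \<subseteq> V" using D(1) by (auto simp: divisor_def V)
      show "div_degree D = 0" by (rule D(2))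
      show "finite (P ` I)" using I by (meson finite_atLeastAtMost finite_imageI finite_subset)
      show "P ` I \<subseteq> V" using PV(1) I by blast
      show "f1 \<in> carrier (function_field V)" "f2 \<in> carrier (function_field V)" "f1 \<noteq> f2" using f carr by auto
    next
      fix Q assume "Q \<in> P ` I"
      then obtain i where i: "i \<in> I" "Q = P i" by blast
      then have iN: "i \<in> {1..N}" using I by blast
      show "h Q \<in> carrier (function_field V) \<and> h Q \<noteq> \<zero>\<^bsub>function_field V\<^esub> \<and> ord_at V Q (h Q) = D Q"
        using \<phi>[OF iN] carr PV(1)[OF iN] by (simp add: i(2) hP[OF iN] principal_divisor_def)
      show "value_P1 V Q (h Q \<otimes>\<^bsub>function_field V\<^esub> f1) = value_P1 V Q (h Q \<otimes>\<^bsub>function_field V\<^esub> f2)"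
        using i(1) by (simp add: i(2) hP[OF iN] I_def word_def)
    qed
    also have "card (P ` I) = card I" using inj I by (intro card_image) (rule inj_on_subset)
    finally show ?thesis by (simp add: I_def)
  qed
  have "enat (nat (int N - 2 * h)) \<le> minimal_distance N (word V P \<phi>) (section_code E D h)" for h :: int
    unfolding minimal_distance_def
  proof (rule Inf_greatest)
    fix x assume "x \<in> {enat (hamming_dist N (word V P \<phi> f) (word V P \<phi> g)) | f g.
        f \<in> section_code E D h \<and> g \<in> section_code E D h \<and> f \<noteq> g}"
    then obtain f g where x: "x = enat (hamming_dist N (word V P \<phi> f) (word V P \<phi> g))"
      and fg: "f \<in> section_code E D h" "g \<in> section_code E D h" "f \<noteq> g" by blast
    let ?A = "{i \<in> {1..N}. word V P \<phi> f i = word V P \<phi> g i}"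
    let ?B = "{i \<in> {1..N}. word V P \<phi> f i \<noteq> word V P \<phi> g i}"
    have "card (?A \<union> ?B) = card ?A + card ?B" by (rule card_Un_disjoint) auto
    moreover have "?A \<union> ?B = {1..N}" by blast
    ultimately have "N = card ?A + card ?B" by (metis card_atLeastAtMost diff_Suc_1)
    moreover have "int (card ?A) \<le> 2 * h"
      using bound[of f g] fg by (simp add: section_code_def V[symmetric])
    ultimately show "enat (nat (int N - 2 * h)) \<le> x" by (simp add: x hamming_dist_def)
  qed
  then show ?thesis using rational bound by blast
qed

end
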